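(* The variety of $6$-dimensional nilpotent anticommutative $\mathfrak{CD}$-algebras over $\mathbb{C}$ has exactly three irreducible components, defined by the family of algebras $\mathbf{M}_6^{\epsilon}$ ($\epsilon\in\mathbb{C}$) and the rigid algebras $\mathbf{B}^1_{6,1}$ and $g_6$ (that is, the irreducible components are the Zariski closure of the union of the orbits of the algebras $\mathbf{M}_6^{\epsilon}$, $\epsilon\in\mathbb{C}$, and the Zariski closures of the orbits of $\mathbf{B}^1_{6,1}$ and of $g_6$, the latter two algebras being rigid in this variety), where, in a basis $e_1,\dots,e_6$, - $\mathbf{M}_6^{\epsilon}$: $[e_1,e_2]=e_3$, $[e_1,e_3]=e_5$, $[e_1,e_5]=e_6$, $[e_2,e_4]=\epsilon e_5$, $[e_3,e_4]=e_6$; - $\mathbf{B}_{6,1}^{1}$: $[e_{1},e_{2}]=e_{4}$, $[e_{1},e_{3}]=e_{5}$, $[e_{2},e_{3}]=e_{6}$, $[e_{4},e_{5}]=e_{6}$; - $g_{6}$: $[e_1,e_2]=e_3$, $[e_1,e_3]=e_4$, $[e_1,e_4]=e_5$, $[e_2,e_3]=e_5$, $[e_2,e_5]=e_6$, $[e_3,e_4]=-e_6$.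
   Context: An anticommutative algebra ($[x,x]=0$ for all $x$) is specified by giving only the nonzero products among basis elements, with $[e_j,e_i]=-[e_i,e_j]$ understood. Set $A^{1}=A$, $A^{n+1}=[A^{n},A^{1}]+[A^{n-1},A^{2}]+\cdots+[A^{1},A^{n}]$; $A$ is nilpotent if $A^{n}=0$ for some $n$. An algebra $A$ is a $\mathfrak{CD}$-algebra if every commutator of two multiplication operators is a derivation: $T_xT_y-T_yT_x\in\mathfrak{Der}(A)$ for all $x,y\in A$ and all $T_z\in\{R_z,L_z\}$, where $R_z,L_z$ are right and left multiplication by $z$ and $\mathfrak{Der}(A)$ is the Lie algebra of derivations of $A$. For an anticommutative algebra this is equivalent to the single identity $$[[[x,y],a],b]-[[[x,y],b],a]=[[[x,a],b],y]-[[[x,b],a],y]+[x,[[y,a],b]]-[x,[[y,b],a]].$$ Let $V$ be a $6$-dimensional complex vector space. The space $\mathrm{Hom}(V\otimes V,V)$ of algebra structures on $V$ is identified, via structure constants in a fixed basis, with the affine space $\mathbb{C}^{6^3}$ with its Zariski topology. The variety of $6$-dimensional nilpotent anticommutative $\mathfrak{CD}$-algebras is the Zariski-closed subset $\mathbb{L}$ of those structures that are nilpotent anticommutative $\mathfrak{CD}$-algebras. The group $\mathrm{GL}(V)$ acts on $\mathbb{L}$ by $(g*\mu)(x\otimes y)=g\mu(g^{-1}x\otimes g^{-1}y)$; the orbits $O(\mu)$ correspond to isomorphism classes of algebras. An algebra represented by $\mu\in\mathbb{L}$ is rigid in $\mathbb{L}$ if $O(\mu)$ is open in $\mathbb{L}$;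 equivalently, $\overline{O(\mu)}$ (Zariski closure) is an irreducible component of $\mathbb{L}$. An irreducible component is a maximal irreducible closed subset. *)

theory Defs
  imports "HOL-Analysis.Analysis"
begin

section \<open>The Zariski topology on affine space\<close>

inductive poly_map :: "('k::field ^ 'n \<Rightarrow> 'k) \<Rightarrow> bool" where
  const: "poly_map (\<lambda>x. c)"
| coord: "poly_map (\<lambda>x. x $ i)"
| add: "poly_map p \<Longrightarrow> poly_map q \<Longrightarrow> poly_map (\<lambda>x. p x + q x)"
| mult: "poly_map p \<Longrightarrow> poly_map q \<Longrightarrow> poly_map (\<lambda>x. p x * q x)"

definition zero_locus :: "('k::field ^ 'n \<Rightarrow> 'k) set \<Rightarrow> ('k ^ 'n) set" where
  "zero_locus P = {x. \<forall>p\<in>P. p x = 0}"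

definition zariski :: "('k::field ^ 'n) topology" where
  "zariski = topology (\<lambda>U. \<exists>P \<subseteq> Collect poly_map. - U = zero_locus P)"

lemma zero_locus_Un:
  "zero_locus P \<union> zero_locus Q = zero_locus {\<lambda>x. p x * q x | p q. p \<in> P \<and> q \<in> Q}"
  unfolding zero_locus_def by fastforce

lemma istopology_zariski:
  "istopology (\<lambda>U::('k::field ^ 'n) set. \<exists>P \<subseteq> Collect poly_map. - U = zero_locus P)"
  unfolding istopology_def
proof (intro conjI allI impI)
  fix S T :: "('k ^ 'n) set"
  assume "\<exists>P \<subseteq> Collect poly_map. - S = zero_locus P"
    and "\<exists>P \<subseteq> Collect poly_map. - T = zero_locus P"
  then obtain P Q where P: "P \<subseteq> Collect poly_map" "- S = zero_locus P"
    and Q: "Q \<subseteq> Collect poly_map" "- T = zero_locus Q"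
    by blast
  let ?R = "{\<lambda>x. p x * q x | p q. p \<in> P \<and> q \<in> Q}"
  have "?R \<subseteq> Collect poly_map"
    using P(1) Q(1) by (auto intro: poly_map.mult)
  moreover have "- (S \<inter> T) = zero_locus ?R"
    using P(2) Q(2) by (simp add: Compl_Int zero_locus_Un)
  ultimately show "\<exists>P \<subseteq> Collect poly_map. - (S \<inter> T) = zero_locus P"
    by blast
next
  fix K :: "('k ^ 'n) set set"
  assume "\<forall>U\<in>K. \<exists>P \<subseteq> Collect poly_map. - U = zero_locus P"
  then obtain P where P: "\<And>U. U \<in> K \<Longrightarrow> P U \<subseteq> Collect poly_map \<and> - U = zero_locus (P U)"
    by metis
  have "x \<in> - \<Union>K \<longleftrightarrow> x \<in> zero_locus (\<Union>U\<in>K. P U)" for x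
  proof -
    have "x \<in> - \<Union>K \<longleftrightarrow> (\<forall>U\<in>K. x \<in> - U)"
      by blast
    also have "\<dots> \<longleftrightarrow> (\<forall>U\<in>K. x \<in> zero_locus (P U))"
      using P by simp
    also have "\<dots> \<longleftrightarrow> x \<in> zero_locus (\<Union>U\<in>K. P U)"
      by (simp add: zero_locus_def)
    finally show ?thesis .
  qed
  then have "- \<Union>K = zero_locus (\<Union>U\<in>K. P U)"
    by (rule set_eqI)
  moreover have "(\<Union>U\<in>K. P U) \<subseteq> Collect poly_map"
    using P by blast
  ultimately show "\<exists>P \<subseteq> Collect poly_map. - \<Union>K = zero_locus P"
    by blast
qed

lemma openin_zariski:
  "openin zariski U \<longleftrightarrow> (\<exists>P \<subseteq> Collect poly_map. - U = zero_locus P)"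
  unfolding zariski_def by (simp add: topology_inverse'[OF istopology_zariski])

lemma topspace_zariski [simp]: "topspace zariski = UNIV"
proof -
  have "- UNIV = zero_locus {\<lambda>x::'a ^ 'b. 1}"
    by (simp add: zero_locus_def)
  then have "openin (zariski :: ('a ^ 'b) topology) UNIV"
    unfolding openin_zariski by (blast intro: poly_map.const)
  then show ?thesis
    by (auto dest: openin_subset)
qed

lemma closedin_zariski:
  "closedin zariski C \<longleftrightarrow> (\<exists>P \<subseteq> Collect poly_map. C = zero_locus P)"
  by (simp add: closedin_def openin_zariski Compl_eq_Diff_UNIV[symmetric])

section \<open>Irreducible components of a topological space\<close>

definition irreducible_in :: "'a topology \<Rightarrow> 'a set \<Rightarrow> bool" where
  "irreducible_in X S \<longleftrightarrow> S \<subseteq> topspace X \<and> S \<noteq> {} \<and>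
     (\<forall>C D. closedin X C \<and> closedin X D \<and> S \<subseteq> C \<union> D \<longrightarrow> S \<subseteq> C \<or> S \<subseteq> D)"

definition irreducible_components :: "'a topology \<Rightarrow> 'a set set" where
  "irreducible_components X =
     {C. closedin X C \<and> irreducible_in X C \<and>
         (\<forall>D. closedin X D \<and> irreducible_in X D \<and> C \<subseteq> D \<longrightarrow> D = C)}"

section \<open>Algebra structures given by structure constants\<close>

text \<open>
  The coordinate \<open>\<mu> $ (i, j, k)\<close> is the coefficient of the \<open>k\<close>-th basis vector in the
  product of the \<open>i\<close>-th and the \<open>j\<close>-th one.
\<close>

type_synonym ('k, 'n) alg = "'k ^ ('n \<times> 'n \<times> 'n)"

definition bracket :: "('k::field, 'n::finite) alg \<Rightarrow> 'k ^ 'n \<Rightarrow> 'k ^ 'n \<Rightarrow> 'k ^ 'n" where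
  "bracket \<mu> x y = (\<chi> k. \<Sum>i\<in>UNIV. \<Sum>j\<in>UNIV. x $ i * y $ j * \<mu> $ (i, j, k))"

definition anticommutative :: "('k::field, 'n::finite) alg \<Rightarrow> bool" where
  "anticommutative \<mu> \<longleftrightarrow> (\<forall>x. bracket \<mu> x x = 0)"

text \<open>
  \<open>alg_power \<mu> n\<close> is the \<open>n\<close>-th power of the algebra for \<open>n \<ge> 1\<close>; the value at \<open>0\<close> is junk.
  \<^const>\<open>vec.span\<close> is the span over the ground field, whereas \<^const>\<open>span\<close> would be the real span.
\<close>

function alg_power :: "('k::field, 'n::finite) alg \<Rightarrow> nat \<Rightarrow> ('k ^ 'n) set" where
  "alg_power \<mu> n =
     (if n \<le> 1 then UNIV
      else vec.span (\<Union>i\<in>{1..<n}. {bracket \<mu> x y | x y. x \<in> alg_power \<mu> i \<and> y \<in> alg_power \<mu> (n - i)}))"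
  by pat_completeness auto
termination
  by (relation "Wellfounded.measure snd") auto

declare alg_power.simps [simp del]

definition nilpotent :: "('k::field, 'n::finite) alg \<Rightarrow> bool" where
  "nilpotent \<mu> \<longleftrightarrow> (\<exists>n\<ge>1. alg_power \<mu> n = {0})"

definition left_mult :: "('k::field, 'n::finite) alg \<Rightarrow> 'k ^ 'n \<Rightarrow> 'k ^ 'n \<Rightarrow> 'k ^ 'n" where
  "left_mult \<mu> z = (\<lambda>x. bracket \<mu> z x)"

definition right_mult :: "('k::field, 'n::finite) alg \<Rightarrow> 'k ^ 'n \<Rightarrow> 'k ^ 'n \<Rightarrow> 'k ^ 'n" where
  "right_mult \<mu> z = (\<lambda>x. bracket \<mu> x z)"

definition derivations :: "('k::field, 'n::finite) alg \<Rightarrow> ('k ^ 'n \<Rightarrow> 'k ^ 'n) set" where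
  "derivations \<mu> =
     {D. Vector_Spaces.linear (*s) (*s) D \<and>
         (\<forall>x y. D (bracket \<mu> x y) = bracket \<mu> (D x) y + bracket \<mu> x (D y))}"

definition CD_algebra :: "('k::field, 'n::finite) alg \<Rightarrow> bool" where
  "CD_algebra \<mu> \<longleftrightarrow>
     (\<forall>x y. \<forall>S \<in> {right_mult \<mu> x, left_mult \<mu> x}. \<forall>T \<in> {right_mult \<mu> y, left_mult \<mu> y}.
        (\<lambda>v. S (T v) - T (S v)) \<in> derivations \<mu>)"

definition nilpotent_anticomm_CD :: "('k::field, 'n::finite) alg set" where
  "nilpotent_anticomm_CD = {\<mu>. nilpotent \<mu> \<and> anticommutative \<mu> \<and> CD_algebra \<mu>}"

section \<open>The action of the general linear group\<close>

abbreviation basis_vec :: "'n \<Rightarrow> 'k::field ^ 'n::finite" (\<open>\<e>\<close>) where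
  "\<e> i \<equiv> axis i 1"

definition gl_act :: "'k ^ 'n ^ 'n \<Rightarrow> ('k::field, 'n::finite) alg \<Rightarrow> ('k, 'n) alg" where
  "gl_act g \<mu> =
     (\<chi> p. case p of (i, j, k) \<Rightarrow> (g *v bracket \<mu> (matrix_inv g *v \<e> i) (matrix_inv g *v \<e> j)) $ k)"

definition orbit :: "('k::field, 'n::finite) alg \<Rightarrow> ('k, 'n) alg set" where
  "orbit \<mu> = {gl_act g \<mu> | g. invertible g}"

definition rigid_in :: "('k::field, 'n::finite) alg set \<Rightarrow> ('k, 'n) alg \<Rightarrow> bool" where
  "rigid_in L \<mu> \<longleftrightarrow> \<mu> \<in> L \<and> openin (subtopology zariski L) (orbit \<mu>)"

lemma bracket_axis: "bracket \<mu> (\<e> i) (\<e> j) $ k = \<mu> $ (i, j, k)"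
proof -
  have "\<e> i $ a * \<e> j $ b * c = (if a = i then if b = j then c else 0 else 0)" for a b and c :: 'a
    by (simp add: axis_def)
  moreover have "(\<Sum>b\<in>UNIV. if a = i then if b = j then c b else 0 else 0) = (if a = i then c j else 0)"
    for a and c :: "'b \<Rightarrow> 'a"
    by simp
  ultimately show ?thesis
    by (simp add: bracket_def)
qed

lemma bracket_expand: "bracket \<mu> x y = (\<Sum>i\<in>UNIV. \<Sum>j\<in>UNIV. (x $ i * y $ j) *s bracket \<mu> (\<e> i) (\<e> j))"
  by (simp add: vec_eq_iff bracket_axis) (simp add: bracket_def)

lemma linear_bracket_left: "Vector_Spaces.linear (*s) (*s) (\<lambda>x. bracket \<mu> x y)"
  by unfold_locales
    (simp_all add: vec_eq_iff bracket_def algebra_simps sum.distrib sum_distrib_left)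

lemma linear_bracket_right: "Vector_Spaces.linear (*s) (*s) (\<lambda>y. bracket \<mu> x y)"
  by unfold_locales
    (simp_all add: vec_eq_iff bracket_def algebra_simps sum.distrib sum_distrib_left)

lemma bracket_gl_act:
  "bracket (gl_act g \<mu>) x y = g *v bracket \<mu> (matrix_inv g *v x) (matrix_inv g *v y)"
proof -
  let ?h = "matrix_inv g"
  define f where "f = (\<lambda>x y. g *v bracket \<mu> (?h *v x) (?h *v y))"
  have lin1: "Vector_Spaces.linear (*s) (*s) (\<lambda>x. f x y)" for y
    unfolding f_def
    using Vector_Spaces.linear_compose[OF Vector_Spaces.linear_compose[OF
        matrix_vector_mul_linear_gen[of ?h] linear_bracket_left[of \<mu> "?h *v y"]]
        matrix_vector_mul_linear_gen[of g]]
    by (simp add: o_def)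
  have lin2: "Vector_Spaces.linear (*s) (*s) (f x)" for x
    unfolding f_def
    using Vector_Spaces.linear_compose[OF Vector_Spaces.linear_compose[OF
        matrix_vector_mul_linear_gen[of ?h] linear_bracket_right[of \<mu> "?h *v x"]]
        matrix_vector_mul_linear_gen[of g]]
    by (simp add: o_def)
  have basis: "bracket (gl_act g \<mu>) (\<e> i) (\<e> j) = f (\<e> i) (\<e> j)" for i j
    by (simp add: vec_eq_iff bracket_axis gl_act_def f_def)
  have "f x y = f (\<Sum>i\<in>UNIV. x $ i *s \<e> i) (\<Sum>j\<in>UNIV. y $ j *s \<e> j)"
    by (simp add: basis_expansion)
  also have "\<dots> = (\<Sum>i\<in>UNIV. x $ i *s f (\<e> i) (\<Sum>j\<in>UNIV. y $ j *s \<e> j))"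
    by (simp add: vec.linear_sum[OF lin1] vec.linear_scale[OF lin1])
  also have "\<dots> = (\<Sum>i\<in>UNIV. x $ i *s (\<Sum>j\<in>UNIV. y $ j *s f (\<e> i) (\<e> j)))"
    by (simp add: vec.linear_sum[OF lin2] vec.linear_scale[OF lin2])
  also have "\<dots> = (\<Sum>i\<in>UNIV. \<Sum>j\<in>UNIV. (x $ i * y $ j) *s f (\<e> i) (\<e> j))"
    by (simp add: vec.scale_sum_right)
  also have "\<dots> = bracket (gl_act g \<mu>) x y"
    by (subst bracket_expand) (simp add: basis)
  finally show ?thesis
    by (simp add: f_def)
qed

section \<open>Anticommutative algebras given by a table of products\<close>

text \<open>
  An entry \<open>(i, j, v)\<close> stands for \<open>[e\<^sub>i, e\<^sub>j] = v\<close> together with \<open>[e\<^sub>j, e\<^sub>i] = -v\<close>; products not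
  listed vanish. A table lists each unordered pair \<open>i \<noteq> j\<close> at most once.
\<close>

definition anticomm_table :: "('n \<times> 'n \<times> ('k ^ 'n)) list \<Rightarrow> ('k::field, 'n::finite) alg" where
  "anticomm_table t =
     (\<chi> p. case p of (i, j, k) \<Rightarrow> \<Sum>(a, b, v)\<leftarrow>t.
        (if (i, j) = (a, b) then v $ k else if (i, j) = (b, a) then - v $ k else 0))"

text \<open>
  In the index type \<^typ>\<open>6\<close> the numerals \<open>1, \<dots>, 6\<close> are the six distinct elements (with \<open>6 = 0\<close>).
\<close>

definition M6 :: "complex \<Rightarrow> (complex, 6) alg" where
  "M6 \<epsilon> = anticomm_table
     [(1, 2, \<e> 3), (1, 3, \<e> 5), (1, 5, \<e> 6), (2, 4, \<epsilon> *s \<e> 5), (3, 4, \<e> 6)]"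

definition B61 :: "(complex, 6) alg" where
  "B61 = anticomm_table [(1, 2, \<e> 4), (1, 3, \<e> 5), (2, 3, \<e> 6), (4, 5, \<e> 6)]"

definition g6 :: "(complex, 6) alg" where
  "g6 = anticomm_table
     [(1, 2, \<e> 3), (1, 3, \<e> 4), (1, 4, \<e> 5), (2, 3, \<e> 5), (2, 5, \<e> 6), (3, 4, - \<e> 6)]"

lemma
  "bracket (M6 \<epsilon>) (\<e> 1) (\<e> 2) = \<e> 3" "bracket (M6 \<epsilon>) (\<e> 1) (\<e> 3) = \<e> 5"
  "bracket (M6 \<epsilon>) (\<e> 1) (\<e> 5) = \<e> 6" "bracket (M6 \<epsilon>) (\<e> 2) (\<e> 4) = \<epsilon> *s \<e> 5"
  "bracket (M6 \<epsilon>) (\<e> 3) (\<e> 4) = \<e> 6" "bracket (M6 \<epsilon>) (\<e> 2) (\<e> 1) = - \<e> 3"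
  "bracket (M6 \<epsilon>) (\<e> 4) (\<e> 2) = - (\<epsilon> *s \<e> 5)" "bracket (M6 \<epsilon>) (\<e> 4) (\<e> 5) = 0"
  unfolding vec_eq_iff bracket_axis M6_def anticomm_table_def by simp_all

lemma
  "bracket B61 (\<e> 1) (\<e> 2) = \<e> 4" "bracket B61 (\<e> 1) (\<e> 3) = \<e> 5"
  "bracket B61 (\<e> 2) (\<e> 3) = \<e> 6" "bracket B61 (\<e> 4) (\<e> 5) = \<e> 6"
  unfolding vec_eq_iff bracket_axis B61_def anticomm_table_def by simp_all

lemma
  "bracket g6 (\<e> 1) (\<e> 2) = \<e> 3" "bracket g6 (\<e> 1) (\<e> 3) = \<e> 4"
  "bracket g6 (\<e> 1) (\<e> 4) = \<e> 5" "bracket g6 (\<e> 2) (\<e> 3) = \<e> 5"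
  "bracket g6 (\<e> 2) (\<e> 5) = \<e> 6" "bracket g6 (\<e> 3) (\<e> 4) = - \<e> 6"
  unfolding vec_eq_iff bracket_axis g6_def anticomm_table_def by simp_all

end

theory Submission
  imports Defs "HOL-Computational_Algebra.Polynomial"
begin

text \<open>
  A nilpotent algebra has a flag of ideals, so every point of the variety lies in the orbit of a
  structure that is strictly upper triangular in the standard basis; there are twenty structure
  constants. The CD-identity restricts them so much that elementary changes of basis move each
  such structure into one of three explicitly parametrised irreducible sets: one in which
  \<open>[A\<^sup>2, A]\<close> is spanned by \<open>e\<^sub>6\<close>, one consisting of metabelian algebras, and one consisting of
  Lie algebras. Their generic members are isomorphic to \<open>B61\<close>, to some \<open>M6 \<epsilon>\<close> and to \<open>g6\<close>
  respectively, and joining an arbitrary member to a generic one by a polynomial curve puts each set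
  into the corresponding orbit closure. The vanishing of \<open>[[[x, y], s], t]\<close>, being metabelian and the
  Jacobi identity are closed conditions that keep the three closures apart. Since the group acts by
  homeomorphisms, an orbit is open as soon as it contains one nonempty open subset of the variety,
  and such a subset is given by the nonvanishing of an explicit polynomial.
\<close>

section \<open>Polynomial maps and Zariski closures\<close>

text \<open>No dimension is ever counted. Density and irreducibility both rest on the fact that two
  polynomials in one complex variable have zero product only if one of them is zero. The obstacle in
  the rigidity proofs is that the normal forms live in a basis depending on the structure, whereas a
  test polynomial is a function of all structures in the standard basis. The tests are therefore
  built from iterated brackets of the fixed vectors \<open>\<e> 1\<close>, \<open>\<e> 2\<close>,
  \<open>\<e> 3\<close>. A change of basis to a normal form turns these into arbitrary vectors, so
  the tests are analysed for arbitrary arguments and only assert that certain brackets are nonzero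
  or independent, which no change of basis disturbs. The parameter of \<open>M6\<close> is the ratio
  \<open>q5 * u / (a3 * r6)\<close> that remains after a generic member of \<open>type_M\<close> has
  been normalised. The normalisation breaks down at ratio 1, which is harmless because only generic
  members have to be normalised. The square root of \<open>c / \<kappa>\<close> in the normalisation
  to \<open>B61\<close> and the common zeros of curves and determinants are where complex numbers
  enter.\<close>

lemma poly_map_uminus: "poly_map p \<Longrightarrow> poly_map (\<lambda>x. - p x)"
  using poly_map.mult[OF poly_map.const[of "-1"]] by simp

lemma poly_map_diff: "poly_map p \<Longrightarrow> poly_map q \<Longrightarrow> poly_map (\<lambda>x. p x - q x)"
  using poly_map.add[OF _ poly_map_uminus] by simp

lemma poly_map_sum: "(\<And>i. i \<in> I \<Longrightarrow> poly_map (p i)) \<Longrightarrow> poly_map (\<lambda>x. \<Sum>i\<in>I. p i x)"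
  by (induction I rule: infinite_finite_induct) (auto intro: poly_map.intros)

lemmas poly_map_intros = poly_map.intros poly_map_uminus poly_map_diff poly_map_sum

lemma poly_map_bracket:
  assumes "\<And>i. poly_map (\<lambda>\<mu>. F \<mu> $ i)" "\<And>i. poly_map (\<lambda>\<mu>. G \<mu> $ i)"
  shows "poly_map (\<lambda>\<mu>. bracket \<mu> (F \<mu>) (G \<mu>) $ k)"
  unfolding bracket_def by (simp, intro poly_map_intros assms)

lemma closedin_zariski_zero: "poly_map p \<Longrightarrow> closedin zariski {x. p x = 0}"
  unfolding closedin_zariski zero_locus_def by (rule exI[of _ "{p}"]) auto

lemma closedin_zariski_All:
  assumes "\<And>i. closedin zariski {x. P i x}"
  shows "closedin zariski {x. \<forall>i. P i x}"
proof -
  have "closedin zariski (\<Inter>i. {x. P i x})"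
    using assms by blast
  then show ?thesis
    by (simp add: INTER_eq)
qed

lemma closedin_zariski_imp:
  assumes "closedin zariski {x. Q x}"
  shows "closedin zariski {x. P \<longrightarrow> Q x}"
  using assms closedin_topspace[of zariski] by (cases P) simp_all

lemma closedin_zariski_conj:
  assumes "closedin zariski {x. P x}" "closedin zariski {x. Q x}"
  shows "closedin zariski {x. P x \<and> Q x}"
  using closedin_Int[OF assms] by (simp add: Collect_conj_eq)

lemma closedin_zariski_vec_zero:
  assumes "\<And>k. poly_map (\<lambda>\<mu>. F \<mu> $ k)"
  shows "closedin zariski {\<mu>. F \<mu> = 0}"
  unfolding vec_eq_iff zero_index by (intro closedin_zariski_All closedin_zariski_zero assms)

section \<open>Curves\<close>

definition polyfun :: "(complex \<Rightarrow> complex) \<Rightarrow> bool" where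
  "polyfun f \<longleftrightarrow> (\<exists>P. \<forall>t. f t = poly P t)"

lemma polyfun_const [intro!]: "polyfun (\<lambda>t. c)"
  unfolding polyfun_def by (rule exI[of _ "[:c:]"]) simp

lemma polyfun_id [intro!]: "polyfun (\<lambda>t. t)"
  unfolding polyfun_def by (rule exI[of _ "[:0, 1:]"]) simp

lemma polyfun_add [intro!]: "polyfun f \<Longrightarrow> polyfun g \<Longrightarrow> polyfun (\<lambda>t. f t + g t)"
  unfolding polyfun_def by (metis poly_add)

lemma polyfun_mult [intro!]: "polyfun f \<Longrightarrow> polyfun g \<Longrightarrow> polyfun (\<lambda>t. f t * g t)"
  unfolding polyfun_def by (metis poly_mult)

lemma polyfun_uminus [intro!]: "polyfun f \<Longrightarrow> polyfun (\<lambda>t. - f t)"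
  unfolding polyfun_def by (metis poly_minus)

lemma polyfun_diff [intro!]: "polyfun f \<Longrightarrow> polyfun g \<Longrightarrow> polyfun (\<lambda>t. f t - g t)"
  unfolding polyfun_def by (metis poly_diff)

lemma polyfun_power [intro!]: "polyfun f \<Longrightarrow> polyfun (\<lambda>t. f t ^ n)"
  by (induction n) auto

lemma polyfun_sum [intro!]: "(\<And>i. i \<in> I \<Longrightarrow> polyfun (f i)) \<Longrightarrow> polyfun (\<lambda>t. \<Sum>i\<in>I. f i t)"
  by (induction I rule: infinite_finite_induct) auto

lemma polyfun_prod [intro!]: "(\<And>i. i \<in> I \<Longrightarrow> polyfun (f i)) \<Longrightarrow> polyfun (\<lambda>t. \<Prod>i\<in>I. f i t)"
  by (induction I rule: infinite_finite_induct) auto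

text \<open>The polynomial ring has no zero divisors, and a polynomial vanishing at every point of
  an infinite field is zero. All density arguments come down to this.\<close>

lemma polyfun_mult_eq_0:
  assumes "polyfun f" "polyfun g" "\<And>t. f t * g t = 0"
  shows "(\<forall>t. f t = 0) \<or> (\<forall>t. g t = 0)"
proof -
  obtain P Q where PQ: "\<And>t. f t = poly P t" "\<And>t. g t = poly Q t"
    using assms(1,2) unfolding polyfun_def by metis
  have "poly (P * Q) t = 0" for t
    using assms(3) by (simp add: PQ)
  then have "P * Q = 0"
    by (intro poly_ext) simp
  then show ?thesis
    by (auto simp: PQ)
qed

lemma polyfun_det:
  assumes "\<And>i j. polyfun (\<lambda>t. A t $ i $ j)"
  shows "polyfun (\<lambda>t. det (A t))"
  unfolding det_def using assms by auto

section \<open>Rational functions with a prescribed denominator\<close>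

definition ratfun :: "(complex \<Rightarrow> complex) \<Rightarrow> (complex \<Rightarrow> complex) \<Rightarrow> bool" where
  "ratfun D f \<longleftrightarrow> (\<exists>P n. polyfun P \<and> (\<forall>t. D t \<noteq> 0 \<longrightarrow> f t * D t ^ n = P t))"

lemma ratfun_polyfun: "polyfun f \<Longrightarrow> ratfun D f"
  unfolding ratfun_def by (rule exI[of _ f], rule exI[of _ 0]) simp

text \<open>At the zeros of \<open>D\<close> a \<open>ratfun\<close> is unconstrained; this is where
  a curve of group elements meets singular matrices. Away from them one power of \<open>D\<close>
  serves as a common denominator.\<close>

lemma ratfun_add:
  assumes "polyfun D" "ratfun D f" "ratfun D g"
  shows "ratfun D (\<lambda>t. f t + g t)"
proof -
  obtain P m Q n where "polyfun P" "\<And>t. D t \<noteq> 0 \<Longrightarrow> f t * D t ^ m = P t"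
    and "polyfun Q" "\<And>t. D t \<noteq> 0 \<Longrightarrow> g t * D t ^ n = Q t"
    using assms(2,3) unfolding ratfun_def by metis
  then show ?thesis
    unfolding ratfun_def using assms(1)
    by (intro exI[of _ "\<lambda>t. P t * D t ^ n + Q t * D t ^ m"] exI[of _ "m + n"])
      (auto simp: algebra_simps power_add)
qed

lemma ratfun_mult:
  assumes "ratfun D f" "ratfun D g"
  shows "ratfun D (\<lambda>t. f t * g t)"
proof -
  obtain P m Q n where PQ: "polyfun P" "\<And>t. D t \<noteq> 0 \<Longrightarrow> f t * D t ^ m = P t"
    "polyfun Q" "\<And>t. D t \<noteq> 0 \<Longrightarrow> g t * D t ^ n = Q t"
    using assms unfolding ratfun_def by metis
  have "f t * g t * D t ^ (m + n) = P t * Q t" if "D t \<noteq> 0" for t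
    unfolding PQ(2)[OF that, symmetric] PQ(4)[OF that, symmetric] by (simp add: power_add)
  then show ?thesis
    unfolding ratfun_def using PQ(1,3) by blast
qed

lemma ratfun_sum:
  assumes "polyfun D" "\<And>i. i \<in> I \<Longrightarrow> ratfun D (f i)"
  shows "ratfun D (\<lambda>t. \<Sum>i\<in>I. f i t)"
  using assms(2)
  by (induction I rule: infinite_finite_induct) (auto intro: ratfun_polyfun ratfun_add[OF assms(1)])

lemma ratfun_poly_map:
  assumes "poly_map p" "polyfun D" "\<And>i. ratfun D (\<lambda>t. \<gamma> t $ i)"
  shows "ratfun D (\<lambda>t. p (\<gamma> t))"
  using assms(1)
  by induction (auto intro: ratfun_polyfun assms ratfun_add ratfun_mult)

lemma polyfun_poly_map:
  assumes "poly_map p" "\<And>i. polyfun (\<lambda>t. \<gamma> t $ i)"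
  shows "polyfun (\<lambda>t. p (\<gamma> t))"
  using assms(1) by induction (use assms(2) in auto)

text \<open>A polynomial that is nonzero at \<open>\<gamma> s\<close> pulls back to a nonzero
  polynomial in the parameter, and so does its product with \<open>D\<close>. Hence every
  neighbourhood of \<open>\<gamma> s\<close> contains a point of the curve lying in
  \<open>S\<close>. The parameter \<open>s\<close> may be a zero of \<open>D\<close>; degenerate
  structures are reached in this way.\<close>

lemma closure_of_curve:
  assumes \<gamma>: "\<And>i. polyfun (\<lambda>t. \<gamma> t $ i)"
    and D: "polyfun D" "D t0 \<noteq> 0"
    and sub: "\<And>t. D t \<noteq> 0 \<Longrightarrow> \<gamma> t \<in> S"
  shows "\<gamma> s \<in> zariski closure_of S"
  unfolding in_closure_of
proof (intro conjI allI impI)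
  fix U assume U: "\<gamma> s \<in> U \<and> openin zariski U"
  then obtain Ps where Ps: "Ps \<subseteq> Collect poly_map" "- U = zero_locus Ps"
    unfolding openin_zariski by blast
  with U obtain p where p: "p \<in> Ps" "p (\<gamma> s) \<noteq> 0"
    by (auto simp: zero_locus_def)
  have "polyfun (\<lambda>t. p (\<gamma> t))"
    by (rule polyfun_poly_map[OF _ \<gamma>]) (use Ps(1) p(1) in auto)
  then obtain t where "p (\<gamma> t) * D t \<noteq> 0"
    using polyfun_mult_eq_0[of "\<lambda>t. p (\<gamma> t)" D] D p(2) by blast
  then have "\<gamma> t \<in> S" "\<gamma> t \<in> U"
    using sub Ps(2) p(1) by (auto simp: zero_locus_def)
  then show "\<exists>y. y \<in> S \<and> y \<in> U"
    by blast
qed simp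

text \<open>If two closed sets cover \<open>S\<close>, take \<open>p\<close> vanishing on the first
  but not at \<open>x\<close>, and \<open>q\<close> vanishing on the second but not at
  \<open>y\<close>. Along a curve in \<open>S\<close> from \<open>x\<close> to \<open>y\<close> the
  product of the pull-backs vanishes; after clearing denominators one of them is identically zero,
  against its value at an end point.\<close>

lemma irreducible_in_closure_of_curves:
  fixes S :: "(complex ^ 'n) set"
  assumes "S \<noteq> {}"
    and curves: "\<And>x y. x \<in> S \<Longrightarrow> y \<in> S \<Longrightarrow>
      \<exists>D \<gamma>. polyfun D \<and> D 0 \<noteq> 0 \<and> D 1 \<noteq> 0 \<and> (\<forall>i. ratfun D (\<lambda>t. \<gamma> t $ i)) \<and>
        \<gamma> 0 = x \<and> \<gamma> 1 = y \<and> (\<forall>t. D t \<noteq> 0 \<longrightarrow> \<gamma> t \<in> S)"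
  shows "irreducible_in zariski (zariski closure_of S)"
  unfolding irreducible_in_def
proof (intro conjI allI impI)
  show "zariski closure_of S \<noteq> {}"
    using assms(1) by (simp add: closure_of_eq_empty)
  fix C C' :: "(complex ^ 'n) set"
  assume "closedin zariski C \<and> closedin zariski C' \<and> zariski closure_of S \<subseteq> C \<union> C'"
  then obtain Ps Qs where Ps: "Ps \<subseteq> Collect poly_map" "C = zero_locus Ps"
    and Qs: "Qs \<subseteq> Collect poly_map" "C' = zero_locus Qs"
    and cl: "closedin zariski C" "closedin zariski C'" and "zariski closure_of S \<subseteq> C \<union> C'"
    unfolding closedin_zariski by blast
  then have sub: "S \<subseteq> C \<union> C'"
    using closure_of_subset[of S zariski] by simp
  have "S \<subseteq> C \<or> S \<subseteq> C'"
  proof (rule ccontr)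
    assume "\<not> (S \<subseteq> C \<or> S \<subseteq> C')"
    then obtain x y where x: "x \<in> S" "x \<notin> C" and y: "y \<in> S" "y \<notin> C'"
      by blast
    then obtain p q where p: "p \<in> Ps" "p x \<noteq> 0" and q: "q \<in> Qs" "q y \<noteq> 0"
      using Ps Qs by (auto simp: zero_locus_def)
    obtain D \<gamma> where D: "polyfun D" "D 0 \<noteq> 0" "D 1 \<noteq> 0" and rat: "\<And>i. ratfun D (\<lambda>t. \<gamma> t $ i)"
      and \<gamma>: "\<gamma> 0 = x" "\<gamma> 1 = y" "\<And>t. D t \<noteq> 0 \<Longrightarrow> \<gamma> t \<in> S"
      using curves[OF x(1) y(1)] by blast
    have "ratfun D (\<lambda>t. p (\<gamma> t))" "ratfun D (\<lambda>t. q (\<gamma> t))"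
      using ratfun_poly_map[OF _ D(1) rat] Ps(1) Qs(1) p(1) q(1) by auto
    then obtain P m Q n where P: "polyfun P" "\<And>t. D t \<noteq> 0 \<Longrightarrow> p (\<gamma> t) * D t ^ m = P t"
      and Q: "polyfun Q" "\<And>t. D t \<noteq> 0 \<Longrightarrow> q (\<gamma> t) * D t ^ n = Q t"
      unfolding ratfun_def by metis
    \<comment> \<open>The factor \<open>D t\<close> covers the parameters at which the curve is not
      known to lie in \<open>S\<close>.\<close>
    have "P t * D t * Q t = 0" for t
    proof (cases "D t = 0")
      case False
      with \<gamma>(3) sub have "\<gamma> t \<in> C \<or> \<gamma> t \<in> C'"
        by blast
      with p(1) q(1) have "p (\<gamma> t) = 0 \<or> q (\<gamma> t) = 0"
        unfolding Ps(2) Qs(2) zero_locus_def by blast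
      with P(2)[OF False] Q(2)[OF False] show ?thesis
        by auto
    qed simp
    then have "(\<forall>t. P t * D t = 0) \<or> (\<forall>t. Q t = 0)"
      by (intro polyfun_mult_eq_0 polyfun_mult P(1) Q(1) D(1))
    moreover have "P 0 * D 0 \<noteq> 0" "Q 1 \<noteq> 0"
      using P(2)[of 0] Q(2)[of 1] D p(2) q(2) \<gamma> by auto
    ultimately show False
      by blast
  qed
  then show "zariski closure_of S \<subseteq> C \<or> zariski closure_of S \<subseteq> C'"
    using closure_of_minimal cl by metis
qed simp

section \<open>The action on structures\<close>

lemma
  fixes g :: "'k::field ^ 'n ^ 'n"
  assumes "invertible g"
  shows matrix_inv_right: "g ** matrix_inv g = mat 1" and matrix_inv_left: "matrix_inv g ** g = mat 1"
  using someI_ex[OF assms[unfolded invertible_def]] unfolding matrix_inv_def by blast+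

lemma matrix_inv_unique:
  fixes g :: "'k::field ^ 'n ^ 'n"
  assumes "g ** h = mat 1" "h ** g = mat 1"
  shows "matrix_inv g = h"
proof -
  have "invertible g"
    using assms unfolding invertible_def by blast
  have "matrix_inv g = matrix_inv g ** (g ** h)"
    by (simp add: assms)
  also have "\<dots> = h"
    by (simp only: matrix_mul_assoc matrix_inv_left[OF \<open>invertible g\<close>] matrix_mul_lid)
  finally show ?thesis .
qed

lemma matrix_inv_cancel:
  fixes g :: "'k::field ^ 'n ^ 'n"
  assumes "invertible g"
  shows "matrix_inv g *v (g *v x) = x" "g *v (matrix_inv g *v x) = x"
  using assms by (simp_all add: matrix_vector_mul_assoc matrix_inv_left matrix_inv_right)

lemma alg_eqI:
  assumes "\<And>i j. bracket \<mu> (\<e> i) (\<e> j) = bracket \<nu> (\<e> i) (\<e> j)"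
  shows "\<mu> = \<nu>"
  unfolding vec_eq_iff split_paired_All using assms by (metis bracket_axis)

lemma gl_act_id: "gl_act (mat 1) \<mu> = \<mu>"
  by (rule alg_eqI) (simp add: bracket_gl_act matrix_inv_unique[of "mat 1" "mat 1"])

lemma gl_act_mult:
  fixes g :: "'k::field ^ 'n ^ 'n"
  assumes "invertible g" "invertible h"
  shows "gl_act (g ** h) \<mu> = gl_act g (gl_act h \<mu>)"
proof (rule alg_eqI)
  have "matrix_inv (g ** h) = matrix_inv h ** matrix_inv g"
  proof (rule matrix_inv_unique)
    have "(g ** h) ** (matrix_inv h ** matrix_inv g) = g ** (h ** matrix_inv h) ** matrix_inv g"
      by (simp only: matrix_mul_assoc)
    then show "(g ** h) ** (matrix_inv h ** matrix_inv g) = mat 1"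
      using assms by (simp add: matrix_inv_right)
    have "(matrix_inv h ** matrix_inv g) ** (g ** h) = matrix_inv h ** (matrix_inv g ** g) ** h"
      by (simp only: matrix_mul_assoc)
    then show "(matrix_inv h ** matrix_inv g) ** (g ** h) = mat 1"
      using assms by (simp add: matrix_inv_left)
  qed
  then show "bracket (gl_act (g ** h) \<mu>) (\<e> i) (\<e> j) = bracket (gl_act g (gl_act h \<mu>)) (\<e> i) (\<e> j)" for i j
    by (simp add: bracket_gl_act matrix_vector_mul_assoc)
qed

lemma invertible_matrix_inv:
  fixes g :: "'k::field ^ 'n ^ 'n"
  shows "invertible g \<Longrightarrow> invertible (matrix_inv g)"
  using matrix_inv_left matrix_inv_right unfolding invertible_def by blast

lemma gl_act_inverse:
  fixes g :: "'k::field ^ 'n ^ 'n"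
  assumes "invertible g"
  shows "gl_act (matrix_inv g) (gl_act g \<mu>) = \<mu>"
  using gl_act_mult[OF invertible_matrix_inv[OF assms] assms, of \<mu>]
  by (simp add: matrix_inv_left assms gl_act_id)

lemma orbit_refl: "\<mu> \<in> orbit \<mu>"
  unfolding orbit_def by (rule CollectI, rule exI[of _ "mat 1"]) (auto simp: gl_act_id invertible_def intro: exI[of _ "mat 1"])

lemma orbit_trans: "\<mu> \<in> orbit \<nu> \<Longrightarrow> \<nu> \<in> orbit \<rho> \<Longrightarrow> \<mu> \<in> orbit \<rho>"
  unfolding orbit_def using gl_act_mult invertible_mult by (smt (verit) mem_Collect_eq)

lemma orbit_sym: "\<mu> \<in> orbit \<nu> \<Longrightarrow> \<nu> \<in> orbit \<mu>"
  unfolding orbit_def using gl_act_inverse invertible_matrix_inv by (smt (verit) mem_Collect_eq)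

lemma gl_act_orbit: "invertible g \<Longrightarrow> gl_act g \<mu> \<in> orbit \<mu>"
  unfolding orbit_def by blast

lemma poly_map_gl_act:
  assumes "poly_map p"
  shows "poly_map (\<lambda>\<mu>. p (gl_act g \<mu>))"
  using assms
proof induction
  case (coord i)
  obtain a b c where "i = (a, b, c)"
    by (metis prod_cases3)
  then show ?case
    unfolding gl_act_def bracket_def
    by (simp add: matrix_vector_mult_def) (intro poly_map_intros)
qed (auto intro: poly_map.intros)

lemma openin_zariski_gl_act:
  assumes "openin zariski U"
  shows "openin zariski {\<mu>. gl_act g \<mu> \<in> U}"
proof -
  obtain P where P: "P \<subseteq> Collect poly_map" "- U = zero_locus P"
    using assms unfolding openin_zariski by blast
  have "- {\<mu>. gl_act g \<mu> \<in> U} = {\<mu>. gl_act g \<mu> \<in> - U}"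
    by blast
  also have "\<dots> = zero_locus ((\<lambda>p \<mu>. p (gl_act g \<mu>)) ` P)"
    unfolding P(2) by (simp add: zero_locus_def)
  finally have "- {\<mu>. gl_act g \<mu> \<in> U} = zero_locus ((\<lambda>p \<mu>. p (gl_act g \<mu>)) ` P)" .
  moreover have "(\<lambda>p \<mu>. p (gl_act g \<mu>)) ` P \<subseteq> Collect poly_map"
    using P(1) poly_map_gl_act by blast
  ultimately show ?thesis
    unfolding openin_zariski by blast
qed

section \<open>Sets stable under changes of basis, and open orbits\<close>

definition gl_invariant :: "('k::field, 'n::finite) alg set \<Rightarrow> bool" where
  "gl_invariant S \<longleftrightarrow> (\<forall>\<mu>\<in>S. \<forall>g. invertible g \<longrightarrow> gl_act g \<mu> \<in> S)"

lemma gl_invariant_orbit: "gl_invariant (orbit \<mu>)"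
  unfolding gl_invariant_def by (meson gl_act_orbit orbit_trans)

lemma gl_invariant_UN: "(\<And>i. i \<in> I \<Longrightarrow> gl_invariant (S i)) \<Longrightarrow> gl_invariant (\<Union>i\<in>I. S i)"
  unfolding gl_invariant_def by (metis UN_iff)

lemma gl_invariantD: "gl_invariant S \<Longrightarrow> \<nu> \<in> S \<Longrightarrow> \<mu> \<in> orbit \<nu> \<Longrightarrow> \<mu> \<in> S"
  unfolding gl_invariant_def orbit_def by auto

lemma gl_invariant_closure_of:
  assumes S: "gl_invariant S"
  shows "gl_invariant (zariski closure_of S)"
  unfolding gl_invariant_def
proof (intro ballI allI impI)
  fix \<mu> :: "('a, 'b) alg" and g :: "'a ^ 'b ^ 'b"
  assume \<mu>: "\<mu> \<in> zariski closure_of S" and g: "invertible g"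
  show "gl_act g \<mu> \<in> zariski closure_of S"
    unfolding in_closure_of
  proof (intro conjI allI impI)
    fix U assume U: "gl_act g \<mu> \<in> U \<and> openin zariski U"
    then have "openin zariski {\<nu>. gl_act g \<nu> \<in> U}"
      by (intro openin_zariski_gl_act) simp
    with \<mu> U obtain \<nu> where "\<nu> \<in> S" "gl_act g \<nu> \<in> U"
      unfolding in_closure_of by (metis mem_Collect_eq)
    with S g show "\<exists>y. y \<in> S \<and> y \<in> U"
      unfolding gl_invariant_def by auto
  qed simp
qed

lemma openin_orbit_if_slice:
  assumes L: "gl_invariant L" and "\<mu> \<in> L"
    and U: "openin zariski U" "\<mu> \<in> U" "L \<inter> U \<subseteq> orbit \<mu>"
  shows "openin (subtopology zariski L) (orbit \<mu>)"
proof -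
  let ?V = "\<Union>g\<in>{g. invertible g}. {\<nu>. gl_act g \<nu> \<in> U}"
  have "openin zariski ?V"
    using openin_zariski_gl_act[OF U(1)] by blast
  moreover have "orbit \<mu> = ?V \<inter> L"
  proof safe
    fix \<nu> assume \<nu>: "\<nu> \<in> orbit \<mu>"
    then show "\<nu> \<in> L"
      using gl_invariantD[OF L \<open>\<mu> \<in> L\<close>] by blast
    from orbit_sym[OF \<nu>] U(2) show "\<nu> \<in> ?V"
      unfolding orbit_def by blast
  next
    fix \<nu> g assume \<nu>: "\<nu> \<in> L" and g: "invertible g" and "gl_act g \<nu> \<in> U"
    moreover have "gl_act g \<nu> \<in> L"
      using L \<nu> g unfolding gl_invariant_def by simp
    ultimately have "gl_act g \<nu> \<in> orbit \<mu>"
      using U(3) by auto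
    then show "\<nu> \<in> orbit \<mu>"
      by (rule orbit_trans[OF orbit_sym[OF gl_act_orbit[OF g]]])
  qed
  ultimately show ?thesis
    unfolding openin_subtopology by blast
qed

text \<open>Cramer's rule. It exhibits the inverse along a polynomial curve of matrices as
  polynomials divided by the determinant.\<close>

lemma matrix_inv_column:
  fixes A :: "'k::field ^ 'n ^ 'n"
  assumes "det A \<noteq> 0"
  shows "matrix_inv A *v b = (\<chi> k. det (\<chi> i j. if j = k then b $ i else A $ i $ j) / det A)"
  using assms by (subst cramer[OF assms, symmetric]) (simp add: matrix_inv_cancel invertible_det_nz)

text \<open>Two points of the family are joined by moving the matrix along a line in the space of
  all matrices and the parameter along a line in the complex numbers. The matrix line may meet
  singular matrices, but only at the zeros of the nonzero polynomial \<open>D\<close>.\<close>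

lemma irreducible_in_orbits:
  fixes F :: "complex \<Rightarrow> (complex, 'n::finite) alg"
  assumes F: "\<And>p. polyfun (\<lambda>t. F t $ p)"
  shows "irreducible_in zariski (zariski closure_of (\<Union>\<epsilon>. orbit (F \<epsilon>)))"
proof (rule irreducible_in_closure_of_curves)
  show "(\<Union>\<epsilon>. orbit (F \<epsilon>)) \<noteq> {}"
    using orbit_refl by blast
  fix x y assume "x \<in> (\<Union>\<epsilon>. orbit (F \<epsilon>))" "y \<in> (\<Union>\<epsilon>. orbit (F \<epsilon>))"
  then obtain a b g h where g: "invertible g" "x = gl_act g (F a)" and h: "invertible h" "y = gl_act h (F b)"
    unfolding orbit_def by blast
  define G where "G t = (\<chi> i j. (1 - t) * g $ i $ j + t * h $ i $ j)" for t
  define \<epsilon> where "\<epsilon> t = (1 - t) * a + t * b" for t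
  have G: "polyfun (\<lambda>t. G t $ i $ j)" for i j
    by (auto simp: G_def)
  have G01: "G 0 = g" "G 1 = h" "\<epsilon> 0 = a" "\<epsilon> 1 = b"
    by (simp_all add: G_def \<epsilon>_def vec_eq_iff)
  have F_\<epsilon>: "polyfun (\<lambda>t. F (\<epsilon> t) $ p)" for p
  proof -
    obtain P where "\<And>t. F t $ p = poly P t"
      using F unfolding polyfun_def by blast
    then show ?thesis
      unfolding polyfun_def \<epsilon>_def
      by (intro exI[of _ "pcompose P [:a, b - a:]"]) (simp add: poly_pcompose algebra_simps)
  qed
  define D where "D t = det (G t)" for t
  have D: "polyfun D"
    unfolding D_def using G by (rule polyfun_det)
  have inv: "ratfun D (\<lambda>t. (matrix_inv (G t) *v \<e> j) $ i)" for i j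
  proof -
    have "polyfun (\<lambda>t. det (\<chi> r s. if s = i then \<e> j $ r else G t $ r $ s))"
    proof (rule polyfun_det)
      show "polyfun (\<lambda>t. (\<chi> r s. if s = i then \<e> j $ r else G t $ r $ s) $ r $ s)" for r s
        using G by (cases "s = i") auto
    qed
    then show ?thesis
      unfolding ratfun_def
      by (intro exI[of _ "\<lambda>t. det (\<chi> r s. if s = i then \<e> j $ r else G t $ r $ s)"] exI[of _ 1])
        (auto simp: D_def matrix_inv_column)
  qed
  have "ratfun D (\<lambda>t. gl_act (G t) (F (\<epsilon> t)) $ p)" for p
  proof -
    obtain i j k where "p = (i, j, k)"
      by (metis prod_cases3)
    then show ?thesis
      unfolding gl_act_def bracket_def
      by (simp add: matrix_vector_mult_def[of "G _"] )
        (intro ratfun_sum ratfun_mult D inv ratfun_polyfun[OF G] ratfun_polyfun[OF F_\<epsilon>])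
  qed
  moreover have "D 0 \<noteq> 0" "D 1 \<noteq> 0"
    using g h by (simp_all add: D_def G01 invertible_det_nz)
  moreover have "gl_act (G t) (F (\<epsilon> t)) \<in> (\<Union>\<epsilon>. orbit (F \<epsilon>))" if "D t \<noteq> 0" for t
    using that gl_act_orbit[of "G t"] by (auto simp: D_def invertible_det_nz)
  ultimately show "\<exists>D \<gamma>. polyfun D \<and> D 0 \<noteq> 0 \<and> D 1 \<noteq> 0 \<and> (\<forall>i. ratfun D (\<lambda>t. \<gamma> t $ i)) \<and>
        \<gamma> 0 = x \<and> \<gamma> 1 = y \<and> (\<forall>t. D t \<noteq> 0 \<longrightarrow> \<gamma> t \<in> (\<Union>\<epsilon>. orbit (F \<epsilon>)))"
    using D g(2) h(2) G01
    by (intro exI[of _ D] exI[of _ "\<lambda>t. gl_act (G t) (F (\<epsilon> t))"]) auto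
qed

section \<open>Coordinates in dimension six\<close>

lemma UNIV_6: "(UNIV :: 6 set) = {1, 2, 3, 4, 5, 6}"
proof (rule card_subset_eq[symmetric])
  show "card {1, 2, 3, 4, 5, 6 :: 6} = card (UNIV :: 6 set)"
    by simp
qed auto

lemma forall_6: "(\<forall>i::6. P i) \<longleftrightarrow> P 1 \<and> P 2 \<and> P 3 \<and> P 4 \<and> P 5 \<and> P 6"
proof -
  have "(\<forall>i::6. P i) \<longleftrightarrow> (\<forall>i\<in>{1,2,3,4,5,6::6}. P i)"
    by (simp flip: UNIV_6)
  then show ?thesis
    by auto
qed

lemma sum_6: "(\<Sum>i\<in>(UNIV::6 set). f i) = f 1 + f 2 + f 3 + f 4 + f 5 + (f 6 :: 'a::comm_monoid_add)"
  unfolding UNIV_6 by (simp add: add.assoc)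

definition vec6 :: "'k \<Rightarrow> 'k \<Rightarrow> 'k \<Rightarrow> 'k \<Rightarrow> 'k \<Rightarrow> 'k \<Rightarrow> 'k ^ 6" where
  "vec6 x1 x2 x3 x4 x5 x6 =
     (\<chi> i. if i = 1 then x1 else if i = 2 then x2 else if i = 3 then x3
       else if i = 4 then x4 else if i = 5 then x5 else x6)"

lemma vec6_nth [simp]:
  "vec6 x1 x2 x3 x4 x5 x6 $ 1 = x1" "vec6 x1 x2 x3 x4 x5 x6 $ 2 = x2"
  "vec6 x1 x2 x3 x4 x5 x6 $ 3 = x3" "vec6 x1 x2 x3 x4 x5 x6 $ 4 = x4"
  "vec6 x1 x2 x3 x4 x5 x6 $ 5 = x5" "vec6 x1 x2 x3 x4 x5 x6 $ 6 = x6"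
  by (simp_all add: vec6_def)

lemma vec6_eq_iff [simp]:
  "vec6 x1 x2 x3 x4 x5 x6 = vec6 y1 y2 y3 y4 y5 y6 \<longleftrightarrow>
     x1 = y1 \<and> x2 = y2 \<and> x3 = y3 \<and> x4 = y4 \<and> x5 = y5 \<and> x6 = y6"
  by (simp add: vec_eq_iff forall_6)

lemma vec6_zero_iff [simp]:
  "vec6 x1 x2 x3 x4 x5 x6 = 0 \<longleftrightarrow> x1 = 0 \<and> x2 = 0 \<and> x3 = 0 \<and> x4 = 0 \<and> x5 = 0 \<and> x6 = 0"
  by (simp add: vec_eq_iff forall_6)

lemma vec6_arith [simp]:
  "vec6 x1 x2 x3 x4 x5 x6 + vec6 y1 y2 y3 y4 y5 y6 =
     vec6 (x1 + y1) (x2 + y2) (x3 + y3) (x4 + y4) (x5 + y5) (x6 + y6)"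
  "vec6 x1 x2 x3 x4 x5 x6 - vec6 y1 y2 y3 y4 y5 y6 =
     vec6 (x1 - y1) (x2 - y2) (x3 - y3) (x4 - y4) (x5 - y5) (x6 - y6)"
  "- vec6 x1 x2 x3 x4 x5 x6 = vec6 (- x1) (- x2) (- x3) (- x4) (- x5) (- x6)"
  "c *s vec6 x1 x2 x3 x4 x5 x6 = vec6 (c * x1) (c * x2) (c * x3) (c * x4) (c * x5) (c * x6)"
  by (simp_all add: vec_eq_iff forall_6)

lemma basis_vec6:
  "\<e> 1 = vec6 1 0 0 0 0 0" "\<e> 2 = vec6 0 1 0 0 0 0" "\<e> 3 = vec6 0 0 1 0 0 0"
  "\<e> 4 = vec6 0 0 0 1 0 0" "\<e> 5 = vec6 0 0 0 0 1 0" "\<e> 6 = vec6 0 0 0 0 0 1"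
  by (simp_all add: vec_eq_iff forall_6 axis_def)

lemma vec6_cases [cases type]:
  obtains x1 x2 x3 x4 x5 x6 where "x = vec6 x1 x2 x3 x4 x5 x6"
proof
  show "x = vec6 (x $ 1) (x $ 2) (x $ 3) (x $ 4) (x $ 5) (x $ 6)"
    by (simp add: vec_eq_iff forall_6)
qed

section \<open>Triangular structures\<close>

text \<open>One letter per pair of basis vectors: \<open>a\<close>, \<open>b\<close>,
  \<open>d\<close> for the pairs 12, 13, 23 and \<open>p\<close>, \<open>q\<close>, \<open>r\<close>
  for 14, 24, 34, the digit naming the basis vector that carries the coefficient; \<open>u\<close>,
  \<open>v\<close>, \<open>w\<close>, \<open>z\<close> belong to 15, 25, 35, 45. In these tables a
  product involves only basis vectors of index larger than both factors.\<close>

definition tri :: "complex \<Rightarrow> complex \<Rightarrow> complex \<Rightarrow> complex \<Rightarrow> complex \<Rightarrow> complex \<Rightarrow> complex \<Rightarrow>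
  complex \<Rightarrow> complex \<Rightarrow> complex \<Rightarrow> complex \<Rightarrow> complex \<Rightarrow> complex \<Rightarrow> complex \<Rightarrow>
  complex \<Rightarrow> complex \<Rightarrow> complex \<Rightarrow> complex \<Rightarrow> complex \<Rightarrow> complex \<Rightarrow> (complex, 6) alg" where
  "tri a3 a4 a5 a6 b4 b5 b6 d4 d5 d6 p5 p6 q5 q6 r5 r6 u v w z = anticomm_table
     [(1, 2, vec6 0 0 a3 a4 a5 a6), (1, 3, vec6 0 0 0 b4 b5 b6), (2, 3, vec6 0 0 0 d4 d5 d6),
      (1, 4, vec6 0 0 0 0 p5 p6), (2, 4, vec6 0 0 0 0 q5 q6), (3, 4, vec6 0 0 0 0 r5 r6),
      (1, 5, vec6 0 0 0 0 0 u), (2, 5, vec6 0 0 0 0 0 v), (3, 5, vec6 0 0 0 0 0 w),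
      (4, 5, vec6 0 0 0 0 0 z)]"

lemma bracket_tri:
  "bracket (tri a3 a4 a5 a6 b4 b5 b6 d4 d5 d6 p5 p6 q5 q6 r5 r6 u v w z)
     (vec6 x1 x2 x3 x4 x5 x6) (vec6 y1 y2 y3 y4 y5 y6) =
   vec6 0 0 (a3 * (x1 * y2 - x2 * y1))
     (a4 * (x1 * y2 - x2 * y1) + b4 * (x1 * y3 - x3 * y1) + d4 * (x2 * y3 - x3 * y2))
     (a5 * (x1 * y2 - x2 * y1) + b5 * (x1 * y3 - x3 * y1) + d5 * (x2 * y3 - x3 * y2) +
       p5 * (x1 * y4 - x4 * y1) + q5 * (x2 * y4 - x4 * y2) + r5 * (x3 * y4 - x4 * y3))
     (a6 * (x1 * y2 - x2 * y1) + b6 * (x1 * y3 - x3 * y1) + d6 * (x2 * y3 - x3 * y2) +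
       p6 * (x1 * y4 - x4 * y1) + q6 * (x2 * y4 - x4 * y2) + r6 * (x3 * y4 - x4 * y3) +
       u * (x1 * y5 - x5 * y1) + v * (x2 * y5 - x5 * y2) + w * (x3 * y5 - x5 * y3) +
       z * (x4 * y5 - x5 * y4))"
  by (simp add: vec_eq_iff forall_6 bracket_def sum_6 tri_def anticomm_table_def)
    (simp add: algebra_simps)

lemma M6_tri: "M6 \<epsilon> = tri 1 0 0 0 0 1 0 0 0 0 0 0 \<epsilon> 0 0 1 1 0 0 0"
  unfolding M6_def tri_def basis_vec6 by (simp add: vec_eq_iff anticomm_table_def forall_6)

lemma B61_tri: "B61 = tri 0 1 0 0 0 1 0 0 0 1 0 0 0 0 0 0 0 0 0 1"
  unfolding B61_def tri_def basis_vec6 by (simp add: vec_eq_iff anticomm_table_def forall_6)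

lemma g6_tri: "g6 = tri 1 0 0 0 1 0 0 0 1 0 1 0 0 0 0 (-1) 0 1 0 0"
  unfolding g6_def tri_def basis_vec6 by (simp add: vec_eq_iff anticomm_table_def forall_6)


section \<open>Brackets\<close>

lemma bracket_linear [simp]:
  "bracket \<mu> (x + y) s = bracket \<mu> x s + bracket \<mu> y s"
  "bracket \<mu> s (x + y) = bracket \<mu> s x + bracket \<mu> s y"
  "bracket \<mu> (x - y) s = bracket \<mu> x s - bracket \<mu> y s"
  "bracket \<mu> s (x - y) = bracket \<mu> s x - bracket \<mu> s y"
  "bracket \<mu> (- x) s = - bracket \<mu> x s"
  "bracket \<mu> s (- x) = - bracket \<mu> s x"
  "bracket \<mu> (c *s x) s = c *s bracket \<mu> x s"
  "bracket \<mu> s (c *s x) = c *s bracket \<mu> s x"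
  "bracket \<mu> 0 s = 0"
  "bracket \<mu> s 0 = 0"
  by (simp_all add: vec.linear_add[OF linear_bracket_left] vec.linear_add[OF linear_bracket_right]
    vec.linear_diff[OF linear_bracket_left] vec.linear_diff[OF linear_bracket_right]
    vec.linear_neg[OF linear_bracket_left] vec.linear_neg[OF linear_bracket_right]
    vec.linear_scale[OF linear_bracket_left] vec.linear_scale[OF linear_bracket_right]
    vec.linear_0[OF linear_bracket_left] vec.linear_0[OF linear_bracket_right])

lemma bracket_sum:
  "bracket \<mu> (\<Sum>i\<in>I. f i) s = (\<Sum>i\<in>I. bracket \<mu> (f i) s)"
  "bracket \<mu> s (\<Sum>i\<in>I. f i) = (\<Sum>i\<in>I. bracket \<mu> s (f i))"
  by (rule vec.linear_sum[OF linear_bracket_left], rule vec.linear_sum[OF linear_bracket_right])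

lemma anticommutative_self: "anticommutative \<mu> \<Longrightarrow> bracket \<mu> x x = 0"
  unfolding anticommutative_def by blast

lemma anticommutative_swap:
  assumes "anticommutative \<mu>"
  shows "bracket \<mu> y x = - bracket \<mu> x y"
proof -
  have "bracket \<mu> (x + y) (x + y) = 0"
    using assms anticommutative_self by blast
  then show ?thesis
    using anticommutative_self[OF assms] by (simp add: eq_neg_iff_add_eq_0 add.commute)
qed

lemma anticommutative_tri:
  "anticommutative (tri a3 a4 a5 a6 b4 b5 b6 d4 d5 d6 p5 p6 q5 q6 r5 r6 u v w z)"
  unfolding anticommutative_def
proof
  show "bracket (tri a3 a4 a5 a6 b4 b5 b6 d4 d5 d6 p5 p6 q5 q6 r5 r6 u v w z) x x = 0" for x
    by (cases x) (simp add: bracket_tri mult.commute)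
qed

definition independent6 :: "complex ^ 6 \<Rightarrow> complex ^ 6 \<Rightarrow> complex ^ 6 \<Rightarrow> complex ^ 6 \<Rightarrow> complex ^ 6 \<Rightarrow>
  complex ^ 6 \<Rightarrow> bool" where
  "independent6 h1 h2 h3 h4 h5 h6 \<longleftrightarrow>
     (\<forall>x1 x2 x3 x4 x5 x6. x1 *s h1 + x2 *s h2 + x3 *s h3 + x4 *s h4 + x5 *s h5 + x6 *s h6 = 0 \<longrightarrow>
        x1 = 0 \<and> x2 = 0 \<and> x3 = 0 \<and> x4 = 0 \<and> x5 = 0 \<and> x6 = 0)"

text \<open>The tool behind every reduction: the matrix with columns \<open>h1\<close>, ...,
  \<open>h6\<close> carries the table to \<open>\<mu>\<close>. A change of basis is thus verified by
  ten products together with the centrality of \<open>h6\<close>; anticommutativity supplies the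
  others.\<close>

lemma orbit_triI:
  assumes anti: "anticommutative \<mu>"
    and indep: "independent6 h1 h2 h3 h4 h5 h6"
    and "bracket \<mu> h1 h2 = a3 *s h3 + a4 *s h4 + a5 *s h5 + a6 *s h6"
    "bracket \<mu> h1 h3 = b4 *s h4 + b5 *s h5 + b6 *s h6"
    "bracket \<mu> h2 h3 = d4 *s h4 + d5 *s h5 + d6 *s h6"
    "bracket \<mu> h1 h4 = p5 *s h5 + p6 *s h6"
    "bracket \<mu> h2 h4 = q5 *s h5 + q6 *s h6"
    "bracket \<mu> h3 h4 = r5 *s h5 + r6 *s h6"
    "bracket \<mu> h1 h5 = u *s h6" "bracket \<mu> h2 h5 = v *s h6"
    "bracket \<mu> h3 h5 = w *s h6" "bracket \<mu> h4 h5 = z *s h6"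
    "bracket \<mu> h1 h6 = 0" "bracket \<mu> h2 h6 = 0" "bracket \<mu> h3 h6 = 0" "bracket \<mu> h4 h6 = 0"
    "bracket \<mu> h5 h6 = 0"
  shows "\<mu> \<in> orbit (tri a3 a4 a5 a6 b4 b5 b6 d4 d5 d6 p5 p6 q5 q6 r5 r6 u v w z)" (is "_ \<in> orbit ?T")
proof -
  define h :: "6 \<Rightarrow> complex ^ 6" where
    "h i = (if i = 1 then h1 else if i = 2 then h2 else if i = 3 then h3
            else if i = 4 then h4 else if i = 5 then h5 else h6)" for i
  define g :: "complex ^ 6 ^ 6" where "g = (\<chi> r s. h s $ r)"
  have h: "h 1 = h1" "h 2 = h2" "h 3 = h3" "h 4 = h4" "h 5 = h5" "h 6 = h6"
    by (simp_all add: h_def)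
  have g_vec6: "g *v vec6 x1 x2 x3 x4 x5 x6 =
      x1 *s h1 + x2 *s h2 + x3 *s h3 + x4 *s h4 + x5 *s h5 + x6 *s h6" for x1 x2 x3 x4 x5 x6
    unfolding vec_eq_iff by (simp add: matrix_vector_mult_def sum_6 g_def h algebra_simps)
  have "\<forall>x. g *v x = 0 \<longrightarrow> x = 0"
  proof (intro allI impI)
    show "x = 0" if "g *v x = 0" for x
      using that indep unfolding independent6_def by (cases x) (auto simp: g_vec6)
  qed
  then have g: "invertible g"
    by (simp add: invertible_left_inverse matrix_left_invertible_ker)
  have inv: "matrix_inv g *v h i = \<e> i" for i
  proof -
    have "g *v \<e> i = h i"
      unfolding vec_eq_iff by (simp add: matrix_vector_mult_def g_def axis_def if_distrib cong: if_cong)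
    then show ?thesis
      using matrix_inv_cancel(1)[OF g] by metis
  qed
  note swap = anticommutative_swap[OF anti]
  have "bracket \<mu> (h i) (h j) = bracket (gl_act g ?T) (h i) (h j)" for i j
  proof -
    have "\<forall>i j. bracket \<mu> (h i) (h j) = g *v bracket ?T (\<e> i) (\<e> j)"
      unfolding forall_6 h basis_vec6 bracket_tri g_vec6
      using assms(3-) anticommutative_self[OF anti]
        swap[of h2 h1] swap[of h3 h1] swap[of h3 h2] swap[of h4 h1] swap[of h4 h2] swap[of h4 h3]
        swap[of h5 h1] swap[of h5 h2] swap[of h5 h3] swap[of h5 h4]
        swap[of h6 h1] swap[of h6 h2] swap[of h6 h3] swap[of h6 h4] swap[of h6 h5]
      by simp
    then show ?thesis
      by (simp add: bracket_gl_act inv)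
  qed
  then have eq: "bracket \<mu> (h i) (h j) = bracket (gl_act g ?T) (h i) (h j)" for i j .
  have exp: "x = (\<Sum>i\<in>UNIV. (matrix_inv g *v x) $ i *s h i)" for x
  proof -
    obtain x1 x2 x3 x4 x5 x6 where "matrix_inv g *v x = vec6 x1 x2 x3 x4 x5 x6"
      by (cases "matrix_inv g *v x") blast
    with matrix_inv_cancel(2)[OF g, of x] show ?thesis
      by (simp add: sum_6 g_vec6 h)
  qed
  have "bracket \<mu> x y = bracket (gl_act g ?T) x y" for x y
    by (subst (1 2) exp[of x], subst (1 2) exp[of y]) (simp add: bracket_sum eq)
  then have "\<mu> = gl_act g ?T"
    by (intro alg_eqI) blast
  with gl_act_orbit[OF g] show ?thesis
    by simp
qed

section \<open>The variety of nilpotent anticommutative CD-algebras\<close>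

definition CD_identity :: "('k::field, 'n::finite) alg \<Rightarrow> bool" where
  "CD_identity \<mu> \<longleftrightarrow> (\<forall>x y a b.
     bracket \<mu> (bracket \<mu> (bracket \<mu> x y) a) b - bracket \<mu> (bracket \<mu> (bracket \<mu> x y) b) a =
     bracket \<mu> (bracket \<mu> (bracket \<mu> x a) b) y - bracket \<mu> (bracket \<mu> (bracket \<mu> x b) a) y +
     bracket \<mu> x (bracket \<mu> (bracket \<mu> y a) b) - bracket \<mu> x (bracket \<mu> (bracket \<mu> y b) a))"

text \<open>Anticommutativity makes left multiplication the negative of right multiplication. All
  four kinds of commutator therefore agree up to sign with that of two right multiplications, and
  derivations are closed under negation.\<close>

lemma CD_identity_iff:
  assumes "anticommutative \<mu>"
  shows "CD_algebra \<mu> \<longleftrightarrow> CD_identity \<mu>"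
proof
  assume CD: "CD_algebra \<mu>"
  have "(\<lambda>v. bracket \<mu> (bracket \<mu> v a) b - bracket \<mu> (bracket \<mu> v b) a) \<in> derivations \<mu>" for a b
    using CD[unfolded CD_algebra_def, rule_format, of "right_mult \<mu> b" b "right_mult \<mu> a" a]
    by (simp add: right_mult_def)
  then have "bracket \<mu> (bracket \<mu> (bracket \<mu> x y) a) b - bracket \<mu> (bracket \<mu> (bracket \<mu> x y) b) a =
     bracket \<mu> (bracket \<mu> (bracket \<mu> x a) b - bracket \<mu> (bracket \<mu> x b) a) y +
     bracket \<mu> x (bracket \<mu> (bracket \<mu> y a) b - bracket \<mu> (bracket \<mu> y b) a)" for x y a b
    unfolding derivations_def by blast
  then show "CD_identity \<mu>"
    unfolding CD_identity_def by (simp add: algebra_simps)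
next
  assume CD: "CD_identity \<mu>"
  have lin: "Vector_Spaces.linear (*s) (*s) (\<lambda>v. bracket \<mu> (bracket \<mu> v a) b - bracket \<mu> (bracket \<mu> v b) a)"
    for a b
    by unfold_locales (simp_all add: algebra_simps)
  have der: "(\<lambda>v. bracket \<mu> (bracket \<mu> v a) b - bracket \<mu> (bracket \<mu> v b) a) \<in> derivations \<mu>" for a b
    unfolding derivations_def using lin CD[unfolded CD_identity_def, rule_format, of _ _ a b] by (simp add: algebra_simps)
  have neg: "(\<lambda>v. - D v) \<in> derivations \<mu>" if D: "D \<in> derivations \<mu>" for D
  proof -
    have "Vector_Spaces.linear (*s) (*s) (\<lambda>v. - D v)"
      by (rule vec.linear_compose_neg) (use D in \<open>simp add: derivations_def\<close>)
    moreover have "- D (bracket \<mu> x y) = bracket \<mu> (- D x) y + bracket \<mu> x (- D y)" for x y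
      using D by (simp add: derivations_def)
    ultimately show ?thesis
      by (simp add: derivations_def)
  qed
  have left: "left_mult \<mu> x = (\<lambda>v. - bracket \<mu> v x)" for x
    unfolding left_mult_def using anticommutative_swap[OF assms] by (intro ext)
  show "CD_algebra \<mu>"
    unfolding CD_algebra_def
  proof (intro allI ballI)
    fix a b S T
    assume "S \<in> {right_mult \<mu> b, left_mult \<mu> b}" "T \<in> {right_mult \<mu> a, left_mult \<mu> a}"
    then consider "\<And>v. S (T v) - T (S v) = bracket \<mu> (bracket \<mu> v a) b - bracket \<mu> (bracket \<mu> v b) a"
      | "\<And>v. S (T v) - T (S v) = - (bracket \<mu> (bracket \<mu> v a) b - bracket \<mu> (bracket \<mu> v b) a)"
      by (force simp: left right_mult_def)
    then show "(\<lambda>v. S (T v) - T (S v)) \<in> derivations \<mu>"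
      by cases (use der neg[OF der] in simp_all)
  qed
qed


text \<open>
  For anticommutative structures nilpotency amounts to the vanishing of the left-normed products
  \<open>foldl (bracket \<mu>) x xs\<close> of a fixed length, which is visibly a Zariski closed condition.
\<close>

lemma alg_power_1 [simp]: "alg_power \<mu> (Suc 0) = UNIV"
  by (simp add: alg_power.simps)

lemma bracket_in_alg_power:
  assumes "x \<in> alg_power \<mu> i" "y \<in> alg_power \<mu> j" "i \<ge> 1" "j \<ge> 1"
  shows "bracket \<mu> x y \<in> alg_power \<mu> (i + j)"
proof -
  have "i \<in> {1..<i + j}"
    using assms(3,4) by simp
  moreover have "bracket \<mu> x y \<in> {bracket \<mu> x y | x y. x \<in> alg_power \<mu> i \<and> y \<in> alg_power \<mu> (i + j - i)}"
    using assms(1,2) by auto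
  ultimately have "bracket \<mu> x y \<in> (\<Union>i'\<in>{1..<i + j}.
      {bracket \<mu> x y | x y. x \<in> alg_power \<mu> i' \<and> y \<in> alg_power \<mu> (i + j - i')})"
    by (rule UN_I)
  then show ?thesis
    using assms(3,4) by (subst alg_power.simps) (simp add: vec.span_base)
qed

lemma foldl_bracket_in_alg_power:
  "x \<in> alg_power \<mu> m \<Longrightarrow> m \<ge> 1 \<Longrightarrow> foldl (bracket \<mu>) x xs \<in> alg_power \<mu> (m + length xs)"
proof (induction xs arbitrary: x m)
  case (Cons y xs)
  have "bracket \<mu> x y \<in> alg_power \<mu> (Suc m)"
    using bracket_in_alg_power[of x \<mu> m y 1] Cons.prems by simp
  from Cons.IH[OF this] show ?case
    by simp
qed simp

lemma nilpotent_left_normed: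
  assumes "nilpotent \<mu>"
  obtains n where "\<And>x xs. length xs = n \<Longrightarrow> foldl (bracket \<mu>) x xs = 0"
proof -
  obtain n where n: "n \<ge> 1" "alg_power \<mu> n = {0}"
    using assms unfolding nilpotent_def by blast
  have "foldl (bracket \<mu>) x xs = 0" if "length xs = n - 1" for x xs
    using foldl_bracket_in_alg_power[of x \<mu> 1 xs] n that by simp
  then show ?thesis
    using that by blast
qed

text \<open>Some number \<open>m\<close> of appended factors still allows a left-normed product
  outside \<open>I\<close>, while \<open>m + 1\<close> factors always lead into \<open>I\<close>.
  Such a product is the required vector. As \<open>I\<close> may be any proper subspace, a flag can
  be built from below one vector at a time.\<close>

lemma left_normed_central:
  assumes nil: "\<And>x xs. length xs = n \<Longrightarrow> foldl (bracket \<mu>) x xs = 0"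
    and I: "vec.subspace I" "I \<noteq> UNIV"
  obtains x where "x \<notin> I" "\<And>y. bracket \<mu> x y \<in> I"
proof -
  define P where "P n \<longleftrightarrow> (\<forall>x xs. length xs = n \<longrightarrow> foldl (bracket \<mu>) x xs \<in> I)" for n
  have "P n"
    unfolding P_def using nil vec.subspace_0[OF I(1)] by simp
  moreover have "\<not> P 0"
    unfolding P_def using I(2) by auto
  ultimately obtain m where m: "\<not> P m" "P (Suc m)"
    using ex_least_nat_less[of P n] by auto
  then obtain x xs where x: "length xs = m" "foldl (bracket \<mu>) x xs \<notin> I"
    unfolding P_def by blast
  have "bracket \<mu> (foldl (bracket \<mu>) x xs) y \<in> I" for y
    using m(2)[unfolded P_def, rule_format, of "xs @ [y]" x] x(1) by simp
  with x(2) show ?thesis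
    using that by blast
qed

lemma vec_span_insertE:
  fixes x :: "'k::field ^ 'n"
  assumes "x \<in> vec.span (insert a S)"
  obtains k y where "x = k *s a + y" "y \<in> vec.span S"
  using assms unfolding vec.span_breakdown_eq by (metis add.commute diff_add_cancel)

lemma nilpotent_tri:
  fixes \<mu> :: "(complex, 6) alg"
  assumes nil: "\<And>x xs. length xs = n \<Longrightarrow> foldl (bracket \<mu>) x xs = 0"
    and anti: "anticommutative \<mu>"
  obtains a3 a4 a5 a6 b4 b5 b6 d4 d5 d6 p5 p6 q5 q6 r5 r6 u v w z
  where "\<mu> \<in> orbit (tri a3 a4 a5 a6 b4 b5 b6 d4 d5 d6 p5 p6 q5 q6 r5 r6 u v w z)"
proof -
  have ne: "vec.span (set hs) \<noteq> (UNIV :: (complex ^ 6) set)" if "length hs < 6" for hs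
    using vec.dim_le_card[of "UNIV :: (complex ^ 6) set" "set hs"] that card_length[of hs]
    by (auto simp: card_cart_basis)
  have step: "\<exists>x. x \<notin> vec.span (set hs) \<and> (\<forall>y. bracket \<mu> x y \<in> vec.span (set hs))" if "length hs < 6" for hs
    using left_normed_central[OF nil vec.subspace_span ne[OF that]] by blast
  \<comment> \<open>The basis is chosen from the bottom: each new vector multiplies the whole
    algebra into the span of those already chosen.\<close>
  obtain h6 where h6: "h6 \<notin> vec.span {}" "\<And>y. bracket \<mu> h6 y \<in> vec.span {}"
    using step[of "[]"] by auto
  obtain h5 where h5: "h5 \<notin> vec.span {h6}" "\<And>y. bracket \<mu> h5 y \<in> vec.span {h6}"
    using step[of "[h6]"] by auto
  obtain h4 where h4: "h4 \<notin> vec.span {h5, h6}" "\<And>y. bracket \<mu> h4 y \<in> vec.span {h5, h6}"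
    using step[of "[h5, h6]"] by auto
  obtain h3 where h3: "h3 \<notin> vec.span {h4, h5, h6}" "\<And>y. bracket \<mu> h3 y \<in> vec.span {h4, h5, h6}"
    using step[of "[h4, h5, h6]"] by auto
  obtain h2 where h2: "h2 \<notin> vec.span {h3, h4, h5, h6}" "\<And>y. bracket \<mu> h2 y \<in> vec.span {h3, h4, h5, h6}"
    using step[of "[h3, h4, h5, h6]"] by auto
  \<comment> \<open>For \<open>h1\<close> independence suffices, because products with it are
    controlled through the other factor.\<close>
  obtain h1 where h1: "h1 \<notin> vec.span {h2, h3, h4, h5, h6}"
    using ne[of "[h2, h3, h4, h5, h6]"] by auto
  note swap = anticommutative_swap[OF anti]
  have span6: "\<exists>a. x = a *s h6" if "x \<in> vec.span {h6}" for x
    using that by (auto elim!: vec_span_insertE)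
  have span5: "\<exists>a b. x = a *s h5 + b *s h6" if "x \<in> vec.span {h5, h6}" for x
    using vec_span_insertE[OF that] span6 by metis
  have span4: "\<exists>a b c. x = a *s h4 + b *s h5 + c *s h6" if "x \<in> vec.span {h4, h5, h6}" for x
    using vec_span_insertE[OF that] span5 by (metis add.assoc)
  have span3: "\<exists>a b c d. x = a *s h3 + b *s h4 + c *s h5 + d *s h6" if "x \<in> vec.span {h3, h4, h5, h6}" for x
    using vec_span_insertE[OF that] span4 by (metis add.assoc)
  have out: "c = 0" if "c *s h + y = 0" "y \<in> vec.span S" "h \<notin> vec.span S" for c and h y :: "complex ^ 6" and S
  proof (rule ccontr)
    assume "c \<noteq> 0"
    have "h = inverse c *s (c *s h)"
      using \<open>c \<noteq> 0\<close> by simp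
    also have "c *s h = - y"
      using that(1) by (simp add: eq_neg_iff_add_eq_0)
    finally have "h = (- inverse c) *s y"
      by simp
    with that(2,3) show False
      using vec.span_scale by blast
  qed
  have indep: "independent6 h1 h2 h3 h4 h5 h6"
    unfolding independent6_def
  proof (intro allI impI)
    fix x1 x2 x3 x4 x5 x6
    assume eq: "x1 *s h1 + x2 *s h2 + x3 *s h3 + x4 *s h4 + x5 *s h5 + x6 *s h6 = 0"
    have "x1 *s h1 + (x2 *s h2 + x3 *s h3 + x4 *s h4 + x5 *s h5 + x6 *s h6) = 0"
      using eq by (simp only: add.assoc)
    then have x1: "x1 = 0"
      by (rule out[OF _ _ h1]) (intro vec.span_add vec.span_scale vec.span_base; simp)
    have "x2 *s h2 + (x3 *s h3 + x4 *s h4 + x5 *s h5 + x6 *s h6) = 0"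
      using eq by (simp add: x1 add.assoc)
    then have x2: "x2 = 0"
      by (rule out[OF _ _ h2(1)]) (intro vec.span_add vec.span_scale vec.span_base; simp)
    have "x3 *s h3 + (x4 *s h4 + x5 *s h5 + x6 *s h6) = 0"
      using eq by (simp add: x1 x2 add.assoc)
    then have x3: "x3 = 0"
      by (rule out[OF _ _ h3(1)]) (intro vec.span_add vec.span_scale vec.span_base; simp)
    have "x4 *s h4 + (x5 *s h5 + x6 *s h6) = 0"
      using eq by (simp add: x1 x2 x3 add.assoc)
    then have x4: "x4 = 0"
      by (rule out[OF _ _ h4(1)]) (intro vec.span_add vec.span_scale vec.span_base; simp)
    have "x5 *s h5 + x6 *s h6 = 0"
      using eq by (simp add: x1 x2 x3 x4)
    then have x5: "x5 = 0"
      by (rule out[OF _ _ h5(1)]) (intro vec.span_add vec.span_scale vec.span_base; simp)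
    have "x6 = 0"
      using eq h6(1) by (simp add: x1 x2 x3 x4 x5 vec.span_empty)
    with x1 x2 x3 x4 x5 show "x1 = 0 \<and> x2 = 0 \<and> x3 = 0 \<and> x4 = 0 \<and> x5 = 0 \<and> x6 = 0"
      by blast
  qed
  have r6: "bracket \<mu> x h6 = 0" for x
    using h6(2)[of x] swap[of h6 x] by simp
  have r5: "bracket \<mu> x h5 \<in> vec.span {h6}" for x
    unfolding swap[of x h5] by (rule vec.span_neg[OF h5(2)])
  have r4: "bracket \<mu> x h4 \<in> vec.span {h5, h6}" for x
    unfolding swap[of x h4] by (rule vec.span_neg[OF h4(2)])
  have r3: "bracket \<mu> x h3 \<in> vec.span {h4, h5, h6}" for x
    unfolding swap[of x h3] by (rule vec.span_neg[OF h3(2)])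
  have r2: "bracket \<mu> x h2 \<in> vec.span {h3, h4, h5, h6}" for x
    unfolding swap[of x h2] by (rule vec.span_neg[OF h2(2)])
  obtain u v w z where uvwz: "bracket \<mu> h1 h5 = u *s h6" "bracket \<mu> h2 h5 = v *s h6"
    "bracket \<mu> h3 h5 = w *s h6" "bracket \<mu> h4 h5 = z *s h6"
    using span6[OF r5[of h1]] span6[OF r5[of h2]] span6[OF r5[of h3]] span6[OF r5[of h4]] by blast
  obtain p5 p6 q5 q6 r5 r6 where pqr: "bracket \<mu> h1 h4 = p5 *s h5 + p6 *s h6"
    "bracket \<mu> h2 h4 = q5 *s h5 + q6 *s h6" "bracket \<mu> h3 h4 = r5 *s h5 + r6 *s h6"
    using span5[OF r4[of h1]] span5[OF r4[of h2]] span5[OF r4[of h3]] by blast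
  obtain b4 b5 b6 d4 d5 d6 where bd: "bracket \<mu> h1 h3 = b4 *s h4 + b5 *s h5 + b6 *s h6"
    "bracket \<mu> h2 h3 = d4 *s h4 + d5 *s h5 + d6 *s h6"
    using span4[OF r3[of h1]] span4[OF r3[of h2]] by blast
  obtain a3 a4 a5 a6 where a: "bracket \<mu> h1 h2 = a3 *s h3 + a4 *s h4 + a5 *s h5 + a6 *s h6"
    using span3[OF r2[of h1]] by blast
  show ?thesis
    by (rule that, rule orbit_triI[OF anti indep a bd pqr uvwz r6 r6 r6 r6 r6])
qed

text \<open>A flag whose first step drops \<open>\<e> 1\<close> and \<open>\<e> 2\<close> together,
  since no product has a component along either. Hence zero is reached after five steps instead of
  six.\<close>

definition tri_filtration :: "nat \<Rightarrow> (complex ^ 6) set" where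
  "tri_filtration k = {x. (k \<ge> 1 \<longrightarrow> x $ 1 = 0 \<and> x $ 2 = 0) \<and> (k \<ge> 2 \<longrightarrow> x $ 3 = 0) \<and>
     (k \<ge> 3 \<longrightarrow> x $ 4 = 0) \<and> (k \<ge> 4 \<longrightarrow> x $ 5 = 0) \<and> (k \<ge> 5 \<longrightarrow> x $ 6 = 0)}"

lemma tri_filtration_5: "tri_filtration 5 = {0}"
  by (auto simp: tri_filtration_def vec_eq_iff forall_6)

lemma subspace_tri_filtration: "vec.subspace (tri_filtration k)"
  unfolding vec.subspace_def tri_filtration_def by auto

lemma bracket_tri_filtration:
  assumes "x \<in> tri_filtration k"
  shows "bracket (tri a3 a4 a5 a6 b4 b5 b6 d4 d5 d6 p5 p6 q5 q6 r5 r6 u v w z) x y \<in> tri_filtration (Suc k)"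
  using assms unfolding tri_filtration_def by (cases x; cases y) (auto simp: bracket_tri)

lemma left_normed_tri:
  assumes "length xs = 5"
  shows "foldl (bracket (tri a3 a4 a5 a6 b4 b5 b6 d4 d5 d6 p5 p6 q5 q6 r5 r6 u v w z)) x xs = 0"
proof -
  have "foldl (bracket (tri a3 a4 a5 a6 b4 b5 b6 d4 d5 d6 p5 p6 q5 q6 r5 r6 u v w z)) x xs
      \<in> tri_filtration (k + length xs)" if "x \<in> tri_filtration k" for k
    using that
  proof (induction xs arbitrary: x k)
    case (Cons y xs)
    from Cons.IH[OF bracket_tri_filtration[OF Cons.prems]] show ?case
      by simp
  qed simp
  from this[of 0] show ?thesis
    using assms by (simp add: tri_filtration_5) (simp add: tri_filtration_def)
qed

text \<open>In each summand of a power with exponent at least \<open>2 ^ Suc k\<close> one factor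
  has exponent at least \<open>2 ^ k\<close>, so doubling the exponent descends one step of the
  flag. Five steps give the crude bound 32.\<close>

lemma alg_power_tri: "alg_power (tri a3 a4 a5 a6 b4 b5 b6 d4 d5 d6 p5 p6 q5 q6 r5 r6 u v w z) 32 = {0}"
proof -
  let ?F = tri_filtration
  define \<mu> where "\<mu> = tri a3 a4 a5 a6 b4 b5 b6 d4 d5 d6 p5 p6 q5 q6 r5 r6 u v w z"
  have step: "bracket \<mu> x y \<in> ?F (Suc k)" if "x \<in> ?F k" for x y k
    unfolding \<mu>_def using bracket_tri_filtration[OF that] .
  have step': "bracket \<mu> x y \<in> ?F (Suc k)" if "y \<in> ?F k" for x y k
    unfolding \<mu>_def anticommutative_swap[OF anticommutative_tri, of _ _ _ _ _ _ _ _ _ _ _ _ _ _ _ _ _ _ _ _ x]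
    by (rule vec.subspace_neg[OF subspace_tri_filtration bracket_tri_filtration[OF that]])
  have "alg_power \<mu> n \<subseteq> ?F k" if "2 ^ k \<le> n" for n k
    using that
  proof (induction k arbitrary: n)
    case 0
    then show ?case
      by (simp add: tri_filtration_def)
  next
    case (Suc k)
    have "n > 1"
      using Suc.prems one_le_power[of "2::nat" k] unfolding power_Suc by linarith
    moreover have "vec.span (\<Union>i\<in>{1..<n}. {bracket \<mu> x y | x y. x \<in> alg_power \<mu> i \<and> y \<in> alg_power \<mu> (n - i)}) \<subseteq> ?F (Suc k)"
    proof (rule vec.span_minimal[OF _ subspace_tri_filtration], safe)
      fix i x y assume i: "i \<in> {1..<n}" and xy: "x \<in> alg_power \<mu> i" "y \<in> alg_power \<mu> (n - i)"
      have "2 ^ k \<le> i \<or> 2 ^ k \<le> n - i"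
        using Suc.prems by auto
      then show "bracket \<mu> x y \<in> ?F (Suc k)"
        using step step' Suc.IH xy by blast
    qed
    ultimately show ?case
      by (subst alg_power.simps) simp
  qed
  from this[of 5 32] have "alg_power \<mu> 32 \<subseteq> {0}"
    by (simp add: tri_filtration_5)
  moreover have "0 \<in> alg_power \<mu> 32"
    by (subst alg_power.simps) (simp add: vec.span_zero)
  ultimately show ?thesis
    unfolding \<mu>_def by blast
qed

section \<open>Invariance of the variety under changes of basis\<close>

lemma alg_power_gl_act:
  assumes "invertible g" "alg_power \<mu> n \<subseteq> {0}"
  shows "alg_power (gl_act g \<mu>) n \<subseteq> {0}"
proof -
  have "alg_power (gl_act g \<mu>) m \<subseteq> {x. matrix_inv g *v x \<in> alg_power \<mu> m}" for m
  proof (induction m rule: less_induct)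
    case (less m)
    show ?case
    proof (cases "m \<le> 1")
      case True
      then show ?thesis
        by (auto simp: alg_power.simps[of _ m])
    next
      case False
      have sub: "vec.subspace {x. matrix_inv g *v x \<in> alg_power \<mu> m}"
        using False by (auto simp: vec.subspace_def alg_power.simps[of _ m] matrix_vector_right_distrib
          vec.scale vec.span_add vec.span_scale vec.span_zero)
      have "bracket (gl_act g \<mu>) x y \<in> {x. matrix_inv g *v x \<in> alg_power \<mu> m}"
        if "i \<in> {1..<m}" "x \<in> alg_power (gl_act g \<mu>) i" "y \<in> alg_power (gl_act g \<mu>) (m - i)" for i x y
      proof -
        have "matrix_inv g *v x \<in> alg_power \<mu> i" "matrix_inv g *v y \<in> alg_power \<mu> (m - i)"
          using that less.IH[of i] less.IH[of "m - i"] by auto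
        from bracket_in_alg_power[OF this] that(1)
        have "bracket \<mu> (matrix_inv g *v x) (matrix_inv g *v y) \<in> alg_power \<mu> m"
          by (metis add_diff_inverse_nat atLeastLessThan_iff less_imp_le_nat not_less zero_less_diff less_one not_le)
        then show ?thesis
          by (simp add: bracket_gl_act matrix_inv_cancel assms(1))
      qed
      then have "vec.span (\<Union>i\<in>{1..<m}. {bracket (gl_act g \<mu>) x y | x y. x \<in> alg_power (gl_act g \<mu>) i \<and>
          y \<in> alg_power (gl_act g \<mu>) (m - i)}) \<subseteq> {x. matrix_inv g *v x \<in> alg_power \<mu> m}"
        by (intro vec.span_minimal[OF _ sub]) blast
      with False show ?thesis
        by (subst alg_power.simps) simp
    qed
  qed
  then have "matrix_inv g *v x = 0" if "x \<in> alg_power (gl_act g \<mu>) n" for x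
    using that assms(2) by blast
  then show ?thesis
    using matrix_inv_cancel(2)[OF assms(1)] by (metis insertI1 matrix_vector_mult_0_right subsetI)
qed

lemma foldl_bracket_gl_act:
  assumes "invertible g"
  shows "foldl (bracket (gl_act g \<mu>)) x xs =
    g *v foldl (bracket \<mu>) (matrix_inv g *v x) (map ((*v) (matrix_inv g)) xs)"
proof (induction xs arbitrary: x)
  case (Cons y xs)
  show ?case
    unfolding foldl_Cons list.map Cons.IH by (simp add: bracket_gl_act matrix_inv_cancel assms)
qed (simp add: matrix_inv_cancel assms)

lemma anticommutative_gl_act: "anticommutative \<mu> \<Longrightarrow> anticommutative (gl_act g \<mu>)"
  by (simp add: anticommutative_def bracket_gl_act)

lemma CD_identity_gl_act:
  assumes "invertible g" "CD_identity \<mu>"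
  shows "CD_identity (gl_act g \<mu>)"
  unfolding CD_identity_def
proof (intro allI)
  fix x y a b
  show "bracket (gl_act g \<mu>) (bracket (gl_act g \<mu>) (bracket (gl_act g \<mu>) x y) a) b -
      bracket (gl_act g \<mu>) (bracket (gl_act g \<mu>) (bracket (gl_act g \<mu>) x y) b) a =
      bracket (gl_act g \<mu>) (bracket (gl_act g \<mu>) (bracket (gl_act g \<mu>) x a) b) y -
      bracket (gl_act g \<mu>) (bracket (gl_act g \<mu>) (bracket (gl_act g \<mu>) x b) a) y +
      bracket (gl_act g \<mu>) x (bracket (gl_act g \<mu>) (bracket (gl_act g \<mu>) y a) b) -
      bracket (gl_act g \<mu>) x (bracket (gl_act g \<mu>) (bracket (gl_act g \<mu>) y b) a)"
    unfolding bracket_gl_act matrix_inv_cancel(1)[OF assms(1)]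
      matrix_vector_right_distrib[symmetric] matrix_vector_mult_diff_distrib[symmetric]
    using assms(2) unfolding CD_identity_def by metis
qed

text \<open>Both directions pass through the triangular form. Any bound on left-normed products
  yields it; a triangular structure kills every product with five appended factors, and its 32nd
  power is zero.\<close>

lemma nilpotent_anticomm_CD_iff:
  fixes \<mu> :: "(complex, 6) alg"
  shows "\<mu> \<in> nilpotent_anticomm_CD \<longleftrightarrow>
    anticommutative \<mu> \<and> CD_identity \<mu> \<and> (\<forall>x xs. length xs = 5 \<longrightarrow> foldl (bracket \<mu>) x xs = 0)"
proof -
  have "nilpotent \<mu> \<longleftrightarrow> (\<forall>x xs. length xs = 5 \<longrightarrow> foldl (bracket \<mu>) x xs = 0)" if anti: "anticommutative \<mu>"
  proof
    assume "nilpotent \<mu>"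
    then obtain n where "\<And>x xs. length xs = n \<Longrightarrow> foldl (bracket \<mu>) x xs = 0"
      by (rule nilpotent_left_normed) blast
    then obtain a3 a4 a5 a6 b4 b5 b6 d4 d5 d6 p5 p6 q5 q6 r5 r6 u v w z
      where "\<mu> \<in> orbit (tri a3 a4 a5 a6 b4 b5 b6 d4 d5 d6 p5 p6 q5 q6 r5 r6 u v w z)"
      by (rule nilpotent_tri[OF _ anti])
    then show "\<forall>x xs. length xs = 5 \<longrightarrow> foldl (bracket \<mu>) x xs = 0"
      unfolding orbit_def by (auto simp: foldl_bracket_gl_act left_normed_tri)
  next
    assume "\<forall>x xs. length xs = 5 \<longrightarrow> foldl (bracket \<mu>) x xs = 0"
    then have "\<And>x xs. length xs = 5 \<Longrightarrow> foldl (bracket \<mu>) x xs = 0"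
      by blast
    then obtain a3 a4 a5 a6 b4 b5 b6 d4 d5 d6 p5 p6 q5 q6 r5 r6 u v w z
      where "\<mu> \<in> orbit (tri a3 a4 a5 a6 b4 b5 b6 d4 d5 d6 p5 p6 q5 q6 r5 r6 u v w z)"
      by (rule nilpotent_tri[OF _ anti])
    then obtain g where "invertible g"
      "\<mu> = gl_act g (tri a3 a4 a5 a6 b4 b5 b6 d4 d5 d6 p5 p6 q5 q6 r5 r6 u v w z)"
      unfolding orbit_def by blast
    then have "alg_power \<mu> 32 \<subseteq> {0}"
      using alg_power_gl_act[OF _ equalityD1[OF alg_power_tri]] by simp
    moreover have "0 \<in> alg_power \<mu> 32"
      by (subst alg_power.simps) (simp add: vec.span_zero)
    ultimately show "nilpotent \<mu>"
      unfolding nilpotent_def by (intro exI[of _ 32]) auto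
  qed
  then show ?thesis
    unfolding nilpotent_anticomm_CD_def using CD_identity_iff by blast
qed

lemma gl_invariant_CD: "gl_invariant (nilpotent_anticomm_CD :: (complex, 6) alg set)"
  unfolding gl_invariant_def
proof (intro ballI allI impI)
  fix \<mu> :: "(complex, 6) alg" and g :: "complex ^ 6 ^ 6"
  assume "\<mu> \<in> nilpotent_anticomm_CD" "invertible g"
  then show "gl_act g \<mu> \<in> nilpotent_anticomm_CD"
    unfolding nilpotent_anticomm_CD_iff
    by (simp add: anticommutative_gl_act CD_identity_gl_act foldl_bracket_gl_act)
qed

section \<open>Closedness of the variety\<close>

lemma closedin_zariski_anticommutative: "closedin zariski {\<mu>. anticommutative \<mu>}"
  unfolding anticommutative_def
  by (intro closedin_zariski_All closedin_zariski_vec_zero poly_map_bracket poly_map_intros)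

lemma closedin_zariski_CD_identity: "closedin zariski {\<mu>. CD_identity \<mu>}"
  unfolding CD_identity_def
  by (subst eq_iff_diff_eq_0, intro closedin_zariski_All closedin_zariski_vec_zero, simp,
    intro poly_map_bracket poly_map_intros)

lemma poly_map_foldl_bracket:
  "(\<And>k. poly_map (\<lambda>\<mu>. F \<mu> $ k)) \<Longrightarrow> poly_map (\<lambda>\<mu>. foldl (bracket \<mu>) (F \<mu>) xs $ k)"
proof (induction xs arbitrary: F)
  case (Cons y xs)
  show ?case
    unfolding foldl_Cons by (rule Cons.IH) (intro poly_map_bracket Cons.prems poly_map_intros)
qed simp

lemma closedin_zariski_CD: "closedin zariski (nilpotent_anticomm_CD :: (complex, 6) alg set)"
proof -
  have "nilpotent_anticomm_CD = {\<mu> :: (complex, 6) alg. anticommutative \<mu> \<and> CD_identity \<mu> \<and>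
      (\<forall>x xs. length xs = 5 \<longrightarrow> foldl (bracket \<mu>) x xs = 0)}"
    using nilpotent_anticomm_CD_iff by blast
  also have "closedin zariski \<dots>"
    by (intro closedin_zariski_conj closedin_zariski_anticommutative closedin_zariski_CD_identity
      closedin_zariski_All closedin_zariski_imp closedin_zariski_vec_zero poly_map_foldl_bracket poly_map_intros)
  finally show ?thesis .
qed

text \<open>Necessary conditions, read off by evaluating the identity at quadruples of basis vectors
  after the normalisation \<open>[e1, e2] = e3\<close>. The reduction draws on nothing else from the
  CD-property.\<close>

lemma CD_tri_eqs:
  assumes "tri 1 0 0 0 b4 b5 b6 d4 d5 d6 p5 p6 q5 q6 r5 r6 u v w z \<in> nilpotent_anticomm_CD"
  shows "b4 * q5 = p5 * d4" "b4 * r5 = 0" "d4 * r5 = 0" "b4 * z = 0" "d4 * z = 0" "b5 * z = 0" "d5 * z = 0"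
    "u * r5 = 0" "v * r5 = 0" "w * r5 = 0" "z * r5 = 0"
    "b4 * q6 + b5 * v = p6 * d4 + u * d5"
    "b4 * r6 + b5 * w + b4 * p5 * v = p5 * u * d4"
    "d4 * r6 + d5 * w + b4 * q5 * v = u * d4 * q5"
    "b4 * (p5 * w) = b4 * (u * r5)"
proof -
  let ?T = "tri 1 0 0 0 b4 b5 b6 d4 d5 d6 p5 p6 q5 q6 r5 r6 u v w z"
  have CD: "bracket ?T (bracket ?T (bracket ?T x y) a) b - bracket ?T (bracket ?T (bracket ?T x y) b) a =
     bracket ?T (bracket ?T (bracket ?T x a) b) y - bracket ?T (bracket ?T (bracket ?T x b) a) y +
     bracket ?T x (bracket ?T (bracket ?T y a) b) - bracket ?T x (bracket ?T (bracket ?T y b) a)" for x y a b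
    using assms unfolding nilpotent_anticomm_CD_iff CD_identity_def by blast
  let ?e1 = "vec6 1 0 0 0 0 0" and ?e2 = "vec6 0 1 0 0 0 0" and ?e3 = "vec6 0 0 1 0 0 0"
    and ?e4 = "vec6 0 0 0 1 0 0" and ?e5 = "vec6 0 0 0 0 1 0"
  \<comment> \<open>This quadruple yields the second relation doubled; the factor 2 is cancelled
    afterwards.\<close>
  have "b4 * q5 = p5 * d4" "2 * (b4 * q6 + b5 * v) = 2 * (p6 * d4 + u * d5)"
    using CD[of ?e1 ?e2 ?e1 ?e2] by (simp_all add: bracket_tri algebra_simps)
  then have 1: "b4 * q5 = p5 * d4" "b4 * q6 + b5 * v = p6 * d4 + u * d5"
    by (blast, metis mult_cancel_left zero_neq_numeral)
  have 2: "b4 * r5 = 0" "d4 * r5 = 0" "b4 * r6 + b5 * w + b4 * p5 * v = p5 * u * d4"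
    "d4 * r6 + d5 * w + b4 * q5 * v = u * d4 * q5"
    using CD[of ?e1 ?e2 ?e1 ?e3] CD[of ?e1 ?e2 ?e2 ?e3] by (simp_all add: bracket_tri algebra_simps)
  have 3: "b4 * z = 0" "d4 * z = 0"
    using CD[of ?e1 ?e2 ?e1 ?e5] CD[of ?e1 ?e2 ?e2 ?e5] by (simp_all add: bracket_tri algebra_simps)
  have 4: "b5 * z = 0" "d5 * z = 0"
    using CD[of ?e1 ?e4 ?e1 ?e2] CD[of ?e2 ?e4 ?e1 ?e2] by (simp_all add: bracket_tri algebra_simps)
  have 5: "u * r5 = 0" "v * r5 = 0"
    using CD[of ?e1 ?e2 ?e1 ?e4] CD[of ?e1 ?e2 ?e2 ?e4] 4 by (simp_all add: bracket_tri algebra_simps)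
  have 6: "w * r5 = 0" "z * r5 = 0"
    using CD[of ?e1 ?e2 ?e3 ?e4] CD[of ?e1 ?e4 ?e2 ?e4] by (simp_all add: bracket_tri algebra_simps)
  have 7: "b4 * (p5 * w) = b4 * (u * r5)"
    using CD[of ?e1 ?e3 ?e1 ?e3] by (simp add: bracket_tri algebra_simps)
  show "b4 * q5 = p5 * d4" "b4 * r5 = 0" "d4 * r5 = 0" "b4 * z = 0" "d4 * z = 0" "b5 * z = 0" "d5 * z = 0"
    "u * r5 = 0" "v * r5 = 0" "w * r5 = 0" "z * r5 = 0"
    "b4 * q6 + b5 * v = p6 * d4 + u * d5"
    "b4 * r6 + b5 * w + b4 * p5 * v = p5 * u * d4"
    "d4 * r6 + d5 * w + b4 * q5 * v = u * d4 * q5"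
    "b4 * (p5 * w) = b4 * (u * r5)"
    by fact+
qed


section \<open>Reduction to three types\<close>

definition type_B :: "(complex, 6) alg set" where
  "type_B = {tri 0 a4 a5 a6 b4 b5 b6 d4 d5 d6 0 p6 0 q6 0 r6 u v w z |
     a4 a5 a6 b4 b5 b6 d4 d5 d6 p6 q6 r6 u v w z. True}"

text \<open>All products lie in the span of \<open>\<e> 3\<close>, \<open>\<e> 5\<close>,
  \<open>\<e> 6\<close>, where the only possible bracket \<open>[e3, e5]\<close> has been set to
  zero.\<close>

definition type_M :: "(complex, 6) alg set" where
  "type_M = {tri a3 0 a5 a6 0 b5 b6 0 0 d6 p5 p6 q5 q6 0 r6 u 0 0 0 |
     a3 a5 a6 b5 b6 d6 p5 p6 q5 q6 r6 u. True}"

text \<open>The entries \<open>u * d5\<close> and \<open>- p5 * v\<close> are the values that the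
  CD-identity forces on \<open>q6\<close> and \<open>r6\<close> once \<open>[e1, e2] = e3\<close>
  and \<open>[e1, e3] = e4\<close>. The same values make the Jacobi identity hold.\<close>

definition type_g :: "(complex, 6) alg set" where
  "type_g = {tri 1 0 0 0 1 0 0 0 d5 d6 p5 p6 0 (u * d5) 0 (- p5 * v) u v 0 0 |
     d5 d6 p5 p6 u v. True}"

definition reducible_to_types :: "(complex, 6) alg \<Rightarrow> bool" where
  "reducible_to_types \<mu> \<longleftrightarrow> (\<exists>\<nu> \<in> type_B \<union> type_M \<union> type_g. \<mu> \<in> orbit \<nu>)"

lemma reducible_orbit: "\<mu> \<in> orbit \<nu> \<Longrightarrow> reducible_to_types \<nu> \<Longrightarrow> reducible_to_types \<mu>"
  unfolding reducible_to_types_def using orbit_trans by blast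

lemma reducible_type_B: "reducible_to_types (tri 0 a4 a5 a6 b4 b5 b6 d4 d5 d6 0 p6 0 q6 0 r6 u v w z)"
  unfolding reducible_to_types_def type_B_def using orbit_refl by blast

lemma reducible_type_M: "reducible_to_types (tri a3 0 a5 a6 0 b5 b6 0 0 d6 p5 p6 q5 q6 0 r6 u 0 0 0)"
  unfolding reducible_to_types_def type_M_def using orbit_refl by blast

lemma reducible_type_g:
  "reducible_to_types (tri 1 0 0 0 1 0 0 0 d5 d6 p5 p6 0 (u * d5) 0 (- p5 * v) u v 0 0)"
  unfolding reducible_to_types_def type_g_def using orbit_refl by blast

text \<open>This form is preserved by every linear change of \<open>e\<^sub>1, \<dots>, e\<^sub>4\<close>.\<close>

lemma reducible_class2_aux:
  "reducible_to_types (tri 0 0 a5 a6 0 b5 b6 0 d5 d6 p5 p6 q5 q6 r5 r6 u 0 0 0)"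
proof -
  let ?T = "tri 0 0 a5 a6 0 b5 b6 0 d5 d6 p5 p6 q5 q6 r5 r6 u 0 0 0"
  consider "d5 \<noteq> 0" | "d5 = 0" "r5 \<noteq> 0" | "d5 = 0" "r5 = 0"
    by blast
  then show ?thesis
  proof cases
    case 1
    \<comment> \<open>The \<open>\<e> 5\<close>-components of the products of \<open>\<e> 2\<close>,
      \<open>\<e> 3\<close>, \<open>\<e> 4\<close> form an alternating form on a three-dimensional
      space, with kernel vector \<open>(r5, - q5, d5)\<close>. Put in third place, it clears the
      entries that \<open>type_M\<close> requires to vanish. The second case is the same with
      \<open>d5 = 0\<close>.\<close>
    have "?T \<in> orbit (tri 0 0 a5 a6 0 (r5 * a5 - q5 * b5 + d5 * p5) (r5 * a6 - q5 * b6 + d5 * p6)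
        0 0 (d5 * q6 - q5 * d6) b5 b6 d5 d6 0 (r5 * d6 - d5 * r6) u 0 0 0)"
      by (rule orbit_triI[OF anticommutative_tri, of "vec6 1 0 0 0 0 0" "vec6 0 1 0 0 0 0"
          "vec6 0 r5 (- q5) d5 0 0" "vec6 0 0 1 0 0 0" "vec6 0 0 0 0 1 0" "vec6 0 0 0 0 0 1"])
        (use 1 in \<open>auto simp: independent6_def bracket_tri algebra_simps\<close>)
    then show ?thesis
      using reducible_orbit reducible_type_M by blast
  next
    case 2
    have "?T \<in> orbit (tri 0 0 b5 b6 0 (r5 * a5 - q5 * b5) (r5 * a6 - q5 * b6)
        0 0 (- r5 * d6) p5 p6 r5 r6 0 (r5 * q6 - q5 * r6) u 0 0 0)"
      by (rule orbit_triI[OF anticommutative_tri, of "vec6 1 0 0 0 0 0" "vec6 0 0 1 0 0 0"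
          "vec6 0 r5 (- q5) 0 0 0" "vec6 0 0 0 1 0 0" "vec6 0 0 0 0 1 0" "vec6 0 0 0 0 0 1"])
        (use 2 in \<open>auto simp: independent6_def bracket_tri algebra_simps\<close>)
    then show ?thesis
      using reducible_orbit reducible_type_M by blast
  next
    case 3
    then show ?thesis
      by (simp add: reducible_type_M)
  qed
qed

text \<open>Multiplication with \<open>\<e> 5\<close> is a linear functional on the span of
  \<open>\<e> 1\<close>, ..., \<open>\<e> 4\<close>, with values on the line of
  \<open>\<e> 6\<close>. A vector outside its kernel is taken first and the other three are
  corrected into the kernel, which clears \<open>v\<close>, \<open>w\<close>,
  \<open>z\<close>.\<close>

lemma reducible_class2:
  "reducible_to_types (tri 0 0 a5 a6 0 b5 b6 0 d5 d6 p5 p6 q5 q6 r5 r6 u v w z)"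
proof -
  let ?T = "tri 0 0 a5 a6 0 b5 b6 0 d5 d6 p5 p6 q5 q6 r5 r6 u v w z"
  consider "z \<noteq> 0" | "z = 0" "w \<noteq> 0" | "z = 0" "w = 0" "v \<noteq> 0" | "z = 0" "w = 0" "v = 0"
    by blast
  then show ?thesis
  proof cases
    case 1
    define x y t where "x = u / z" "y = v / z" "t = w / z"
    then have uvw: "u = x * z" "v = y * z" "w = t * z"
      using 1 by simp_all
    have "?T \<in> orbit (tri 0 0 (- p5) (- p6) 0 (- q5) (- q6) 0 (a5 - y * p5 + x * q5) (a6 - y * p6 + x * q6)
        (- r5) (- r6) (b5 - t * p5 + x * r5) (b6 - t * p6 + x * r6) (d5 - t * q5 + y * r5) (d6 - t * q6 + y * r6) z 0 0 0)"
      by (rule orbit_triI[OF anticommutative_tri, of "vec6 0 0 0 1 0 0" "vec6 1 0 0 (- x) 0 0"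
          "vec6 0 1 0 (- y) 0 0" "vec6 0 0 1 (- t) 0 0" "vec6 0 0 0 0 1 0" "vec6 0 0 0 0 0 1"])
        (auto simp: independent6_def bracket_tri uvw algebra_simps)
    then show ?thesis
      using reducible_orbit reducible_class2_aux by blast
  next
    case 2
    define x y where "x = u / w" "y = v / w"
    then have uv: "u = x * w" "v = y * w"
      using 2 by simp_all
    have "?T \<in> orbit (tri 0 0 (- b5) (- b6) 0 (- d5) (- d6) 0 (a5 - y * b5 + x * d5) (a6 - y * b6 + x * d6)
        r5 r6 (p5 - x * r5) (p6 - x * r6) (q5 - y * r5) (q6 - y * r6) w 0 0 0)"
      by (rule orbit_triI[OF anticommutative_tri, of "vec6 0 0 1 0 0 0" "vec6 1 0 (- x) 0 0 0"
          "vec6 0 1 (- y) 0 0 0" "vec6 0 0 0 1 0 0" "vec6 0 0 0 0 1 0" "vec6 0 0 0 0 0 1"])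
        (use 2(1) in \<open>auto simp: independent6_def bracket_tri uv algebra_simps\<close>)
    then show ?thesis
      using reducible_orbit reducible_class2_aux by blast
  next
    case 3
    define x where "x = u / v"
    then have u: "u = x * v"
      using 3 by simp
    have "?T \<in> orbit (tri 0 0 (- a5) (- a6) 0 d5 d6 0 (b5 - x * d5) (b6 - x * d6)
        q5 q6 (p5 - x * q5) (p6 - x * q6) r5 r6 v 0 0 0)"
      by (rule orbit_triI[OF anticommutative_tri, of "vec6 0 1 0 0 0 0" "vec6 1 (- x) 0 0 0 0"
          "vec6 0 0 1 0 0 0" "vec6 0 0 0 1 0 0" "vec6 0 0 0 0 1 0" "vec6 0 0 0 0 0 1"])
        (use 3(1,2) in \<open>auto simp: independent6_def bracket_tri u algebra_simps\<close>)
    then show ?thesis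
      using reducible_orbit reducible_class2_aux by blast
  next
    case 4
    then show ?thesis
      by (simp add: reducible_class2_aux)
  qed
qed

section \<open>Reduction of structures with [e1, e2] = e3\<close>

lemma orbit_rotate:
  "tri 1 0 0 0 b4 b5 b6 d4 d5 d6 p5 p6 q5 q6 r5 r6 u v w z \<in>
   orbit (tri 1 0 0 0 d4 d5 d6 (s * d4 - b4) (s * d5 - b5) (s * d6 - b6) q5 q6 (s * q5 - p5) (s * q6 - p6) r5 r6
     v (s * v - u) w z)"
  by (rule orbit_triI[OF anticommutative_tri, of "vec6 0 1 0 0 0 0" "vec6 (- 1) s 0 0 0 0"
      "vec6 0 0 1 0 0 0" "vec6 0 0 0 1 0 0" "vec6 0 0 0 0 1 0" "vec6 0 0 0 0 0 1"])
    (auto simp: independent6_def bracket_tri algebra_simps)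

text \<open>The hypothesis says that \<open>(b5, d5)\<close> and \<open>(u, v)\<close> are
  proportional, so a single rotation clears \<open>d5\<close> and \<open>v\<close> together. It is
  what the relation \<open>b4 * q6 + b5 * v = p6 * d4 + u * d5\<close> becomes for
  \<open>b4 = d4 = 0\<close>.\<close>

lemma reducible_rank1:
  assumes "b5 * v = u * d5"
  shows "reducible_to_types (tri 1 0 0 0 0 b5 b6 0 d5 d6 p5 p6 q5 q6 0 r6 u v 0 0)"
proof -
  have red: "reducible_to_types (tri 1 0 0 0 0 b5 b6 0 d5 d6 p5 p6 q5 q6 0 r6 u v 0 0)"
    if "s * d5 = b5" "s * v = u" for s
    using orbit_rotate[of 0 b5 b6 0 d5 d6 p5 p6 q5 q6 0 r6 u v 0 0 s] that
    by (simp add: reducible_orbit[OF _ reducible_type_M])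
  show ?thesis
  proof (cases "d5 = 0")
    case False
    then show ?thesis
      using assms by (intro red[of "b5 / d5"]) (simp_all add: field_simps)
  next
    case True
    then show ?thesis
    proof (cases "v = 0")
      case False
      with True assms show ?thesis
        by (intro red[of "u / v"]) (simp_all add: field_simps)
    qed (simp add: reducible_type_M)
  qed
qed

text \<open>All products with \<open>\<e> 3\<close> as a factor lie on the line of
  \<open>\<e> 6\<close>. Hence \<open>\<e> 3\<close> can take the place of \<open>\<e> 4\<close>,
  where \<open>type_B\<close> asks for just that.\<close>

lemma reducible_swap34:
  "reducible_to_types (tri 1 0 0 0 0 0 b6 0 0 d6 p5 p6 q5 q6 0 r6 u v w z)"
proof -
  have "tri 1 0 0 0 0 0 b6 0 0 d6 p5 p6 q5 q6 0 r6 u v w z \<in>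
      orbit (tri 0 1 0 0 0 p5 p6 0 q5 q6 0 b6 0 d6 0 (- r6) u v z w)"
    by (rule orbit_triI[OF anticommutative_tri, of "vec6 1 0 0 0 0 0" "vec6 0 1 0 0 0 0"
        "vec6 0 0 0 1 0 0" "vec6 0 0 1 0 0 0" "vec6 0 0 0 0 1 0" "vec6 0 0 0 0 0 1"])
      (auto simp: independent6_def bracket_tri algebra_simps)
  then show ?thesis
    using reducible_orbit reducible_type_B by blast
qed

lemma CD_orbit: "\<mu> \<in> nilpotent_anticomm_CD \<Longrightarrow> \<mu> \<in> orbit \<nu> \<Longrightarrow> \<nu> \<in> nilpotent_anticomm_CD"
  for \<mu> \<nu> :: "(complex, 6) alg"
  using gl_invariantD[OF gl_invariant_CD] orbit_sym by blast

text \<open>With \<open>[e1, e3]\<close> as fourth basis vector the relations become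
  \<open>q6' = u * d5\<close>, \<open>r6' = - p5' * v\<close>, \<open>d5 * w = 0\<close> and
  \<open>p5' * w = 0\<close>. For \<open>w = 0\<close> this is \<open>type_g\<close>; otherwise
  \<open>d5\<close> and \<open>p5'\<close> vanish, and exchanging \<open>\<e> 4\<close> with
  \<open>\<e> 5\<close> leads to \<open>type_M\<close>.\<close>

lemma reducible_filiform:
  assumes L: "tri 1 0 0 0 b4 b5 b6 0 d5 d6 p5 p6 q5 q6 r5 r6 u v w z \<in> nilpotent_anticomm_CD"
    and "b4 \<noteq> 0"
  shows "reducible_to_types (tri 1 0 0 0 b4 b5 b6 0 d5 d6 p5 p6 q5 q6 r5 r6 u v w z)"
proof -
  note eqs = CD_tri_eqs[OF L]
  have 0: "q5 = 0" "r5 = 0" "z = 0"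
    using eqs(1,2,4) \<open>b4 \<noteq> 0\<close> by auto
  define p5' p6' q6' r6' where
    "p5' = b4 * p5" "p6' = b4 * p6 + b5 * u" "q6' = b4 * q6 + b5 * v" "r6' = b4 * r6 + b5 * w"
  have orb: "tri 1 0 0 0 b4 b5 b6 0 d5 d6 p5 p6 q5 q6 r5 r6 u v w z \<in>
      orbit (tri 1 0 0 0 1 0 0 0 d5 d6 p5' p6' 0 q6' 0 r6' u v w 0)"
    by (rule orbit_triI[OF anticommutative_tri, of "vec6 1 0 0 0 0 0" "vec6 0 1 0 0 0 0"
        "vec6 0 0 1 0 0 0" "vec6 0 0 0 b4 b5 b6" "vec6 0 0 0 0 1 0" "vec6 0 0 0 0 0 1"])
      (use \<open>b4 \<noteq> 0\<close> in \<open>auto simp: independent6_def bracket_tri 0 p5'_p6'_q6'_r6'_def algebra_simps\<close>)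
  note eqs' = CD_tri_eqs[OF CD_orbit[OF L orb]]
  have q6': "q6' = u * d5" and r6': "r6' = - p5' * v" and "d5 * w = 0" and "p5' * w = 0"
    using eqs'(12-15) by (simp_all add: eq_neg_iff_add_eq_0)
  show ?thesis
  proof (cases "w = 0")
    case True
    then show ?thesis
      using orb reducible_orbit reducible_type_g by (simp add: q6' r6')
  next
    case False
    with \<open>d5 * w = 0\<close> \<open>p5' * w = 0\<close> have "d5 = 0" "p5' = 0"
      by auto
    moreover have "tri 1 0 0 0 1 0 0 0 0 d6 0 p6' 0 0 0 0 u v w 0 \<in>
        orbit (tri 1 0 0 0 0 1 0 0 0 d6 0 u 0 v 0 w p6' 0 0 0)"
      by (rule orbit_triI[OF anticommutative_tri, of "vec6 1 0 0 0 0 0" "vec6 0 1 0 0 0 0"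
          "vec6 0 0 1 0 0 0" "vec6 0 0 0 0 1 0" "vec6 0 0 0 1 0 0" "vec6 0 0 0 0 0 1"])
        (auto simp: independent6_def bracket_tri algebra_simps)
    then have "reducible_to_types (tri 1 0 0 0 1 0 0 0 0 d6 0 p6' 0 0 0 0 u v w 0)"
      using reducible_orbit reducible_type_M by blast
    ultimately show ?thesis
      using orb reducible_orbit by (simp add: q6' r6')
  qed
qed

lemma reducible_normalised:
  assumes L: "tri 1 0 0 0 b4 b5 b6 d4 d5 d6 p5 p6 q5 q6 r5 r6 u v w z \<in> nilpotent_anticomm_CD"
  shows "reducible_to_types (tri 1 0 0 0 b4 b5 b6 d4 d5 d6 p5 p6 q5 q6 r5 r6 u v w z)"
proof -
  note eqs = CD_tri_eqs[OF L]
  consider "d4 \<noteq> 0" | "d4 = 0" "b4 \<noteq> 0" | "d4 = 0" "b4 = 0"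
    by blast
  then show ?thesis
  proof cases
    \<comment> \<open>The rotation clears \<open>d4\<close> and moves its old, nonzero value into
      the place of \<open>b4\<close>.\<close>
    case 1
    define s where "s = b4 / d4"
    have s: "s * d4 - b4 = 0"
      using 1 by (simp add: s_def)
    note orb = orbit_rotate[of b4 b5 b6 d4 d5 d6 p5 p6 q5 q6 r5 r6 u v w z s, unfolded s]
    show ?thesis
      by (rule reducible_orbit[OF orb reducible_filiform[OF CD_orbit[OF L orb] 1]])
  next
    case 2
    with L reducible_filiform show ?thesis
      by simp
  next
    case bd: 3
    consider "z \<noteq> 0" | "z = 0" "r5 \<noteq> 0" | "z = 0" "r5 = 0"
      by blast
    then show ?thesis
    proof cases
      case 1
      with eqs(6,7,11) bd show ?thesis
        by (simp add: reducible_swap34)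
    next
      case 2
      with eqs(8-10) have 0: "u = 0" "v = 0" "w = 0"
        by auto
      \<comment> \<open>Since \<open>\<e> 5\<close> is central here, it may be mixed with
        \<open>\<e> 6\<close>. The new last vector is \<open>[e3, e4]\<close>, which clears
        \<open>r5\<close>.\<close>
      have "tri 1 0 0 0 b4 b5 b6 d4 d5 d6 p5 p6 q5 q6 r5 r6 u v w z \<in>
          orbit (tri 1 0 0 0 0 (b6 - b5 * r6/r5) (b5/r5) 0 (d6 - d5 * r6/r5) (d5/r5)
            (p6 - p5 * r6/r5) (p5/r5) (q6 - q5 * r6/r5) (q5/r5) 0 1 0 0 0 0)"
        by (rule orbit_triI[OF anticommutative_tri, of "vec6 1 0 0 0 0 0" "vec6 0 1 0 0 0 0"
            "vec6 0 0 1 0 0 0" "vec6 0 0 0 1 0 0" "vec6 0 0 0 0 0 1" "vec6 0 0 0 0 r5 r6"])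
          (use 2 in \<open>auto simp: independent6_def bracket_tri 0 bd field_simps\<close>)
      then show ?thesis
        by (rule reducible_orbit) (rule reducible_rank1, simp)
    next
      case 3
      show ?thesis
      proof (cases "w = 0")
        case True
        with 3 bd eqs(12) show ?thesis
          by (simp add: reducible_rank1)
      next
        case False
        with 3 bd eqs(13,14) show ?thesis
          by (simp add: reducible_swap34)
      qed
    qed
  qed
qed

lemma reducible_a3:
  assumes L: "tri a3 a4 a5 a6 b4 b5 b6 d4 d5 d6 p5 p6 q5 q6 r5 r6 u v w z \<in> nilpotent_anticomm_CD"
    and "a3 \<noteq> 0"
  shows "reducible_to_types (tri a3 a4 a5 a6 b4 b5 b6 d4 d5 d6 p5 p6 q5 q6 r5 r6 u v w z)"
proof -
  have orb: "tri a3 a4 a5 a6 b4 b5 b6 d4 d5 d6 p5 p6 q5 q6 r5 r6 u v w z \<in> orbit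
    (tri 1 0 0 0 (a3 * b4) (a3 * b5 + a4 * p5) (a3 * b6 + a4 * p6 + a5 * u) (a3 * d4) (a3 * d5 + a4 * q5) (a3 * d6 + a4 * q6 + a5 * v)
      p5 p6 q5 q6 (a3 * r5) (a3 * r6 - a5 * z) u v (a3 * w + a4 * z) z)"
    by (rule orbit_triI[OF anticommutative_tri, of "vec6 1 0 0 0 0 0" "vec6 0 1 0 0 0 0"
        "vec6 0 0 a3 a4 a5 a6" "vec6 0 0 0 1 0 0" "vec6 0 0 0 0 1 0" "vec6 0 0 0 0 0 1"])
      (use assms(2) in \<open>auto simp: independent6_def bracket_tri algebra_simps\<close>)
  show ?thesis
    by (rule reducible_orbit[OF orb reducible_normalised[OF CD_orbit[OF L orb]]])
qed

lemma reducible_tri: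
  assumes L: "tri a3 a4 a5 a6 b4 b5 b6 d4 d5 d6 p5 p6 q5 q6 r5 r6 u v w z \<in> nilpotent_anticomm_CD"
  shows "reducible_to_types (tri a3 a4 a5 a6 b4 b5 b6 d4 d5 d6 p5 p6 q5 q6 r5 r6 u v w z)"
proof -
  consider "a3 \<noteq> 0" | "a3 = 0" "a4 \<noteq> 0" | "a3 = 0" "a4 = 0" "b4 \<noteq> 0" | "a3 = 0" "a4 = 0" "b4 = 0" "d4 \<noteq> 0"
    | "a3 = 0" "a4 = 0" "b4 = 0" "d4 = 0"
    by blast
  then show ?thesis
  proof cases
    case 1
    with L show ?thesis
      by (rule reducible_a3)
  next
    case 2
    \<comment> \<open>The \<open>\<e> 4\<close>-components of the products of \<open>\<e> 1\<close>,
      \<open>\<e> 2\<close>, \<open>\<e> 3\<close> form an alternating form with kernel vector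
      \<open>(d4, - b4, a4)\<close>. This vector moves to fourth place and the old
      \<open>\<e> 4\<close> to third, which produces a nonzero \<open>a3\<close>. The next two cases
      do the same for the remaining positions of a nonzero coefficient.\<close>
    have orb: "tri a3 a4 a5 a6 b4 b5 b6 d4 d5 d6 p5 p6 q5 q6 r5 r6 u v w z \<in> orbit
      (tri a4 0 a5 a6 0 p5 p6 0 q5 q6 (a4 * b5 - b4 * a5) (a4 * b6 - b4 * a6) (a4 * d5 - d4 * a5) (a4 * d6 - d4 * a6)
        (b4 * q5 - d4 * p5 - a4 * r5) (b4 * q6 - d4 * p6 - a4 * r6) u v z (d4 * u - b4 * v + a4 * w))"
      by (rule orbit_triI[OF anticommutative_tri, of "vec6 1 0 0 0 0 0" "vec6 0 1 0 0 0 0"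
          "vec6 0 0 0 1 0 0" "vec6 d4 (- b4) a4 0 0 0" "vec6 0 0 0 0 1 0" "vec6 0 0 0 0 0 1"])
        (use 2 in \<open>auto simp: independent6_def bracket_tri algebra_simps\<close>)
    show ?thesis
      by (rule reducible_orbit[OF orb reducible_a3[OF CD_orbit[OF L orb] 2(2)]])
  next
    case 3
    have orb: "tri a3 a4 a5 a6 b4 b5 b6 d4 d5 d6 p5 p6 q5 q6 r5 r6 u v w z \<in> orbit
      (tri b4 0 b5 b6 0 p5 p6 0 r5 r6 (- b4 * a5) (- b4 * a6) (b4 * d5 - d4 * b5) (b4 * d6 - d4 * b6)
        (b4 * q5 - d4 * p5) (b4 * q6 - d4 * p6) u w z (d4 * u - b4 * v))"
      by (rule orbit_triI[OF anticommutative_tri, of "vec6 1 0 0 0 0 0" "vec6 0 0 1 0 0 0"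
          "vec6 0 0 0 1 0 0" "vec6 d4 (- b4) 0 0 0 0" "vec6 0 0 0 0 1 0" "vec6 0 0 0 0 0 1"])
        (use 3 in \<open>auto simp: independent6_def bracket_tri algebra_simps\<close>)
    show ?thesis
      by (rule reducible_orbit[OF orb reducible_a3[OF CD_orbit[OF L orb] 3(3)]])
  next
    case 4
    have orb: "tri a3 a4 a5 a6 b4 b5 b6 d4 d5 d6 p5 p6 q5 q6 r5 r6 u v w z \<in> orbit
      (tri d4 0 d5 d6 0 q5 q6 0 r5 r6 (- a5) (- a6) (- b5) (- b6) (- p5) (- p6) v w z u)"
      by (rule orbit_triI[OF anticommutative_tri, of "vec6 0 1 0 0 0 0" "vec6 0 0 1 0 0 0"
          "vec6 0 0 0 1 0 0" "vec6 1 0 0 0 0 0" "vec6 0 0 0 0 1 0" "vec6 0 0 0 0 0 1"])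
        (use 4 in \<open>auto simp: independent6_def bracket_tri algebra_simps\<close>)
    show ?thesis
      by (rule reducible_orbit[OF orb reducible_a3[OF CD_orbit[OF L orb] 4(4)]])
  next
    case 5
    then show ?thesis
      by (simp add: reducible_class2)
  qed
qed

lemma reducible_CD:
  assumes "\<mu> \<in> nilpotent_anticomm_CD"
  shows "reducible_to_types \<mu>"
proof -
  have anti: "anticommutative \<mu>" and nil: "\<And>x xs. length xs = 5 \<Longrightarrow> foldl (bracket \<mu>) x xs = 0"
    using assms unfolding nilpotent_anticomm_CD_iff by auto
  obtain a3 a4 a5 a6 b4 b5 b6 d4 d5 d6 p5 p6 q5 q6 r5 r6 u v w z
    where orb: "\<mu> \<in> orbit (tri a3 a4 a5 a6 b4 b5 b6 d4 d5 d6 p5 p6 q5 q6 r5 r6 u v w z)"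
    by (rule nilpotent_tri[OF nil anti])
  show ?thesis
    by (rule reducible_orbit[OF orb reducible_tri[OF CD_orbit[OF assms orb]]])
qed

section \<open>Membership of the three named algebras in the variety\<close>

lemma CD_identity_M6: "CD_identity (M6 \<epsilon>)"
  unfolding CD_identity_def M6_tri
proof (intro allI)
  fix x y a b :: "complex ^ 6"
  let ?B = "bracket (tri 1 0 0 0 0 1 0 0 0 0 0 0 \<epsilon> 0 0 1 1 0 0 0)"
  show "?B (?B (?B x y) a) b - ?B (?B (?B x y) b) a =
     ?B (?B (?B x a) b) y - ?B (?B (?B x b) a) y + ?B x (?B (?B y a) b) - ?B x (?B (?B y b) a)"
    by (cases x; cases y; cases a; cases b) (simp add: bracket_tri, (simp add: algebra_simps)?)
qed

lemma CD_identity_B61: "CD_identity B61"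
  unfolding CD_identity_def B61_tri
proof (intro allI)
  fix x y a b :: "complex ^ 6"
  let ?B = "bracket (tri 0 1 0 0 0 1 0 0 0 1 0 0 0 0 0 0 0 0 0 1)"
  show "?B (?B (?B x y) a) b - ?B (?B (?B x y) b) a =
     ?B (?B (?B x a) b) y - ?B (?B (?B x b) a) y + ?B x (?B (?B y a) b) - ?B x (?B (?B y b) a)"
    by (cases x; cases y; cases a; cases b) (simp add: bracket_tri, (simp add: algebra_simps)?)
qed

lemma CD_identity_g6: "CD_identity g6"
  unfolding CD_identity_def g6_tri
proof (intro allI)
  fix x y a b :: "complex ^ 6"
  let ?B = "bracket (tri 1 0 0 0 1 0 0 0 1 0 1 0 0 0 0 (-1) 0 1 0 0)"
  show "?B (?B (?B x y) a) b - ?B (?B (?B x y) b) a =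
     ?B (?B (?B x a) b) y - ?B (?B (?B x b) a) y + ?B x (?B (?B y a) b) - ?B x (?B (?B y b) a)"
    by (cases x; cases y; cases a; cases b) (simp add: bracket_tri, (simp add: algebra_simps)?)
qed

lemma M6_in_CD: "M6 \<epsilon> \<in> nilpotent_anticomm_CD"
  unfolding nilpotent_anticomm_CD_iff using CD_identity_M6
  by (simp add: M6_tri anticommutative_tri left_normed_tri)

lemma B61_in_CD: "B61 \<in> nilpotent_anticomm_CD"
  unfolding nilpotent_anticomm_CD_iff using CD_identity_B61
  by (simp add: B61_tri anticommutative_tri left_normed_tri)

lemma g6_in_CD: "g6 \<in> nilpotent_anticomm_CD"
  unfolding nilpotent_anticomm_CD_iff using CD_identity_g6
  by (simp add: g6_tri anticommutative_tri left_normed_tri)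

section \<open>Generic members of the types\<close>

lemma polyfun_tri:
  assumes "polyfun a3" "polyfun a4" "polyfun a5" "polyfun a6" "polyfun b4" "polyfun b5" "polyfun b6"
    "polyfun d4" "polyfun d5" "polyfun d6" "polyfun p5" "polyfun p6" "polyfun q5" "polyfun q6"
    "polyfun r5" "polyfun r6" "polyfun u" "polyfun v" "polyfun w" "polyfun z"
  shows "polyfun (\<lambda>t. tri (a3 t) (a4 t) (a5 t) (a6 t) (b4 t) (b5 t) (b6 t) (d4 t) (d5 t) (d6 t)
    (p5 t) (p6 t) (q5 t) (q6 t) (r5 t) (r6 t) (u t) (v t) (w t) (z t) $ p)"
proof -
  have vec: "polyfun (\<lambda>t. vec6 (x1 t) (x2 t) (x3 t) (x4 t) (x5 t) (x6 t) $ k)"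
    if "polyfun x1" "polyfun x2" "polyfun x3" "polyfun x4" "polyfun x5" "polyfun x6" for x1 x2 x3 x4 x5 x6 k
    unfolding vec6_def
    by (cases "k = 1"; cases "k = 2"; cases "k = 3"; cases "k = 4"; cases "k = 5") (simp_all add: that)
  obtain i j k where p: "p = (i, j, k)"
    by (metis prod_cases3)
  have entry: "polyfun (\<lambda>t. if c then f t else if c' then - f t else 0)" if "polyfun f" for f c c'
    using that by (cases c; cases c') auto
  show ?thesis
    unfolding p tri_def anticomm_table_def vec_lambda_beta prod.case list.map sum_list.Cons sum_list.Nil
    by (intro polyfun_add polyfun_const entry vec assms)
qed

lemma polyfun_segment [intro!]: "polyfun (\<lambda>t. (1 - t) * a + t * b)"
  by auto

text \<open>Corrections by \<open>\<e> 3\<close>, \<open>\<e> 4\<close>, \<open>\<e> 5\<close> clear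
  \<open>d\<close>, \<open>p5\<close> and \<open>p6\<close>, leaving an
  \<open>\<e> 6\<close>-component in \<open>[e2, e4]\<close>. Replacing \<open>\<e> 5\<close> by
  itself plus \<open>y\<close> times \<open>\<e> 6\<close> absorbs it if
  \<open>q + y = \<epsilon> * y\<close>; this is solvable because \<open>q5 \<noteq> r\<close> means
  \<open>\<epsilon> \<noteq> 1\<close>.\<close>

lemma M6_orbit_normalised:
  assumes "r \<noteq> 0" "q5 \<noteq> r"
  shows "tri 1 0 0 0 0 1 0 0 0 d p5 p6 q5 q6 0 r 1 0 0 0 \<in> orbit (M6 (q5 / r))"
proof -
  define \<epsilon> where "\<epsilon> = q5 / r"
  have \<epsilon>: "q5 = \<epsilon> * r" "1 - \<epsilon> \<noteq> 0"
    using assms by (auto simp: \<epsilon>_def)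
  define q where "q = (q6 - p5 * d) / r"
  have q: "q6 = q * r + p5 * d"
    using assms(1) by (simp add: q_def)
  define y where "y = - q / (1 - \<epsilon>)"
  have y: "q + y = \<epsilon> * y"
    using \<epsilon>(2) by (simp add: y_def field_simps)
  define s s' t where "s = p5 / r" "s' = p6 / r" "t = 1 / r"
  then have p: "p5 = s * r" "p6 = s' * r" "r * t = 1" "r * (t * k) = k" "r * (k * t) = k" "t \<noteq> 0" for k
    using assms(1) by simp_all
  have "tri 1 0 0 0 0 1 0 0 0 d p5 p6 q5 q6 0 r 1 0 0 0 \<in> orbit (tri 1 0 0 0 0 1 0 0 0 0 0 0 \<epsilon> 0 0 1 1 0 0 0)"
    by (rule orbit_triI[OF anticommutative_tri, of "vec6 1 0 0 0 0 0" "vec6 0 1 (y - d * s) (d * t) (- d * s') 0"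
        "vec6 0 0 1 0 y 0" "vec6 0 0 (- s) t (- s') 0" "vec6 0 0 0 0 1 y" "vec6 0 0 0 0 0 1"])
      (use y p(6) in \<open>auto simp: independent6_def bracket_tri \<epsilon> q p algebra_simps\<close>)
  then show ?thesis
    by (simp add: M6_tri \<epsilon>_def)
qed

text \<open>The vectors \<open>\<e> 3\<close>, \<open>\<e> 5\<close>, \<open>\<e> 6\<close> are
  replaced by the iterated products of \<open>\<e> 1\<close> with \<open>\<e> 2\<close>;
  \<open>c\<close> is the \<open>\<e> 6\<close>-coefficient of the second of them. The last factor
  of the hypothesis keeps the resulting parameter away from 1.\<close>

lemma M6_orbit_generic:
  assumes "a3 * b5 * u * r6 * (q5 * u - a3 * r6) \<noteq> 0"
  shows "tri a3 0 a5 a6 0 b5 b6 0 0 d6 p5 p6 q5 q6 0 r6 u 0 0 0 \<in> (\<Union>\<epsilon>. orbit (M6 \<epsilon>))"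
proof -
  have nz: "a3 \<noteq> 0" "b5 \<noteq> 0" "u \<noteq> 0" "r6 \<noteq> 0" "q5 * u \<noteq> a3 * r6"
    using assms by auto
  define c where "c = a3 * b6 + a5 * u"
  define P5 Q5 where "P5 = p5 / (a3 * b5)" "Q5 = q5 / (a3 * b5)"
  define P6 Q6 where "P6 = (p6 - P5 * c) / (a3 * b5 * u)" "Q6 = (q6 - Q5 * c) / (a3 * b5 * u)"
  define D R where "D = d6 / (b5 * u)" "R = r6 / (b5 * u)"
  have eqs: "p5 = P5 * (a3 * b5)" "q5 = Q5 * (a3 * b5)" "p6 = P6 * (a3 * b5 * u) + P5 * c"
    "q6 = Q6 * (a3 * b5 * u) + Q5 * c" "d6 = D * (b5 * u)" "r6 = R * (b5 * u)"
    unfolding P6_Q6_def D_R_def using nz(1-3) by (simp_all add: P5_Q5_def)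
  have orb: "tri a3 0 a5 a6 0 b5 b6 0 0 d6 p5 p6 q5 q6 0 r6 u 0 0 0 \<in>
      orbit (tri 1 0 0 0 0 1 0 0 0 D P5 P6 Q5 Q6 0 R 1 0 0 0)"
    unfolding eqs
    by (rule orbit_triI[OF anticommutative_tri, of "vec6 1 0 0 0 0 0" "vec6 0 1 0 0 0 0"
        "vec6 0 0 a3 0 a5 a6" "vec6 0 0 0 1 0 0" "vec6 0 0 0 0 (a3 * b5) c" "vec6 0 0 0 0 0 (a3 * b5 * u)"])
      (use nz(1-3) in \<open>auto simp: independent6_def bracket_tri c_def algebra_simps\<close>)
  have "R \<noteq> 0" "Q5 \<noteq> R"
    using nz by (auto simp: eqs)
  from orbit_trans[OF orb M6_orbit_normalised[OF this]] show ?thesis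
    by blast
qed

lemma type_M_closure: "type_M \<subseteq> zariski closure_of (\<Union>\<epsilon>. orbit (M6 \<epsilon>))"
proof
  fix \<mu> assume "\<mu> \<in> type_M"
  then obtain a3 a5 a6 b5 b6 d6 p5 p6 q5 q6 r6 u
    where \<mu>: "\<mu> = tri a3 0 a5 a6 0 b5 b6 0 0 d6 p5 p6 q5 q6 0 r6 u 0 0 0"
    unfolding type_M_def by blast
  define s where "s t a b = (1 - t) * a + t * b" for t a b :: complex
  \<comment> \<open>The segment ends at \<open>M6 0\<close>, where no factor of \<open>D\<close>
    vanishes.\<close>
  define \<gamma> where "\<gamma> t = tri (s t a3 1) 0 (s t a5 0) (s t a6 0) 0 (s t b5 1) (s t b6 0) 0 0 (s t d6 0)
    (s t p5 0) (s t p6 0) (s t q5 0) (s t q6 0) 0 (s t r6 1) (s t u 1) 0 0 0" for t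
  define D where "D t = s t a3 1 * s t b5 1 * s t u 1 * s t r6 1 * (s t q5 0 * s t u 1 - s t a3 1 * s t r6 1)" for t
  have "polyfun (\<lambda>t. \<gamma> t $ p)" for p
    unfolding \<gamma>_def s_def by (intro polyfun_tri polyfun_const polyfun_segment)
  moreover have "polyfun D"
    unfolding D_def s_def by auto
  moreover have "D 1 \<noteq> 0"
    by (simp add: D_def s_def)
  moreover have "\<gamma> t \<in> (\<Union>\<epsilon>. orbit (M6 \<epsilon>))" if "D t \<noteq> 0" for t
    using that unfolding D_def \<gamma>_def by (rule M6_orbit_generic)
  ultimately have "\<gamma> 0 \<in> zariski closure_of (\<Union>\<epsilon>. orbit (M6 \<epsilon>))"
    by (rule closure_of_curve)
  then show "\<mu> \<in> zariski closure_of (\<Union>\<epsilon>. orbit (M6 \<epsilon>))"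
    by (simp add: \<gamma>_def \<mu> s_def)
qed

text \<open>The scalar \<open>t\<close> turns \<open>d5\<close> into 1. Adding \<open>x\<close>
  times \<open>\<e> 4\<close> to \<open>\<e> 2\<close>, and correspondingly \<open>x\<close> times
  \<open>\<e> 5\<close> to \<open>\<e> 3\<close>, changes \<open>d6\<close> by
  \<open>2 * x * v\<close>: one summand comes from \<open>[e2, e5]\<close>, the other from
  \<open>[e4, e3]\<close>.\<close>

lemma g6_orbit_normalised:
  assumes "d5 \<noteq> 0" "v \<noteq> 0"
  shows "tri 1 0 0 0 1 0 0 0 d5 d6 1 0 0 0 0 (- v) 0 v 0 0 \<in> orbit g6"
proof -
  define t x where "t = 1 / d5" "x = - d6 / (2 * v)"
  then have tx: "d5 * t = 1" "d5 * (t * t) = t" "x * (v * 2) = - d6" "t \<noteq> 0"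
    using assms by simp_all
  have "d6 + x * v + x * v = 0"
    using tx(3) by (simp add: algebra_simps)
  then have d6: "d6 = - (x * v) - x * v"
    by (simp add: algebra_simps add_eq_0_iff)
  show ?thesis
    unfolding g6_tri d6
    by (rule orbit_triI[OF anticommutative_tri, of "vec6 1 0 0 0 0 0" "vec6 0 t 0 (t * x) 0 0"
        "vec6 0 0 t 0 (t * x) 0" "vec6 0 0 0 t 0 0" "vec6 0 0 0 0 t 0" "vec6 0 0 0 0 0 (t * t * v)"])
      (use assms(2) tx in \<open>auto simp: independent6_def bracket_tri algebra_simps\<close>)
qed

lemma g6_orbit_generic:
  assumes "p5 * d5 * v \<noteq> 0"
  shows "tri 1 0 0 0 1 0 0 0 d5 d6 p5 p6 0 (u * d5) 0 (- p5 * v) u v 0 0 \<in> orbit g6"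
proof -
  have nz: "p5 \<noteq> 0" "d5 \<noteq> 0" "v \<noteq> 0"
    using assms by auto
  define s where "s = u / v"
  have u: "u = s * v"
    using nz by (simp add: s_def)
  define D where "D = d5 / p5"
  define c where "c = p6 - s * u * (D * p5)"
  have d5: "d5 = D * p5"
    using nz by (simp add: D_def)
  define E where "E = (d6 - D * c) / (p5 * v)"
  have d6: "d6 = E * (p5 * v) + D * c"
    using nz by (simp add: E_def)
  have orb: "tri 1 0 0 0 1 0 0 0 d5 d6 p5 p6 0 (u * d5) 0 (- p5 * v) u v 0 0 \<in>
      orbit (tri 1 0 0 0 1 0 0 0 D E 1 0 0 0 0 (- 1) 0 1 0 0)"
    unfolding d6 d5
    \<comment> \<open>The first vector is chosen to commute with \<open>\<e> 5\<close>. The fourth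
      and fifth are its iterated products with \<open>\<e> 3\<close>, and \<open>c\<close> is the
      \<open>\<e> 6\<close>-coefficient of the fifth.\<close>
    by (rule orbit_triI[OF anticommutative_tri, of "vec6 1 (- s) 0 0 0 0" "vec6 0 1 0 0 0 0"
        "vec6 0 0 1 0 0 0" "vec6 0 0 0 1 (- s * (D * p5)) (- s * (E * (p5 * v) + D * c))" "vec6 0 0 0 0 p5 c" "vec6 0 0 0 0 0 (p5 * v)"])
      (use nz(1,3) in \<open>auto simp: independent6_def bracket_tri c_def u algebra_simps\<close>)
  have "D \<noteq> 0"
    using nz by (simp add: D_def)
  then show ?thesis
    using orbit_trans[OF orb g6_orbit_normalised[of D 1 E]] by simp
qed

lemma type_g_closure: "type_g \<subseteq> zariski closure_of (orbit g6)"
proof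
  fix \<mu> assume "\<mu> \<in> type_g"
  then obtain d5 d6 p5 p6 u v
    where \<mu>: "\<mu> = tri 1 0 0 0 1 0 0 0 d5 d6 p5 p6 0 (u * d5) 0 (- p5 * v) u v 0 0"
    unfolding type_g_def by blast
  define s where "s t a b = (1 - t) * a + t * b" for t a b :: complex
  \<comment> \<open>Only \<open>d5\<close>, \<open>p5\<close> and \<open>v\<close> move. The
    dependent entries follow as products, so the curve has degree two and stays inside
    \<open>type_g\<close>.\<close>
  define \<gamma> where "\<gamma> t = tri 1 0 0 0 1 0 0 0 (s t d5 1) d6 (s t p5 1) p6 0 (u * s t d5 1) 0
    (- s t p5 1 * s t v 1) u (s t v 1) 0 0" for t
  define D where "D t = s t p5 1 * s t d5 1 * s t v 1" for t
  have "polyfun (\<lambda>t. \<gamma> t $ p)" for p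
    unfolding \<gamma>_def s_def by (intro polyfun_tri polyfun_const polyfun_mult polyfun_uminus polyfun_segment)
  moreover have "polyfun D"
    unfolding D_def s_def by auto
  moreover have "D 1 \<noteq> 0"
    by (simp add: D_def s_def)
  moreover have "\<gamma> t \<in> orbit g6" if "D t \<noteq> 0" for t
    using that unfolding D_def \<gamma>_def by (rule g6_orbit_generic)
  ultimately have "\<gamma> 0 \<in> zariski closure_of (orbit g6)"
    by (rule closure_of_curve)
  then show "\<mu> \<in> zariski closure_of (orbit g6)"
    by (simp add: \<gamma>_def \<mu> s_def)
qed

section \<open>Separating the components\<close>

definition jacobi :: "('k::field, 'n::finite) alg \<Rightarrow> bool" where
  "jacobi \<mu> \<longleftrightarrow> (\<forall>x y s. bracket \<mu> (bracket \<mu> x y) s + bracket \<mu> (bracket \<mu> y s) x + bracket \<mu> (bracket \<mu> s x) y = 0)"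

definition metabelian :: "('k::field, 'n::finite) alg \<Rightarrow> bool" where
  "metabelian \<mu> \<longleftrightarrow> (\<forall>x y s t. bracket \<mu> (bracket \<mu> x y) (bracket \<mu> s t) = 0)"

definition class3 :: "('k::field, 'n::finite) alg \<Rightarrow> bool" where
  "class3 \<mu> \<longleftrightarrow> (\<forall>x y s t. bracket \<mu> (bracket \<mu> (bracket \<mu> x y) s) t = 0)"

lemma closedin_zariski_jacobi: "closedin zariski {\<mu>. jacobi \<mu>}"
  unfolding jacobi_def
  by (intro closedin_zariski_All closedin_zariski_vec_zero, simp, intro poly_map_bracket poly_map_intros)

lemma closedin_zariski_metabelian: "closedin zariski {\<mu>. metabelian \<mu>}"
  unfolding metabelian_def
  by (intro closedin_zariski_All closedin_zariski_vec_zero poly_map_bracket poly_map_intros)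

lemma closedin_zariski_class3: "closedin zariski {\<mu>. class3 \<mu>}"
  unfolding class3_def
  by (intro closedin_zariski_All closedin_zariski_vec_zero poly_map_bracket poly_map_intros)

lemma jacobi_orbit: "\<mu> \<in> orbit \<nu> \<Longrightarrow> jacobi \<nu> \<Longrightarrow> jacobi \<mu>"
  unfolding orbit_def jacobi_def
  by (auto simp: bracket_gl_act matrix_inv_cancel matrix_vector_right_distrib[symmetric])

lemma metabelian_orbit: "\<mu> \<in> orbit \<nu> \<Longrightarrow> metabelian \<nu> \<Longrightarrow> metabelian \<mu>"
  unfolding orbit_def metabelian_def by (auto simp: bracket_gl_act matrix_inv_cancel)

lemma class3_orbit: "\<mu> \<in> orbit \<nu> \<Longrightarrow> class3 \<nu> \<Longrightarrow> class3 \<mu>"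
  unfolding orbit_def class3_def by (auto simp: bracket_gl_act matrix_inv_cancel)

lemma type_g_jacobi:
  assumes "\<mu> \<in> type_g"
  shows "jacobi \<mu>"
proof -
  have "jacobi (tri 1 0 0 0 1 0 0 0 d5 d6 p5 p6 0 (u * d5) 0 (- p5 * v) u v 0 0)" for d5 d6 p5 p6 u v
    unfolding jacobi_def
  proof (intro allI)
    fix x y s :: "complex ^ 6"
    let ?B = "bracket (tri 1 0 0 0 1 0 0 0 d5 d6 p5 p6 0 (u * d5) 0 (- p5 * v) u v 0 0)"
    show "?B (?B x y) s + ?B (?B y s) x + ?B (?B s x) y = 0"
      by (cases x; cases y; cases s) (simp add: bracket_tri, simp add: algebra_simps)
  qed
  with assms show ?thesis
    unfolding type_g_def by blast
qed

lemma type_M_metabelian: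
  assumes "\<mu> \<in> type_M"
  shows "metabelian \<mu>"
proof -
  have "metabelian (tri a3 0 a5 a6 0 b5 b6 0 0 d6 p5 p6 q5 q6 0 r6 u 0 0 0)"
    for a3 a5 a6 b5 b6 d6 p5 p6 q5 q6 r6 u
    unfolding metabelian_def
  proof (intro allI)
    fix x y s t :: "complex ^ 6"
    let ?B = "bracket (tri a3 0 a5 a6 0 b5 b6 0 0 d6 p5 p6 q5 q6 0 r6 u 0 0 0)"
    show "?B (?B x y) (?B s t) = 0"
      by (cases x; cases y; cases s; cases t) (simp add: bracket_tri)
  qed
  with assms show ?thesis
    unfolding type_M_def by blast
qed

lemma type_B_class3:
  assumes "\<mu> \<in> type_B"
  shows "class3 \<mu>"
proof -
  have "class3 (tri 0 a4 a5 a6 b4 b5 b6 d4 d5 d6 0 p6 0 q6 0 r6 u v w z)"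
    for a4 a5 a6 b4 b5 b6 d4 d5 d6 p6 q6 r6 u v w z
    unfolding class3_def
  proof (intro allI)
    fix x y s t :: "complex ^ 6"
    let ?B = "bracket (tri 0 a4 a5 a6 b4 b5 b6 d4 d5 d6 0 p6 0 q6 0 r6 u v w z)"
    show "?B (?B (?B x y) s) t = 0"
      by (cases x; cases y; cases s; cases t) (simp add: bracket_tri)
  qed
  with assms show ?thesis
    unfolding type_B_def by blast
qed

text \<open>The determinant of the coordinates 4, 5, 6, a polynomial certificate of independence.
  For \<open>g6\<close> and \<open>B61\<close> the vectors to be tested point along
  \<open>\<e> 4\<close>, \<open>\<e> 5\<close>, \<open>\<e> 6\<close>.\<close>

definition minor3 :: "complex ^ 6 \<Rightarrow> complex ^ 6 \<Rightarrow> complex ^ 6 \<Rightarrow> complex" where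
  "minor3 x y s = x $ 4 * (y $ 5 * s $ 6 - y $ 6 * s $ 5) - x $ 5 * (y $ 4 * s $ 6 - y $ 6 * s $ 4)
     + x $ 6 * (y $ 4 * s $ 5 - y $ 5 * s $ 4)"

lemma minor3_independent:
  assumes "minor3 x y s \<noteq> 0" "a *s x + b *s y + c *s s = 0"
  shows "a = 0" "b = 0" "c = 0"
proof -
  have eq: "a * x $ k + b * y $ k + c * s $ k = 0" for k
    using assms(2) by (simp add: vec_eq_iff)
  have "a * minor3 x y s = 0" "b * minor3 x y s = 0" "c * minor3 x y s = 0"
    using eq[of 4] eq[of 5] eq[of 6] unfolding minor3_def by algebra+
  then show "a = 0" "b = 0" "c = 0"
    using assms(1) by auto
qed

lemma minor3_gl_act_independent:
  assumes "minor3 (g *v x) (g *v y) (g *v s) \<noteq> 0" "a *s x + b *s y + c *s s = 0"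
  shows "a = 0" "b = 0" "c = 0"
proof -
  have "a *s (g *v x) + b *s (g *v y) + c *s (g *v s) = 0"
    using arg_cong[OF assms(2), of "(*v) g"] by (simp add: matrix_vector_right_distrib vec.scale)
  from minor3_independent[OF assms(1) this] show "a = 0" "b = 0" "c = 0" .
qed

lemma poly_map_minor3:
  assumes "\<And>k. poly_map (\<lambda>\<mu>. F \<mu> $ k)" "\<And>k. poly_map (\<lambda>\<mu>. G \<mu> $ k)" "\<And>k. poly_map (\<lambda>\<mu>. H \<mu> $ k)"
  shows "poly_map (\<lambda>\<mu>. minor3 (F \<mu>) (G \<mu>) (H \<mu>))"
  unfolding minor3_def by (intro poly_map_intros assms)

lemma openin_zariski_nonzero: "poly_map p \<Longrightarrow> openin zariski {x. p x \<noteq> 0}"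
  using closedin_zariski_zero[of p] by (simp add: closedin_def Compl_eq_Diff_UNIV[symmetric] Collect_neg_eq)

section \<open>Rigidity of \<open>g6\<close>\<close>

text \<open>At \<open>g6\<close> the vectors \<open>f3\<close>, ..., \<open>f6\<close> are
  \<open>\<e> 3\<close>, ..., \<open>\<e> 6\<close>. The first factor rules out metabelian
  structures; the second forces \<open>f6\<close>, hence \<open>f5\<close>, to be nonzero, which
  rules out \<open>class3\<close>.\<close>

definition g6_test :: "(complex, 6) alg \<Rightarrow> complex" where
  "g6_test \<mu> = (let f3 = bracket \<mu> (\<e> 1) (\<e> 2); f4 = bracket \<mu> (\<e> 1) f3; f5 = bracket \<mu> (\<e> 1) f4;
     f6 = bracket \<mu> (\<e> 2) f5
   in bracket \<mu> f3 f4 $ 6 * minor3 f4 (bracket \<mu> (\<e> 2) f3) f6)"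

lemma poly_map_g6_test: "poly_map g6_test"
  unfolding g6_test_def[abs_def] Let_def
  by (intro poly_map_intros poly_map_minor3 poly_map_bracket)

lemma g6_test_g6: "g6_test g6 \<noteq> 0"
  by (simp add: g6_test_def g6_tri basis_vec6 bracket_tri minor3_def)

text \<open>Here \<open>x\<close> and \<open>y\<close> stand for \<open>\<e> 1\<close> and
  \<open>\<e> 2\<close> carried back by an unknown change of basis. Since \<open>[f3, f4]\<close> is
  a multiple of \<open>p5 * v\<close>, both are nonzero. If \<open>d5\<close> were zero,
  \<open>f4\<close> and \<open>[y, f3]\<close> would be proportional modulo \<open>\<e> 6\<close>,
  on whose line \<open>f6\<close> lies, against independence.\<close>

lemma g6_test_type_g:
  fixes x y :: "complex ^ 6"
  assumes "T \<in> type_g"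
    and f: "f3 = bracket T x y" "f4 = bracket T x f3" "f5 = bracket T x f4" "f6 = bracket T y f5"
    and ne: "bracket T f3 f4 \<noteq> 0"
    and indep: "\<And>a b c. a *s f4 + b *s bracket T y f3 + c *s f6 = 0 \<Longrightarrow> a = 0 \<and> b = 0 \<and> c = 0"
  shows "T \<in> orbit g6"
proof -
  obtain d5 d6 p5 p6 u v where T: "T = tri 1 0 0 0 1 0 0 0 d5 d6 p5 p6 0 (u * d5) 0 (- p5 * v) u v 0 0"
    using assms(1) unfolding type_g_def by blast
  obtain x1 x2 x3 x4 x5 x6 where x: "x = vec6 x1 x2 x3 x4 x5 x6"
    by (cases x)
  obtain y1 y2 y3 y4 y5 y6 where y: "y = vec6 y1 y2 y3 y4 y5 y6"
    by (cases y)
  define m where "m = x1 * y2 - x2 * y1"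
  obtain r4 r5 r6 where f3: "f3 = vec6 0 0 m r4 r5 r6"
    unfolding f(1) T x y by (simp add: bracket_tri m_def)
  obtain s5 s6 where f4: "f4 = vec6 0 0 0 (x1 * m) s5 s6" 
    and s5: "s5 = d5 * (x2 * m) + p5 * (x1 * r4)"
    unfolding f(2) T x f3 by (simp add: bracket_tri)
  obtain t6 where f5: "f5 = vec6 0 0 0 0 (p5 * (x1 * (x1 * m))) t6"
    unfolding f(3) T x f4 by (simp add: bracket_tri)
  have f6: "f6 = vec6 0 0 0 0 0 (f6 $ 6)"
    unfolding f(4) T y f5 by (simp add: bracket_tri)
  obtain w5 w6 where yf3: "bracket T y f3 = vec6 0 0 0 (y1 * m) w5 w6"
    and w5: "w5 = d5 * (y2 * m) + p5 * (y1 * r4)"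
    unfolding T y f3 by (simp add: bracket_tri)
  have "bracket T f3 f4 = vec6 0 0 0 0 0 (- p5 * v * (m * (x1 * m)))"
    unfolding f3 f4 T by (simp add: bracket_tri)
  with ne have nz: "p5 \<noteq> 0" "v \<noteq> 0" "m \<noteq> 0" "x1 \<noteq> 0"
    by auto
  have "d5 \<noteq> 0"
  proof
    assume "d5 = 0"
    define k where "k = x1 * w6 - y1 * s6"
    have "(- y1 * f6 $ 6) *s f4 + (x1 * f6 $ 6) *s bracket T y f3 + (- k) *s f6 = 0"
      by (subst (3) f6, simp only: f4 yf3 s5 w5) (simp add: \<open>d5 = 0\<close> k_def algebra_simps)
    then have "x1 * f6 $ 6 = 0"
      using indep by blast
    with nz have "f6 $ 6 = 0"
      by simp
    with f6 have "0 *s f4 + 0 *s bracket T y f3 + 1 *s f6 = 0"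
      by simp
    then show False
      using indep by fastforce
  qed
  with nz show ?thesis
    unfolding T by (intro g6_orbit_generic) simp
qed

lemma g6_slice:
  assumes "\<mu> \<in> nilpotent_anticomm_CD" "g6_test \<mu> \<noteq> 0"
  shows "\<mu> \<in> orbit g6"
proof -
  define f3 where "f3 = bracket \<mu> (\<e> 1) (\<e> 2)"
  define f4 where "f4 = bracket \<mu> (\<e> 1) f3"
  define f5 where "f5 = bracket \<mu> (\<e> 1) f4"
  define f6 where "f6 = bracket \<mu> (\<e> 2) f5"
  note f_defs = f3_def f4_def f5_def f6_def
  have anti: "anticommutative \<mu>"
    using assms(1) by (simp add: nilpotent_anticomm_CD_def)
  have ne: "bracket \<mu> f3 f4 \<noteq> 0" and minor: "minor3 f4 (bracket \<mu> (\<e> 2) f3) f6 \<noteq> 0"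
    using assms(2) by (auto simp: g6_test_def f_defs)
  obtain T where T: "T \<in> type_B \<union> type_M \<union> type_g" and orb: "\<mu> \<in> orbit T"
    using reducible_CD[OF assms(1)] unfolding reducible_to_types_def by blast
  have "\<not> metabelian \<mu>"
    using ne unfolding metabelian_def f4_def f3_def by blast
  moreover have "\<not> class3 \<mu>"
  proof
    assume "class3 \<mu>"
    then have "bracket \<mu> (bracket \<mu> (bracket \<mu> (\<e> 1) (\<e> 2)) (\<e> 1)) (\<e> 1) = 0"
      unfolding class3_def by blast
    then have "f5 = 0"
      unfolding f5_def f4_def f3_def
      by (metis anticommutative_swap[OF anti] bracket_linear(5))
    then show False
      using minor by (simp add: f6_def minor3_def)
  qed
  ultimately have "T \<in> type_g"
    using T metabelian_orbit[OF orb type_M_metabelian] class3_orbit[OF orb type_B_class3] by blast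
  obtain g where g: "invertible g" "\<mu> = gl_act g T"
    using orb unfolding orbit_def by blast
  let ?h = "\<lambda>x. matrix_inv g *v x"
  have h: "?h (bracket \<mu> x y) = bracket T (?h x) (?h y)" for x y
    by (simp add: g(2) bracket_gl_act matrix_inv_cancel(1)[OF g(1)])
  have "T \<in> orbit g6"
  proof (rule g6_test_type_g[OF \<open>T \<in> type_g\<close>])
    show "?h f3 = bracket T (?h (\<e> 1)) (?h (\<e> 2))" "?h f4 = bracket T (?h (\<e> 1)) (?h f3)"
      "?h f5 = bracket T (?h (\<e> 1)) (?h f4)" "?h f6 = bracket T (?h (\<e> 2)) (?h f5)"
      by (simp_all only: h f_defs)
    have "g *v ?h (bracket \<mu> f3 f4) \<noteq> 0"
      using ne by (simp add: matrix_inv_cancel(2)[OF g(1)])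
    then show "bracket T (?h f3) (?h f4) \<noteq> 0"
      unfolding h by auto
    have "minor3 (g *v ?h f4) (g *v ?h (bracket \<mu> (\<e> 2) f3)) (g *v ?h f6) \<noteq> 0"
      using minor by (simp add: matrix_inv_cancel(2)[OF g(1)])
    from minor3_gl_act_independent[OF this]
    show "a = 0 \<and> b = 0 \<and> c = 0" if "a *s ?h f4 + b *s bracket T (?h (\<e> 2)) (?h f3) + c *s ?h f6 = 0" for a b c
      using that unfolding h by blast
  qed
  then show ?thesis
    by (rule orbit_trans[OF orb])
qed

lemma rigid_g6: "rigid_in nilpotent_anticomm_CD g6"
  unfolding rigid_in_def
proof
  show "openin (subtopology zariski nilpotent_anticomm_CD) (orbit g6)"
    by (rule openin_orbit_if_slice[OF gl_invariant_CD g6_in_CD openin_zariski_nonzero[OF poly_map_g6_test]])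
      (use g6_test_g6 g6_slice in auto)
qed (rule g6_in_CD)

section \<open>Rigidity of \<open>B61\<close>\<close>

lemma type_B_products:
  assumes "T \<in> type_B"
  shows "\<exists>a b. bracket T x y = vec6 0 0 0 a b (bracket T x y $ 6)"
    and "bracket T x (bracket T y s) = vec6 0 0 0 0 0 (bracket T x (bracket T y s) $ 6)"
    and "bracket T x (vec6 0 0 0 0 0 c) = 0"
proof -
  obtain a4 a5 a6 b4 b5 b6 d4 d5 d6 p6 q6 r6 u v w z
    where T: "T = tri 0 a4 a5 a6 b4 b5 b6 d4 d5 d6 0 p6 0 q6 0 r6 u v w z"
    using assms unfolding type_B_def by blast
  show "\<exists>a b. bracket T x y = vec6 0 0 0 a b (bracket T x y $ 6)"
    "bracket T x (bracket T y s) = vec6 0 0 0 0 0 (bracket T x (bracket T y s) $ 6)"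
    "bracket T x (vec6 0 0 0 0 0 c) = 0"
    by (cases x; cases y; cases s; simp add: T bracket_tri)+
qed

lemma type_B_anticommutative: "T \<in> type_B \<Longrightarrow> anticommutative T"
  unfolding type_B_def using anticommutative_tri by blast

text \<open>Modulo \<open>\<e> 6\<close> the vector \<open>W\<close> is a combination of
  \<open>Y\<close> and \<open>Z\<close>, which is removed by adding multiples of \<open>x1\<close>
  to \<open>x2\<close> and \<open>x3\<close>. What is left of \<open>W\<close> is nonzero by
  independence and has to match \<open>[Y, Z]\<close>.\<close>

lemma B61_orbit_adapted:
  assumes T: "T \<in> type_B"
    and Y: "bracket T x1 x2 = Y" and Z: "bracket T x1 x3 = Z" and W: "bracket T x2 x3 = W"
    and centr: "bracket T x1 Y = 0" "bracket T x2 Y = 0" "bracket T x3 Y = 0"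
      "bracket T x1 Z = 0" "bracket T x2 Z = 0" "bracket T x3 Z = 0"
    and YZ: "bracket T Y Z \<noteq> 0"
    and indep: "\<And>a b c. a *s Y + b *s Z + c *s W = 0 \<Longrightarrow> a = 0 \<and> b = 0 \<and> c = 0"
  shows "T \<in> orbit B61"
proof -
  note prod = type_B_products[OF T] and swap = anticommutative_swap[OF type_B_anticommutative[OF T]]
  define e where "e = (vec6 0 0 0 0 0 1 :: complex ^ 6)"
  have e: "e \<noteq> 0" "bracket T x e = 0" "bracket T e x = 0" for x
    using prod(3)[of x 1] swap[of e x] by (simp_all add: e_def)
  obtain \<kappa> where \<kappa>: "bracket T Y Z = \<kappa> *s e"
    using prod(2)[of Y x1 x3] by (simp add: Z e_def)
  have "\<kappa> \<noteq> 0"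
    using YZ by (auto simp: \<kappa>)
  obtain Y4 Y5 Y6 where Y': "Y = vec6 0 0 0 Y4 Y5 Y6"
    using prod(1)[of x1 x2] Y by metis
  obtain Z4 Z5 Z6 where Z': "Z = vec6 0 0 0 Z4 Z5 Z6"
    using prod(1)[of x1 x3] Z by metis
  obtain W4 W5 W6 where W': "W = vec6 0 0 0 W4 W5 W6"
    using prod(1)[of x2 x3] W by metis
  define \<delta> where "\<delta> = Y4 * Z5 - Y5 * Z4"
  have "\<delta> \<noteq> 0"
  proof
    assume "\<delta> = 0"
    obtain a4 a5 a6 b4 b5 b6 d4 d5 d6 p6 q6 r6 u v w z
      where "T = tri 0 a4 a5 a6 b4 b5 b6 d4 d5 d6 0 p6 0 q6 0 r6 u v w z"
      using T unfolding type_B_def by blast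
    then have "bracket T Y Z = vec6 0 0 0 0 0 (z * \<delta>)"
      by (simp add: Y' Z' bracket_tri \<delta>_def)
    with \<open>\<delta> = 0\<close> YZ show False
      by simp
  qed
  \<comment> \<open>Cramer's rule for the coefficients of \<open>W\<close> with respect to
    \<open>Y\<close> and \<open>Z\<close> modulo \<open>\<e> 6\<close>.\<close>
  define d where "d = (W4 * Z5 - W5 * Z4) / \<delta>"
  define d' where "d' = (Y4 * W5 - Y5 * W4) / \<delta>"
  define c where "c = W6 - d * Y6 - d' * Z6"
  have "W4 = d * Y4 + d' * Z4" "W5 = d * Y5 + d' * Z5"
    using \<open>\<delta> \<noteq> 0\<close> by (simp_all add: d_def d'_def divide_simps) (simp_all add: \<delta>_def algebra_simps)
  then have W_eq: "W = d *s Y + d' *s Z + c *s e"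
    by (simp add: W' Y' Z' e_def c_def)
  have "c \<noteq> 0"
  proof
    assume "c = 0"
    then have "d *s Y + d' *s Z + (- 1) *s W = 0"
      by (simp add: W_eq)
    then show False
      using indep by fastforce
  qed
  \<comment> \<open>Scaling \<open>x1\<close> by \<open>s\<close> multiplies \<open>[Y, Z]\<close>
    by the square of \<open>s\<close> and leaves the corrected \<open>W\<close> alone; the square
    root makes the two equal.\<close>
  define s where "s = csqrt (c / \<kappa>)"
  have s: "s * s * \<kappa> = c"
    using \<open>\<kappa> \<noteq> 0\<close> power2_csqrt[of "c / \<kappa>"] by (simp add: s_def power2_eq_square)
  then have "s \<noteq> 0"
    using \<open>c \<noteq> 0\<close> by auto
  note sw = swap[of x2 x1] swap[of x3 x1] swap[of x3 x2]
  have "T \<in> orbit (tri 0 1 0 0 0 1 0 0 0 1 0 0 0 0 0 0 0 0 0 1)"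
  proof (rule orbit_triI[OF type_B_anticommutative[OF T]])
    show "independent6 (s *s x1) (x2 - d' *s x1) (x3 + d *s x1) (s *s Y) (s *s Z) (c *s e)"
      unfolding independent6_def
    proof (intro allI impI)
      fix k1 k2 k3 k4 k5 k6
      assume eq: "k1 *s (s *s x1) + k2 *s (x2 - d' *s x1) + k3 *s (x3 + d *s x1) + k4 *s (s *s Y)
        + k5 *s (s *s Z) + k6 *s (c *s e) = 0" (is "?v = 0")
      have YY: "bracket T Y Y = 0" "bracket T Z Z = 0" "bracket T x1 x1 = 0" "bracket T x2 x2 = 0"
        using anticommutative_self[OF type_B_anticommutative[OF T]] by auto
      \<comment> \<open>Only \<open>Y\<close> and \<open>Z\<close> among the six vectors fail to
        annihilate both \<open>Y\<close> and \<open>Z\<close>, so these brackets isolate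
        \<open>k4\<close> and \<open>k5\<close>. Bracketing with \<open>x1\<close> and
        \<open>x2\<close> then isolates the first three coefficients.\<close>
      have "bracket T ?v Z = 0" "bracket T ?v Y = 0"
        unfolding eq by simp_all
      then have "k4 = 0" "k5 = 0"
        using \<open>s \<noteq> 0\<close> \<open>\<kappa> \<noteq> 0\<close> e(1) by (simp_all add: centr e YY \<kappa> swap[of Z Y])
      have "bracket T x1 ?v = 0" "bracket T x2 ?v = 0"
        unfolding eq by simp_all
      then have "k2 *s Y + k3 *s Z + 0 *s W = 0"
        and 2: "- (k1 * s) *s Y + k3 *s W + (k2 * d' - k3 * d) *s Y = 0"
        using \<open>k4 = 0\<close> \<open>k5 = 0\<close> by (simp_all add: centr e YY Y Z W sw algebra_simps)
      from indep[OF this(1)] have "k2 = 0" "k3 = 0"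
        by auto
      with 2 have "- (k1 * s) *s Y + 0 *s Z + 0 *s W = 0"
        by simp
      from indep[OF this] \<open>s \<noteq> 0\<close> have "k1 = 0"
        by simp
      with eq \<open>k2 = 0\<close> \<open>k3 = 0\<close> \<open>k4 = 0\<close> \<open>k5 = 0\<close> \<open>c \<noteq> 0\<close> e(1) have "k6 = 0"
        by simp
      with \<open>k1 = 0\<close> \<open>k2 = 0\<close> \<open>k3 = 0\<close> \<open>k4 = 0\<close> \<open>k5 = 0\<close>
      show "k1 = 0 \<and> k2 = 0 \<and> k3 = 0 \<and> k4 = 0 \<and> k5 = 0 \<and> k6 = 0"
        by blast
    qed
    show "bracket T (x2 - d' *s x1) (x3 + d *s x1) = 0 *s (s *s Y) + 0 *s (s *s Z) + 1 *s (c *s e)"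
      using anticommutative_self[OF type_B_anticommutative[OF T], of x1]
      by (simp add: Y Z W sw W_eq algebra_simps)
    show "bracket T (s *s Y) (s *s Z) = 1 *s (c *s e)"
      by (simp add: \<kappa> flip: s)
  qed (use anticommutative_self[OF type_B_anticommutative[OF T]] in
      \<open>simp_all add: Y Z centr e\<close>)
  then show ?thesis
    by (simp add: B61_tri)
qed

text \<open>
  When \<open>[A\<^sup>2, A]\<close> is a line, subtracting these multiples of \<open>y, z \<in> A\<^sup>2\<close> from a multiple of \<open>x\<close>
  makes it commute with \<open>y\<close> and \<open>z\<close>.
\<close>

definition adjust :: "(complex, 6) alg \<Rightarrow> complex ^ 6 \<Rightarrow> complex ^ 6 \<Rightarrow> complex ^ 6 \<Rightarrow> complex ^ 6" where
  "adjust \<mu> y z x = (bracket \<mu> y z $ 6) *s x - (bracket \<mu> x z $ 6) *s y + (bracket \<mu> x y $ 6) *s z"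

text \<open>Products of adjusted vectors are \<open>k * k * \<zeta> * \<zeta>\<close> times the
  original products plus a multiple of the central vector \<open>e\<close>. Adjusted vectors commute
  with \<open>y\<close> and \<open>z\<close>, hence also with the new \<open>Y\<close> and
  \<open>Z\<close>, as \<open>B61_orbit_adapted\<close> requires.\<close>

lemma B61_orbit_adjust:
  fixes x1 x2 x3 :: "complex ^ 6"
  assumes T: "T \<in> type_B"
    and yz: "y = bracket T x1 x2" "z = bracket T x1 x3"
    and x': "x1' = k *s adjust T y z x1" "x2' = k *s adjust T y z x2" "x3' = k *s adjust T y z x3"
    and YZW: "Y = bracket T x1' x2'" "Z = bracket T x1' x3'" "W = bracket T x2' x3'"
    and YZ: "bracket T Y Z \<noteq> 0"
    and indep: "\<And>a b c. a *s Y + b *s Z + c *s W = 0 \<Longrightarrow> a = 0 \<and> b = 0 \<and> c = 0"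
  shows "T \<in> orbit B61"
proof -
  note prod = type_B_products[OF T] and anti = type_B_anticommutative[OF T]
  note swap = anticommutative_swap[OF anti]
  define e where "e = (vec6 0 0 0 0 0 1 :: complex ^ 6)"
  have e: "bracket T x e = 0" "bracket T e x = 0" for x
    using prod(3)[of x 1] swap[of e x] by (simp_all add: e_def)
  have line: "bracket T x (bracket T s t) = (bracket T x (bracket T s t) $ 6) *s e" for x s t
    using prod(2)[of x s t] by (simp add: e_def)
  define \<zeta> where "\<zeta> = bracket T y z $ 6"
  have \<zeta>: "bracket T y z = \<zeta> *s e" "bracket T z y = - \<zeta> *s e" "bracket T y y = 0" "bracket T z z = 0"
    using line[of y x1 x3] swap[of z y] anticommutative_self[OF anti] by (simp_all add: yz(2) \<zeta>_def)
  have xy: "bracket T x y = (bracket T x y $ 6) *s e" "bracket T x z = (bracket T x z $ 6) *s e" for x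
    using line[of x x1 x2] line[of x x1 x3] by (simp_all add: yz)
  have adj_y: "bracket T (adjust T y z x) y = 0" and adj_z: "bracket T (adjust T y z x) z = 0" for x
    unfolding adjust_def \<zeta>_def[symmetric] by (simp_all add: \<zeta>, (subst xy(1) xy(2), simp)+)
  have prod_adj: "\<exists>l. bracket T (k *s adjust T y z a) (k *s adjust T y z b) = (k * k * \<zeta> * \<zeta>) *s bracket T a b + l *s e"
    for a b
  proof -
    define m where "m = bracket T a z $ 6 * (bracket T b y $ 6) - bracket T a y $ 6 * (bracket T b z $ 6)"
    have "bracket T (adjust T y z a) (adjust T y z b) = \<zeta> *s bracket T (adjust T y z a) b"
      by (subst (2) adjust_def) (simp add: adj_y adj_z \<zeta>_def)
    also have "bracket T (adjust T y z a) b = \<zeta> *s bracket T a b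
        + (bracket T a z $ 6) *s bracket T b y - (bracket T a y $ 6) *s bracket T b z"
      using swap[of y b] swap[of z b] by (simp add: adjust_def \<zeta>_def)
    also have "\<dots> = \<zeta> *s bracket T a b + m *s e"
      unfolding m_def by (subst xy(1)[of b], subst xy(2)[of b]) (simp add: vec.scale_left_diff_distrib)
    finally show ?thesis
      by (intro exI[of _ "k * k * \<zeta> * m"]) (simp add: vec.scale_right_distrib mult_ac)
  qed
  obtain l where l: "Y = (k * k * \<zeta> * \<zeta>) *s y + l *s e"
    using prod_adj[of x1 x2] by (auto simp: YZW x' yz)
  obtain m where m: "Z = (k * k * \<zeta> * \<zeta>) *s z + m *s e"
    using prod_adj[of x1 x3] by (auto simp: YZW x' yz)
  show ?thesis
    by (rule B61_orbit_adapted[OF T YZW(1)[symmetric] YZW(2)[symmetric] YZW(3)[symmetric] _ _ _ _ _ _ YZ indep])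
      (simp_all add: l m x' adj_y adj_z e)
qed

definition B61_test :: "(complex, 6) alg \<Rightarrow> complex" where
  "B61_test \<mu> = (let y = bracket \<mu> (\<e> 1) (\<e> 2); z = bracket \<mu> (\<e> 1) (\<e> 3);
     x1 = adjust \<mu> y z (\<e> 1); x2 = adjust \<mu> y z (\<e> 2); x3 = adjust \<mu> y z (\<e> 3)
   in bracket \<mu> (bracket \<mu> x1 x2) (bracket \<mu> x1 x3) $ 6 *
      minor3 (bracket \<mu> x1 x2) (bracket \<mu> x1 x3) (bracket \<mu> x2 x3))"

lemma poly_map_adjust:
  assumes "\<And>k. poly_map (\<lambda>\<mu>. F \<mu> $ k)" "\<And>k. poly_map (\<lambda>\<mu>. G \<mu> $ k)" "\<And>k. poly_map (\<lambda>\<mu>. H \<mu> $ k)"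
  shows "poly_map (\<lambda>\<mu>. adjust \<mu> (F \<mu>) (G \<mu>) (H \<mu>) $ k)"
  unfolding adjust_def by (simp, intro poly_map_intros poly_map_bracket assms)

lemma poly_map_B61_test: "poly_map B61_test"
  unfolding B61_test_def[abs_def] Let_def
  by (intro poly_map_intros poly_map_minor3 poly_map_bracket poly_map_adjust)

lemma B61_test_B61: "B61_test B61 \<noteq> 0"
  by (simp add: B61_test_def B61_tri basis_vec6 bracket_tri minor3_def adjust_def)

lemma B61_slice_type_B:
  assumes T: "T \<in> type_B" and orb: "\<mu> \<in> orbit T" and test: "B61_test \<mu> \<noteq> 0"
  shows "\<mu> \<in> orbit B61"
proof -
  obtain g where g: "invertible g" "\<mu> = gl_act g T"
    using orb unfolding orbit_def by blast
  let ?h = "\<lambda>x. matrix_inv g *v x"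
  have h: "?h (bracket \<mu> x y) = bracket T (?h x) (?h y)" for x y
    by (simp add: g(2) bracket_gl_act matrix_inv_cancel(1)[OF g(1)])
  define y where "y = bracket \<mu> (\<e> 1) (\<e> 2)"
  define z where "z = bracket \<mu> (\<e> 1) (\<e> 3)"
  define x1 where "x1 = adjust \<mu> y z (\<e> 1)"
  define x2 where "x2 = adjust \<mu> y z (\<e> 2)"
  define x3 where "x3 = adjust \<mu> y z (\<e> 3)"
  define Y where "Y = bracket \<mu> x1 x2"
  define Z where "Z = bracket \<mu> x1 x3"
  define W where "W = bracket \<mu> x2 x3"
  have ne: "bracket \<mu> Y Z \<noteq> 0" and minor: "minor3 Y Z W \<noteq> 0"
    using test by (auto simp: B61_test_def y_def z_def x1_def x2_def x3_def Y_def Z_def W_def)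
  \<comment> \<open>The sixth coordinate used by \<open>adjust\<close> is not invariant. But triple
    products of \<open>\<mu>\<close> lie on the image of the line of \<open>\<e> 6\<close> under
    \<open>g\<close>, so reading them in either basis differs by the one factor
    \<open>k\<close>.\<close>
  define k where "k = (g *v vec6 0 0 0 0 0 1) $ 6"
  have line: "bracket \<mu> a b $ 6 = k * (bracket T (?h a) (?h b) $ 6)"
    if "?h b = bracket T s t" for a b s t
  proof -
    define c where "c = bracket T (?h a) (?h b) $ 6"
    have "bracket T (?h a) (?h b) = vec6 0 0 0 0 0 c"
      unfolding c_def that by (rule type_B_products(2)[OF T])
    also have "\<dots> = c *s vec6 0 0 0 0 0 1"
      by simp
    finally have "bracket \<mu> a b = c *s (g *v vec6 0 0 0 0 0 1)"
      by (simp only: g(2) bracket_gl_act vec.scale)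
    then show ?thesis
      by (simp add: k_def c_def mult.commute)
  qed
  have adj: "?h (adjust \<mu> y z a) = k *s adjust T (?h y) (?h z) (?h a)" for a
  proof -
    have "bracket \<mu> y z $ 6 = k * (bracket T (?h y) (?h z) $ 6)"
      "bracket \<mu> a z $ 6 = k * (bracket T (?h a) (?h z) $ 6)"
      "bracket \<mu> a y $ 6 = k * (bracket T (?h a) (?h y) $ 6)"
      by (rule line[OF h[of "\<e> 1" "\<e> 3", folded z_def]] line[OF h[of "\<e> 1" "\<e> 2", folded y_def]])+
    then show ?thesis
      by (simp add: adjust_def vec.scale matrix_vector_right_distrib matrix_vector_mult_diff_distrib
        vec.scale_right_distrib vec.scale_right_diff_distrib)
  qed
  have "T \<in> orbit B61"
  proof (rule B61_orbit_adjust[OF T])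
    show "?h y = bracket T (?h (\<e> 1)) (?h (\<e> 2))" "?h z = bracket T (?h (\<e> 1)) (?h (\<e> 3))"
      by (simp_all only: h y_def z_def)
    show "?h x1 = k *s adjust T (?h y) (?h z) (?h (\<e> 1))" "?h x2 = k *s adjust T (?h y) (?h z) (?h (\<e> 2))"
      "?h x3 = k *s adjust T (?h y) (?h z) (?h (\<e> 3))"
      by (simp_all only: adj x1_def x2_def x3_def)
    show "?h Y = bracket T (?h x1) (?h x2)" "?h Z = bracket T (?h x1) (?h x3)" "?h W = bracket T (?h x2) (?h x3)"
      by (simp_all only: h Y_def Z_def W_def)
    have "g *v ?h (bracket \<mu> Y Z) \<noteq> 0"
      using ne by (simp add: matrix_inv_cancel(2)[OF g(1)])
    then show "bracket T (?h Y) (?h Z) \<noteq> 0"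
      unfolding h by auto
    have "minor3 (g *v ?h Y) (g *v ?h Z) (g *v ?h W) \<noteq> 0"
      using minor by (simp add: matrix_inv_cancel(2)[OF g(1)])
    from minor3_gl_act_independent[OF this]
    show "a = 0 \<and> b = 0 \<and> c = 0" if "a *s ?h Y + b *s ?h Z + c *s ?h W = 0" for a b c
      using that by blast
  qed
  then show ?thesis
    by (rule orbit_trans[OF orb])
qed

text \<open>The curve runs inside \<open>type_B\<close> to \<open>B61\<close>. The test polynomial
  pulled back to it plays the part of \<open>D\<close>, in place of an explicit genericity condition
  on the constants.\<close>

lemma type_B_closure: "type_B \<subseteq> zariski closure_of (orbit B61)"
proof
  fix \<mu> assume "\<mu> \<in> type_B"
  then obtain a4 a5 a6 b4 b5 b6 d4 d5 d6 p6 q6 r6 u v w z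
    where \<mu>: "\<mu> = tri 0 a4 a5 a6 b4 b5 b6 d4 d5 d6 0 p6 0 q6 0 r6 u v w z"
    unfolding type_B_def by blast
  define s where "s t a b = (1 - t) * a + t * b" for t a b :: complex
  define \<gamma> where "\<gamma> t = tri 0 (s t a4 1) (s t a5 0) (s t a6 0) (s t b4 0) (s t b5 1) (s t b6 0)
    (s t d4 0) (s t d5 0) (s t d6 1) 0 (s t p6 0) 0 (s t q6 0) 0 (s t r6 0) (s t u 0) (s t v 0) (s t w 0) (s t z 1)" for t
  have \<gamma>: "polyfun (\<lambda>t. \<gamma> t $ p)" for p
    unfolding \<gamma>_def s_def by (intro polyfun_tri polyfun_const polyfun_segment)
  moreover have "polyfun (\<lambda>t. B61_test (\<gamma> t))"
    by (rule polyfun_poly_map[OF poly_map_B61_test \<gamma>])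
  moreover have "B61_test (\<gamma> 1) \<noteq> 0"
    using B61_test_B61 by (simp add: \<gamma>_def s_def B61_tri)
  moreover have "\<gamma> t \<in> orbit B61" if "B61_test (\<gamma> t) \<noteq> 0" for t
  proof (rule B61_slice_type_B[OF _ orbit_refl that])
    show "\<gamma> t \<in> type_B"
      unfolding type_B_def \<gamma>_def by blast
  qed
  ultimately have "\<gamma> 0 \<in> zariski closure_of (orbit B61)"
    by (rule closure_of_curve)
  then show "\<mu> \<in> zariski closure_of (orbit B61)"
    by (simp add: \<gamma>_def \<mu> s_def)
qed

lemma B61_slice:
  assumes "\<mu> \<in> nilpotent_anticomm_CD" "B61_test \<mu> \<noteq> 0" "\<not> jacobi \<mu>"
  shows "\<mu> \<in> orbit B61"
proof -
  obtain T where T: "T \<in> type_B \<union> type_M \<union> type_g" and orb: "\<mu> \<in> orbit T"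
    using reducible_CD[OF assms(1)] unfolding reducible_to_types_def by blast
  have "\<not> metabelian \<mu>"
  proof
    assume "metabelian \<mu>"
    then have "B61_test \<mu> = 0"
      by (simp add: metabelian_def B61_test_def Let_def)
    with assms(2) show False ..
  qed
  with assms(3) have "T \<in> type_B"
    using T metabelian_orbit[OF orb type_M_metabelian] jacobi_orbit[OF orb type_g_jacobi] by blast
  then show ?thesis
    using B61_slice_type_B orb assms(2) by blast
qed

lemma not_jacobi_B61: "\<not> jacobi B61"
proof
  assume "jacobi B61"
  from this[unfolded jacobi_def, rule_format, of "\<e> 1" "\<e> 2" "\<e> 5"] show False
    by (simp add: B61_tri basis_vec6 bracket_tri)
qed

lemma rigid_B61: "rigid_in nilpotent_anticomm_CD B61"
  unfolding rigid_in_def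
proof
  have "openin zariski {\<mu> :: (complex, 6) alg. \<not> jacobi \<mu>}"
    using closedin_zariski_jacobi by (simp add: closedin_def Compl_eq_Diff_UNIV[symmetric] Collect_neg_eq)
  then have "openin zariski ({\<mu>. B61_test \<mu> \<noteq> 0} \<inter> {\<mu>. \<not> jacobi \<mu>})"
    by (intro openin_Int openin_zariski_nonzero poly_map_B61_test)
  then show "openin (subtopology zariski nilpotent_anticomm_CD) (orbit B61)"
    by (rule openin_orbit_if_slice[OF gl_invariant_CD B61_in_CD])
      (use B61_test_B61 not_jacobi_B61 B61_slice in auto)
qed (rule B61_in_CD)

section \<open>The irreducible components\<close>

text \<open>For closed \<open>L\<close>, the closed irreducible subsets of the subspace are those of
  \<open>X\<close> contained in \<open>L\<close>. Each lies in one of the three pieces, and since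
  these form an antichain they are the maximal ones.\<close>

lemma irreducible_components_closed_subset:
  assumes L: "closedin X L"
    and cover: "L = C1 \<union> C2 \<union> C3"
    and irr: "\<And>C. C \<in> {C1, C2, C3} \<Longrightarrow> closedin X C \<and> irreducible_in X C"
    and ne: "\<not> C1 \<subseteq> C2" "\<not> C1 \<subseteq> C3" "\<not> C2 \<subseteq> C1" "\<not> C2 \<subseteq> C3" "\<not> C3 \<subseteq> C1" "\<not> C3 \<subseteq> C2"
  shows "irreducible_components (subtopology X L) = {C1, C2, C3}"
proof -
  have closed: "closedin (subtopology X L) C \<longleftrightarrow> closedin X C \<and> C \<subseteq> L" for C
    using L by (simp add: closedin_closed_subtopology)
  have sub: "L \<subseteq> topspace X"
    using L by (rule closedin_subset)
  have irrD: "S \<subseteq> C \<or> S \<subseteq> D"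
    if "irreducible_in Y S" "closedin Y C" "closedin Y D" "S \<subseteq> C \<union> D" for Y :: "'a topology" and S C D
    using that unfolding irreducible_in_def by simp
  have irr_sub: "irreducible_in (subtopology X L) C \<longleftrightarrow> irreducible_in X C \<and> C \<subseteq> L" for C
  proof
    assume C: "irreducible_in (subtopology X L) C"
    then have "C \<subseteq> L" "C \<noteq> {}"
      unfolding irreducible_in_def by simp_all
    moreover have "C \<subseteq> D \<or> C \<subseteq> E" if "closedin X D" "closedin X E" "C \<subseteq> D \<union> E" for D E
    proof -
      have "closedin (subtopology X L) (D \<inter> L)" "closedin (subtopology X L) (E \<inter> L)"
        using that L unfolding closed by auto
      moreover have "C \<subseteq> (D \<inter> L) \<union> (E \<inter> L)"
        using that(3) \<open>C \<subseteq> L\<close> by auto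
      ultimately have "C \<subseteq> D \<inter> L \<or> C \<subseteq> E \<inter> L"
        by (rule irrD[OF C])
      then show ?thesis
        by auto
    qed
    ultimately show "irreducible_in X C \<and> C \<subseteq> L"
      using sub unfolding irreducible_in_def by simp
  next
    assume C: "irreducible_in X C \<and> C \<subseteq> L"
    then show "irreducible_in (subtopology X L) C"
      unfolding irreducible_in_def closed by simp
  qed
  have max: "\<exists>C\<in>{C1, C2, C3}. D \<subseteq> C" if D: "irreducible_in X D" "D \<subseteq> L" for D
  proof -
    have cl: "closedin X C1" "closedin X C2" "closedin X C3"
      using irr by auto
    have "D \<subseteq> C1 \<union> (C2 \<union> C3)"
      using D(2) unfolding cover by (simp only: Un_assoc)
    then consider "D \<subseteq> C1" | "D \<subseteq> C2 \<union> C3"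
      using irrD[OF D(1) cl(1) closedin_Un[OF cl(2,3)]] by argo
    then show ?thesis
    proof cases
      case 2
      from irrD[OF D(1) cl(2,3) this] show ?thesis
        by auto
    qed simp
  qed
  have antichain: "C = E" if "C \<in> {C1, C2, C3}" "E \<in> {C1, C2, C3}" "C \<subseteq> E" for C E
    using that ne by (metis empty_iff insert_iff)
  show ?thesis
    unfolding irreducible_components_def closed irr_sub
  proof (intro equalityI subsetI)
    fix C assume C: "C \<in> {C1, C2, C3}"
    then have "C \<subseteq> L"
      using cover by auto
    moreover have "D = C" if D: "irreducible_in X D" "D \<subseteq> L" "C \<subseteq> D" for D
    proof -
      obtain E where E: "E \<in> {C1, C2, C3}" "D \<subseteq> E"
        using max[OF D(1,2)] by blast
      then have "C = E"
        using antichain[OF C E(1)] D(3) by simp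
      with E(2) D(3) show ?thesis
        by simp
    qed
    ultimately show "C \<in> {C. (closedin X C \<and> C \<subseteq> L) \<and> (irreducible_in X C \<and> C \<subseteq> L) \<and>
        (\<forall>D. (closedin X D \<and> D \<subseteq> L) \<and> (irreducible_in X D \<and> D \<subseteq> L) \<and> C \<subseteq> D \<longrightarrow> D = C)}"
      using irr[OF C] by simp
  next
    fix C assume C: "C \<in> {C. (closedin X C \<and> C \<subseteq> L) \<and> (irreducible_in X C \<and> C \<subseteq> L) \<and>
        (\<forall>D. (closedin X D \<and> D \<subseteq> L) \<and> (irreducible_in X D \<and> D \<subseteq> L) \<and> C \<subseteq> D \<longrightarrow> D = C)}"
    then have "irreducible_in X C" "C \<subseteq> L"
      and C_max: "\<And>D. closedin X D \<Longrightarrow> D \<subseteq> L \<Longrightarrow> irreducible_in X D \<Longrightarrow> C \<subseteq> D \<Longrightarrow> D = C"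
      by simp_all
    from max[OF this(1,2)] obtain E where E: "E \<in> {C1, C2, C3}" "C \<subseteq> E"
      by blast
    then have "E \<subseteq> L"
      using cover by auto
    with C_max irr[OF E(1)] E(2) have "E = C"
      by simp
    with E(1) show "C \<in> {C1, C2, C3}"
      by simp
  qed
qed

theorem theorem11:
  fixes L :: "(complex, 6) alg set"
  defines "L \<equiv> nilpotent_anticomm_CD"
  shows "irreducible_components (subtopology zariski L) =
           {zariski closure_of (\<Union>\<epsilon>. orbit (M6 \<epsilon>)),
            zariski closure_of (orbit B61),
            zariski closure_of (orbit g6)}
       \<and> card (irreducible_components (subtopology zariski L)) = 3
       \<and> rigid_in L B61 \<and> rigid_in L g6"
proof -
  let ?M = "zariski closure_of (\<Union>\<epsilon>. orbit (M6 \<epsilon>))" and ?B = "zariski closure_of (orbit B61)"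
    and ?g = "zariski closure_of (orbit g6)"
  have inv: "gl_invariant ?M" "gl_invariant ?B" "gl_invariant ?g"
    by (intro gl_invariant_closure_of gl_invariant_UN gl_invariant_orbit)+
  have orbit_L: "orbit \<mu> \<subseteq> L" if "\<mu> \<in> L" for \<mu>
    using gl_invariantD[OF gl_invariant_CD] that unfolding L_def by blast
  have "zariski closure_of S \<subseteq> L" if "S \<subseteq> L" for S
    using that closedin_zariski_CD unfolding L_def by (rule closure_of_minimal)
  then have "?M \<subseteq> L" "?B \<subseteq> L" "?g \<subseteq> L"
    using orbit_L M6_in_CD B61_in_CD g6_in_CD unfolding L_def by (simp_all add: UN_least)
  moreover have "L \<subseteq> ?M \<union> ?B \<union> ?g"
  proof
    fix \<mu> assume "\<mu> \<in> L"
    then obtain T where "T \<in> type_B \<union> type_M \<union> type_g" and orb: "\<mu> \<in> orbit T"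
      using reducible_CD unfolding reducible_to_types_def L_def by blast
    then consider "T \<in> ?M" | "T \<in> ?B" | "T \<in> ?g"
      using type_M_closure type_B_closure type_g_closure by blast
    then show "\<mu> \<in> ?M \<union> ?B \<union> ?g"
      by cases (use gl_invariantD[OF inv(1) _ orb] gl_invariantD[OF inv(2) _ orb]
        gl_invariantD[OF inv(3) _ orb] in auto)
  qed
  ultimately have cover: "L = ?M \<union> ?B \<union> ?g"
    by blast
  \<comment> \<open>A single orbit is a family with constant parameter.\<close>
  have irr_orbit: "irreducible_in zariski (zariski closure_of (orbit \<mu>))" for \<mu> :: "(complex, 6) alg"
    using irreducible_in_orbits[of "\<lambda>_. \<mu>"] by (simp add: polyfun_const)
  have "polyfun (\<lambda>t. M6 t $ p)" for p
    unfolding M6_tri by (intro polyfun_tri polyfun_const polyfun_id)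
  then have irr_M: "irreducible_in zariski ?M"
    by (rule irreducible_in_orbits)
  have mem: "M6 0 \<in> ?M" "B61 \<in> ?B" "g6 \<in> ?g"
    by (auto intro!: subsetD[OF closure_of_subset] intro: orbit_refl)
  have sub: "zariski closure_of S \<subseteq> {\<mu>. P \<mu>}"
    if "closedin zariski {\<mu>. P \<mu>}" "\<And>\<mu>. \<mu> \<in> S \<Longrightarrow> P \<mu>" for S and P :: "(complex, 6) alg \<Rightarrow> bool"
    using that by (intro closure_of_minimal) auto
  have M6_type: "M6 \<epsilon> \<in> type_M" for \<epsilon>
    unfolding M6_tri type_M_def by blast
  have B61_type: "B61 \<in> type_B"
    unfolding B61_tri type_B_def by blast
  have "tri 1 0 0 0 1 0 0 0 1 0 1 0 0 (0 * 1) 0 (- 1 * 1) 0 1 0 0 \<in> type_g"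
    unfolding type_g_def by blast
  then have g6_type: "g6 \<in> type_g"
    unfolding g6_tri by simp
  have M_sub: "?M \<subseteq> {\<mu>. metabelian \<mu>}"
    by (rule sub[OF closedin_zariski_metabelian]) (auto intro: metabelian_orbit[OF _ type_M_metabelian[OF M6_type]])
  have B_sub: "?B \<subseteq> {\<mu>. class3 \<mu>}"
    by (rule sub[OF closedin_zariski_class3 class3_orbit[OF _ type_B_class3[OF B61_type]]])
  have g_sub: "?g \<subseteq> {\<mu>. jacobi \<mu>}"
    by (rule sub[OF closedin_zariski_jacobi jacobi_orbit[OF _ type_g_jacobi[OF g6_type]]])
  \<comment> \<open>The Jacobi sum of \<open>\<e> 1\<close>, \<open>\<e> 2\<close>,
    \<open>\<e> 4\<close> in \<open>M6 \<epsilon>\<close> is \<open>1 - \<epsilon>\<close> times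
    \<open>\<e> 6\<close>, so \<open>\<epsilon> = 0\<close> is a suitable witness for the
    family.\<close>
  have "\<not> jacobi (M6 0)" "\<not> class3 (M6 0)"
  proof -
    show "\<not> jacobi (M6 0)"
      unfolding jacobi_def not_all
      by (rule exI[of _ "\<e> 1"], rule exI[of _ "\<e> 2"], rule exI[of _ "\<e> 4"])
        (simp add: M6_tri basis_vec6 bracket_tri)
    show "\<not> class3 (M6 0)"
      unfolding class3_def not_all
      by (rule exI[of _ "\<e> 1"], rule exI[of _ "\<e> 2"], rule exI[of _ "\<e> 1"], rule exI[of _ "\<e> 1"])
        (simp add: M6_tri basis_vec6 bracket_tri)
  qed
  moreover have "\<not> metabelian B61"
    unfolding metabelian_def not_all
    by (rule exI[of _ "\<e> 1"], rule exI[of _ "\<e> 2"], rule exI[of _ "\<e> 1"], rule exI[of _ "\<e> 3"])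
      (simp add: B61_tri basis_vec6 bracket_tri)
  moreover have "\<not> metabelian g6" "\<not> class3 g6"
  proof -
    show "\<not> metabelian g6"
      unfolding metabelian_def not_all
      by (rule exI[of _ "\<e> 1"], rule exI[of _ "\<e> 2"], rule exI[of _ "\<e> 1"], rule exI[of _ "\<e> 3"])
        (simp add: g6_tri basis_vec6 bracket_tri)
    show "\<not> class3 g6"
      unfolding class3_def not_all
      by (rule exI[of _ "\<e> 1"], rule exI[of _ "\<e> 2"], rule exI[of _ "\<e> 1"], rule exI[of _ "\<e> 1"])
        (simp add: g6_tri basis_vec6 bracket_tri)
  qed
  ultimately have ne: "\<not> ?M \<subseteq> ?B" "\<not> ?M \<subseteq> ?g" "\<not> ?B \<subseteq> ?M" "\<not> ?B \<subseteq> ?g" "\<not> ?g \<subseteq> ?M" "\<not> ?g \<subseteq> ?B"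
    using mem M_sub B_sub g_sub not_jacobi_B61 by auto
  have comps: "irreducible_components (subtopology zariski L) = {?M, ?B, ?g}"
    by (rule irreducible_components_closed_subset[OF _ cover _ ne])
      (use irr_M irr_orbit in \<open>auto simp: L_def closedin_zariski_CD\<close>)
  moreover have "?M \<noteq> ?B" "?M \<noteq> ?g" "?B \<noteq> ?g"
    using ne by auto
  then have "card {?M, ?B, ?g} = 3"
    by simp
  ultimately show ?thesis
    using rigid_B61 rigid_g6 unfolding L_def by simp
qed

end
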